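(* Let $\Omega\subset\mathbb{R}^n$ be a bounded domain with smooth boundary, let $f,h\in C^1(\mathbb{R})$, and let $a\in C^{1,1}_{loc}((0,+\infty))$ satisfy $a(t)>0$ and $a(t)+a'(t)t>0$ for every $t\in(0,+\infty)$. Let $u\in C^2(\overline{\Omega})$ be a stable weak solution (in the sense defined in the context) of $$\operatorname{div}(a(|\nabla u|)\nabla u)+f(u)=0\ \text{ in }\Omega,\qquad a(|\nabla u|)\,\partial_\nu u+h(u)=0\ \text{ on }\partial\Omega .$$ Then, for every $\varphi\in C^1(\overline{\Omega})$, $$\int_{\{\nabla u\neq 0\}\cap\Omega}\Big[\sum_{i=1}^n\langle A(\nabla u)\nabla u_i,\nabla u_i\rangle-\langle A(\nabla u)\nabla|\nabla u|,\nabla|\nabla u|\rangle\Big]\varphi^2\,dx$$ $$+\int_{\partial\Omega}\Big(f(u)\,\partial_\nu u-a(|\nabla u|)\langle\nabla u,\partial_\nu\nabla u\rangle-h(u)\,\Delta u-h'(u)|\nabla u|^2\Big)\varphi^2\,d\sigma$$ $$\leq\int_\Omega|\nabla u|^2\,\langle A(\nabla u)\nabla\varphi,\nabla\varphi\rangle\,dx .$$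
   Context: Notation: $\nu$ is the external unit normal to $\partial\Omega$; $u_i=\partial_{x_i}u$; $\partial_\nu\nabla u=(\partial_\nu u_1,\ldots,\partial_\nu u_n)$; $\langle\cdot,\cdot\rangle$ is the Euclidean scalar product; $\sigma$ is surface measure on $\partial\Omega$. For $\xi\in\mathbb{R}^n\setminus\{0\}$, $A(\xi)$ is the $n\times n$ matrix with entries $$A_{hk}(\xi)=\frac{a'(|\xi|)}{|\xi|}\xi_h\xi_k+a(|\xi|)\delta_{hk},\qquad 1\le h,k\le n.$$ When condition (A2) below holds, $A$ extends continuously to $\xi=0$ by $A(0)=a(0)\,\mathrm{Id}$, and this extension is used. Weak solution: $u$ is a weak solution of the boundary value problem if $u\in C^1(\overline\Omega)$, $$\int_\Omega a(|\nabla u|)\langle\nabla u,\nabla\varphi\rangle\,dx+\int_{\partial\Omega}h(u)\varphi\,d\sigma-\int_\Omega f(u)\varphi\,dx=0\quad\text{for all }\varphi\in C^1(\overline\Omega),$$ and at least one of the following holds: (A1) $\{x\in\overline\Omega:\nabla u(x)=0\}=\varnothing$; (A2) $a\in C^0([0,+\infty))$ and the map $t\mapsto t\,a(t)$ belongs to $C^1([0,+\infty))$. Stability: a weak solution $u$ is stable if $$\int_\Omega\langle A(\nabla u)\nabla\varphi,\nabla\varphi\rangle\,dx+\int_{\partial\Omega}h'(u)\varphi^2\,d\sigma-\int_\Omega f'(u)\varphi^2\,dx\ge0\quad\text{for all }\varphi\in C^1(\overline\Omega).$$ *)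

theory Defs
  imports "HOL-Analysis.Analysis"
begin

text \<open>
  Functions on the closure of an open set \<open>U\<close> are total functions; only their values on
  \<open>closure U\<close> matter.  Derivatives are taken inside \<open>U\<close> and extended to \<open>frontier U\<close> by limits from
  inside \<open>U\<close>, and \<open>u \<in> C\<^sup>m(closure U)\<close> means that all partial derivatives of \<open>u\<close> up to order \<open>m\<close>
  exist in \<open>U\<close> and extend continuously to \<open>closure U\<close>.
\<close>

definition ext_closure :: "(real^'n) set \<Rightarrow> (real^'n \<Rightarrow> real) \<Rightarrow> real^'n \<Rightarrow> real" where
  "ext_closure U g x = (if x \<in> U then g x else Lim (at x within U) g)"

definition partial :: "(real^'n) set \<Rightarrow> 'n \<Rightarrow> (real^'n \<Rightarrow> real) \<Rightarrow> real^'n \<Rightarrow> real" where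
  "partial U i u = ext_closure U (\<lambda>x. frechet_derivative u (at x) (axis i 1))"

definition grad :: "(real^'n) set \<Rightarrow> (real^'n \<Rightarrow> real) \<Rightarrow> real^'n \<Rightarrow> real^'n" where
  "grad U u x = (\<chi> i. partial U i u x)"

definition laplacian :: "(real^'n) set \<Rightarrow> (real^'n \<Rightarrow> real) \<Rightarrow> real^'n \<Rightarrow> real" where
  "laplacian U u x = (\<Sum>i\<in>UNIV. partial U i (partial U i u) x)"

text \<open>
  For \<open>U = UNIV\<close> this is \<open>C\<^sup>m(\<real>\<^sup>n)\<close>.  In the successor step, differentiability in \<open>U\<close> is automatic
  from the existence of continuous partial derivatives; it is stated because \<^const>\<open>partial\<close> is
  meaningful only for differentiable functions.
\<close>

primrec Ck_closure :: "nat \<Rightarrow> (real^'n) set \<Rightarrow> (real^'n \<Rightarrow> real) \<Rightarrow> bool" where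
  "Ck_closure 0 U u \<longleftrightarrow> continuous_on (closure U) u"
| "Ck_closure (Suc m) U u \<longleftrightarrow>
     continuous_on (closure U) u \<and> (\<forall>x\<in>U. u differentiable (at x)) \<and>
     (\<forall>i. Ck_closure m U (partial U i u))"

text \<open>
  Inside \<open>ball c r\<close> the set \<open>\<Omega>\<close> is the part of the ball on one side (chosen by the sign \<open>s\<close>) of the
  graph \<open>x\<^sub>k = \<gamma>(x')\<close>, where \<open>x'\<close> consists of the coordinates of \<open>x\<close> other than \<open>x\<^sub>k\<close>.  The function
  \<open>\<gamma>\<close> on \<open>\<real>\<^sup>n\<^sup>-\<^sup>1\<close> is represented by a function on \<open>\<real>\<^sup>n\<close> that does not depend on \<open>x\<^sub>k\<close>.
\<close>

definition graph_patch ::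
    "(real^'n) set \<Rightarrow> real^'n \<Rightarrow> real \<Rightarrow> 'n \<Rightarrow> real \<Rightarrow> (real^'n \<Rightarrow> real) \<Rightarrow> bool" where
  "graph_patch \<Omega> c r k s \<gamma> \<longleftrightarrow>
     0 < r \<and> (s = 1 \<or> s = - 1) \<and> (\<forall>m. Ck_closure m UNIV \<gamma>) \<and>
     (\<forall>x y. (\<forall>i. i \<noteq> k \<longrightarrow> x $ i = y $ i) \<longrightarrow> \<gamma> x = \<gamma> y) \<and>
     \<Omega> \<inter> ball c r = {x \<in> ball c r. 0 < s * (x $ k - \<gamma> x)}"

definition smooth_boundary :: "(real^'n) set \<Rightarrow> bool" where
  "smooth_boundary \<Omega> \<longleftrightarrow> (\<forall>p\<in>frontier \<Omega>. \<exists>r k s \<gamma>. graph_patch \<Omega> p r k s \<gamma>)"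

definition bounded_smooth_domain :: "(real^'n) set \<Rightarrow> bool" where
  "bounded_smooth_domain \<Omega> \<longleftrightarrow>
     open \<Omega> \<and> connected \<Omega> \<and> \<Omega> \<noteq> {} \<and> bounded \<Omega> \<and> smooth_boundary \<Omega>"

text \<open>
  The exterior unit normal at \<open>p\<close>: the unit vector orthogonal to the velocities of all curves in the
  boundary through \<open>p\<close> and pointing out of \<open>\<Omega>\<close>.  The curves need not be continuous away from
  parameter \<open>0\<close>, so a curve defined near \<open>0\<close> only is covered by extending it with the value \<open>p\<close>.
\<close>

definition outer_normal :: "(real^'n) set \<Rightarrow> real^'n \<Rightarrow> real^'n" where
  "outer_normal \<Omega> p = (THE v.
     norm v = 1 \<and>
     (\<forall>g d. (\<forall>t. g t \<in> frontier \<Omega>) \<and> g 0 = p \<and> (g has_vector_derivative d) (at (0::real))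
        \<longrightarrow> v \<bullet> d = 0) \<and>
     (\<forall>\<^sub>F t in at_right 0. p + t *\<^sub>R v \<notin> closure \<Omega>))"

definition normal_deriv :: "(real^'n) set \<Rightarrow> (real^'n \<Rightarrow> real) \<Rightarrow> real^'n \<Rightarrow> real" where
  "normal_deriv \<Omega> u x = grad \<Omega> u x \<bullet> outer_normal \<Omega> x"

definition normal_deriv_grad :: "(real^'n) set \<Rightarrow> (real^'n \<Rightarrow> real) \<Rightarrow> real^'n \<Rightarrow> real^'n" where
  "normal_deriv_grad \<Omega> u x = (\<chi> i. normal_deriv \<Omega> (partial \<Omega> i u) x)"

text \<open>
  The surface measure of the part of the graph of \<open>\<gamma>\<close> inside \<open>ball c r\<close>: the image of
  \<open>sqrt (1 + |\<nabla>\<gamma>|\<^sup>2) dx'\<close> under the graph map, where \<open>dx'\<close> is the Lebesgue measure on the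
  coordinates other than \<open>x\<^sub>k\<close>.  For \<open>n = 1\<close> it is the unit point mass.
\<close>

definition base_point :: "'n \<Rightarrow> (real^'n \<Rightarrow> real) \<Rightarrow> real^'n" where
  "base_point k y = (\<Sum>b\<in>Basis - {axis k 1}. y b *\<^sub>R b)"

definition graph_measure ::
    "real^'n \<Rightarrow> real \<Rightarrow> 'n \<Rightarrow> (real^'n \<Rightarrow> real) \<Rightarrow> (real^'n) measure" where
  "graph_measure c r k \<gamma> =
     density
       (distr
          (density (PiM (Basis - {axis k 1}) (\<lambda>_. lborel))
             (\<lambda>y. ennreal (sqrt (1 + (norm (grad UNIV \<gamma> (base_point k y)))\<^sup>2))))
          borel
          (\<lambda>y. base_point k y + \<gamma> (base_point k y) *\<^sub>R axis k 1))
       (indicator (ball c r))"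

text \<open>
  The measures of two graph patches agree on the intersection of their balls, so the least upper
  bound in the lattice of measures glues them: it is the unique Borel measure that is concentrated
  on \<open>frontier \<Omega>\<close> and restricts to \<open>graph_measure c r k \<gamma>\<close> on the ball of each graph patch.
\<close>

definition surface_measure :: "(real^'n) set \<Rightarrow> (real^'n) measure" where
  "surface_measure \<Omega> = Sup {graph_measure c r k \<gamma> | c r k s \<gamma>. graph_patch \<Omega> c r k s \<gamma>}"

definition C11_loc_pos :: "(real \<Rightarrow> real) \<Rightarrow> bool" where
  "C11_loc_pos a \<longleftrightarrow> a C1_differentiable_on {0<..} \<and>
     (\<forall>K. compact K \<and> K \<subseteq> {0<..} \<longrightarrow> (\<exists>L. L-lipschitz_on K (deriv a)))"

text \<open>The value at \<open>0\<close> is relevant only under \<open>cond_A2\<close>, where it is the continuous extension.\<close>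

definition A_mat :: "(real \<Rightarrow> real) \<Rightarrow> real^'n \<Rightarrow> real^'n^'n" where
  "A_mat a \<xi> =
     (if \<xi> = 0 then a 0 *\<^sub>R mat 1
      else (\<chi> h k. deriv a (norm \<xi>) / norm \<xi> * \<xi> $ h * \<xi> $ k
                   + a (norm \<xi>) * (if h = k then 1 else 0)))"

definition cond_A1 :: "(real^'n) set \<Rightarrow> (real^'n \<Rightarrow> real) \<Rightarrow> bool" where
  "cond_A1 \<Omega> u \<longleftrightarrow> {x \<in> closure \<Omega>. grad \<Omega> u x = 0} = {}"

definition cond_A2 :: "(real \<Rightarrow> real) \<Rightarrow> bool" where
  "cond_A2 a \<longleftrightarrow> continuous_on {0..} a \<and>
     (\<exists>D. continuous_on {0..} D \<and>
        (\<forall>t\<ge>0. ((\<lambda>t. t * a t) has_real_derivative D t) (at t within {0..})))"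

definition weak_solution ::
    "(real^'n) set \<Rightarrow> (real \<Rightarrow> real) \<Rightarrow> (real \<Rightarrow> real) \<Rightarrow> (real \<Rightarrow> real) \<Rightarrow> (real^'n \<Rightarrow> real) \<Rightarrow> bool"
  where
  "weak_solution \<Omega> a f h u \<longleftrightarrow>
     Ck_closure 1 \<Omega> u \<and>
     (\<forall>\<phi>. Ck_closure 1 \<Omega> \<phi> \<longrightarrow>
        (LINT x:\<Omega>|lborel. a (norm (grad \<Omega> u x)) * (grad \<Omega> u x \<bullet> grad \<Omega> \<phi> x))
        + (LINT x:frontier \<Omega>|surface_measure \<Omega>. h (u x) * \<phi> x)
        - (LINT x:\<Omega>|lborel. f (u x) * \<phi> x) = 0) \<and>
     (cond_A1 \<Omega> u \<or> cond_A2 a)"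

definition stable_solution ::
    "(real^'n) set \<Rightarrow> (real \<Rightarrow> real) \<Rightarrow> (real \<Rightarrow> real) \<Rightarrow> (real \<Rightarrow> real) \<Rightarrow> (real^'n \<Rightarrow> real) \<Rightarrow> bool"
  where
  "stable_solution \<Omega> a f h u \<longleftrightarrow>
     (\<forall>\<phi>. Ck_closure 1 \<Omega> \<phi> \<longrightarrow>
        (LINT x:\<Omega>|lborel. (A_mat a (grad \<Omega> u x) *v grad \<Omega> \<phi> x) \<bullet> grad \<Omega> \<phi> x)
        + (LINT x:frontier \<Omega>|surface_measure \<Omega>. deriv h (u x) * (\<phi> x)\<^sup>2)
        - (LINT x:\<Omega>|lborel. deriv f (u x) * (\<phi> x)\<^sup>2) \<ge> 0)"

end

theory Submission
  imports Defs
begin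

text \<open>
  Write \<open>X = a(|\<nabla>u|)\<nabla>u\<close>.  Testing the equation linearised in direction \<open>x\<^sub>k\<close> with \<open>u\<^sub>k \<phi>\<^sup>2\<close>,
  summing over \<open>k\<close>, and subtracting the stability inequality for the test function
  \<open>(|\<nabla>u|\<^sup>2 + \<epsilon>)\<^sup>1\<^sup>/\<^sup>2 \<phi>\<close> gives the claim as \<open>\<epsilon> \<rightarrow> 0\<close>; on \<open>{\<nabla>u = 0}\<close> an additional term
  \<open>a(0)|D\<^sup>2u|\<^sup>2\<phi>\<^sup>2 \<ge> 0\<close> appears on the left and is dropped.

  As \<open>u\<close> is only \<open>C\<^sup>2\<close>, derivatives of test functions are not admissible in the weak formulation.
  The linearised equation follows instead from
  \<open>\<integral>\<^sub>\<Omega> (\<partial>\<^sub>kX\<^sub>j \<partial>\<^sub>j\<psi> - \<partial>\<^sub>jX\<^sub>j \<partial>\<^sub>k\<psi>) = \<integral>\<^sub>\<partial>\<^sub>\<Omega> X\<^sub>j (\<partial>\<^sub>j\<psi> \<nu>\<^sub>k - \<partial>\<^sub>k\<psi> \<nu>\<^sub>j)\<close>, which needs only \<open>X\<close>, \<open>\<psi>\<close> of class \<open>C\<^sup>1\<close>,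
  and from \<open>div X = - f(u)\<close>.  This identity and the divergence theorem are obtained from cutoff
  functions with compact support in \<open>\<Omega>\<close> whose gradients converge weakly to \<open>- \<nu> \<sigma>\<close>.
\<close>

subsection \<open>Continuously differentiable functions and partitions of unity\<close>

text \<open>For a component \<open>Y\<close> of \<open>X\<close> the expression \<open>\<partial>_k
  Y \<partial>_j \<psi> - \<partial>_j Y \<partial>_k \<psi>\<close> is formally the divergence
  \<open>\<partial>_k (Y \<partial>_j \<psi>) - \<partial>_j (Y \<partial>_k \<psi>)\<close>, since
  the mixed second derivatives of \<open>\<psi>\<close> cancel. For compact supports this can be
  proved by moving a difference quotient from one factor to the other. After multiplication by a
  cutoff, the gradient of the cutoff carries the whole boundary contribution, so the same cutoffs
  give both integral identities.

  The surface measure is a supremum over all graph patches and is hard to evaluate until the patch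
  measures are known to agree on overlaps. Hence the cutoffs are built on single patches, where
  Fubini in graph coordinates handles the boundary layer; the local divergence theorem that results
  is what proves the agreement.

  The boundary condition is used only under integrals. Its weight there is
  \<open>\<Delta>u \<phi>^2\<close>, which is merely continuous, so it has to be extended from
  \<open>C^1\<close> test functions by density. The regularisation by \<open>\<epsilon>\<close> is
  forced by \<open>|\<nabla>u|\<close>, which may fail to be \<open>C^1\<close> at critical points
  of \<open>u\<close>.\<close>

definition C1_with_grad ::
    "(real^'n) set \<Rightarrow> (real^'n \<Rightarrow> real) \<Rightarrow> (real^'n \<Rightarrow> real^'n) \<Rightarrow> bool" where
  "C1_with_grad U g G \<longleftrightarrow>
     continuous_on (closure U) g \<and> continuous_on (closure U) G \<and>
     (\<forall>x\<in>U. (g has_derivative (\<lambda>v. G x \<bullet> v)) (at x))"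

lemma C1_with_gradD:
  assumes "C1_with_grad U g G"
  shows "continuous_on (closure U) g" "continuous_on (closure U) G"
    "x \<in> U \<Longrightarrow> (g has_derivative (\<lambda>v. G x \<bullet> v)) (at x)"
  using assms by (auto simp: C1_with_grad_def)

lemma has_derivative_grad:
  assumes "x \<in> U" "g differentiable (at x)"
  shows "(g has_derivative (\<lambda>v. grad U g x \<bullet> v)) (at x)"
proof -
  let ?f = "frechet_derivative g (at x)"
  have d: "(g has_derivative ?f) (at x)"
    using assms(2) frechet_derivative_works by blast
  then have lin: "linear ?f"
    using has_derivative_linear by blast
  have "?f v = grad U g x \<bullet> v" for v
  proof -
    have "?f v = ?f (\<Sum>i\<in>UNIV. v $ i *\<^sub>R axis i 1)"
      by (simp add: basis_expansion flip: scalar_mult_eq_scaleR)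
    also have "\<dots> = (\<Sum>i\<in>UNIV. v $ i * ?f (axis i 1))"
      by (simp add: linear_sum[OF lin] linear_cmul[OF lin])
    also have "\<dots> = grad U g x \<bullet> v"
      using assms(1)
      by (simp add: grad_def partial_def ext_closure_def inner_vec_def mult.commute)
    finally show ?thesis .
  qed
  then have "?f = (\<lambda>v. grad U g x \<bullet> v)" by auto
  then show ?thesis using d by simp
qed

lemma Ck_closure_1_C1_with_grad:
  assumes "Ck_closure 1 U g"
  shows "C1_with_grad U g (grad U g)"
proof -
  have "continuous_on (closure U) (grad U g)"
    unfolding grad_def using assms by (intro continuous_on_vec_lambda) auto
  then show ?thesis
    using assms has_derivative_grad by (auto simp: C1_with_grad_def)
qed

text \<open>A point of \<open>closure U\<close> outside \<open>U\<close> is a limit point of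
  \<open>U\<close>, so the limit that defines \<open>partial\<close> there is unique, and continuity
  of \<open>G\<close> up to the boundary provides it. Thus an explicit formula for \<open>G\<close>
  may replace \<open>grad U g\<close> on the whole closure.\<close>

lemma C1_with_grad_partial:
  assumes "open U" and g: "C1_with_grad U g G" and x: "x \<in> closure U"
  shows "partial U i g x = G x $ i"
proof -
  have eq: "frechet_derivative g (at y) (axis i 1) = G y $ i" if "y \<in> U" for y
    using frechet_derivative_at[OF C1_with_gradD(3)[OF g that], symmetric]
    by (simp add: inner_axis)
  show ?thesis
  proof (cases "x \<in> U")
    case True
    then show ?thesis by (simp add: partial_def ext_closure_def eq)
  next
    case False
    then have "x islimpt U"
      using x by (simp add: closure_def)
    then have nb: "at x within U \<noteq> bot"
      by (simp add: trivial_limit_within)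
    have "continuous_on (closure U) (\<lambda>x. G x $ i)"
      using C1_with_gradD(2)[OF g] by (intro continuous_intros)
    then have "((\<lambda>y. G y $ i) \<longlongrightarrow> G x $ i) (at x within U)"
      using x by (meson closure_subset continuous_on_def tendsto_within_subset)
    then have "((\<lambda>y. frechet_derivative g (at y) (axis i 1)) \<longlongrightarrow> G x $ i) (at x within U)"
      by (rule Lim_transform_eventually) (auto simp: eventually_at_filter eq)
    then have "Lim (at x within U) (\<lambda>y. frechet_derivative g (at y) (axis i 1)) = G x $ i"
      using nb tendsto_Lim by blast
    then show ?thesis using False by (simp add: partial_def ext_closure_def)
  qed
qed

lemma C1_with_grad_grad:
  assumes "open U" "C1_with_grad U g G" "x \<in> closure U"
  shows "grad U g x = G x"
  using C1_with_grad_partial[OF assms] by (simp add: grad_def)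

lemma C1_with_grad_imp_Ck_closure_1:
  assumes "open U" "C1_with_grad U g G"
  shows "Ck_closure 1 U g"
proof -
  have "continuous_on (closure U) (partial U i g)" for i
    using C1_with_gradD(2)[OF assms(2)] C1_with_grad_partial[OF assms]
    by (subst continuous_on_cong[OF refl, where g="\<lambda>x. G x $ i"]) (auto intro: continuous_intros)
  then show ?thesis
    using assms C1_with_gradD(3)[OF assms(2)] by (auto simp: C1_with_grad_def differentiable_def)
qed

lemma C1_with_grad_subset:
  assumes "C1_with_grad V g G" "U \<subseteq> V"
  shows "C1_with_grad U g G"
  using assms closure_mono[OF assms(2)]
  by (auto simp: C1_with_grad_def intro: continuous_on_subset)

section \<open>Calculus rules, extension by zero, and points where the gradient vanishes\<close>

lemma C1_with_grad_const: "C1_with_grad U (\<lambda>x. c) (\<lambda>x. 0)"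
  by (auto simp: C1_with_grad_def)

lemma C1_with_grad_add:
  assumes "C1_with_grad U f F" "C1_with_grad U g G"
  shows "C1_with_grad U (\<lambda>x. f x + g x) (\<lambda>x. F x + G x)"
  using assms
  by (auto simp: C1_with_grad_def inner_add_left intro!: continuous_intros has_derivative_add)

lemma C1_with_grad_mult:
  assumes "C1_with_grad U f F" "C1_with_grad U g G"
  shows "C1_with_grad U (\<lambda>x. f x * g x) (\<lambda>x. f x *\<^sub>R G x + g x *\<^sub>R F x)"
  unfolding C1_with_grad_def
proof (intro conjI ballI)
  fix x assume "x \<in> U"
  then have "(f has_derivative (\<lambda>v. F x \<bullet> v)) (at x)" "(g has_derivative (\<lambda>v. G x \<bullet> v)) (at x)"
    using assms by (auto simp: C1_with_grad_def)
  from has_derivative_mult[OF this]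
  show "((\<lambda>x. f x * g x) has_derivative (\<lambda>v. (f x *\<^sub>R G x + g x *\<^sub>R F x) \<bullet> v)) (at x)"
    by (simp add: inner_add_left mult.commute)
qed (use assms in \<open>auto simp: C1_with_grad_def intro!: continuous_intros\<close>)

lemma C1_with_grad_cmult:
  assumes "C1_with_grad U f F"
  shows "C1_with_grad U (\<lambda>x. c * f x) (\<lambda>x. c *\<^sub>R F x)"
  using C1_with_grad_mult[OF C1_with_grad_const[of U c] assms] by simp

lemma C1_with_grad_diff:
  assumes "C1_with_grad U f F" "C1_with_grad U g G"
  shows "C1_with_grad U (\<lambda>x. f x - g x) (\<lambda>x. F x - G x)"
  using C1_with_grad_add[OF assms(1) C1_with_grad_cmult[OF assms(2), of "-1"]] by simp

lemma C1_with_grad_sum: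
  assumes "\<And>i. i \<in> I \<Longrightarrow> C1_with_grad U (f i) (F i)"
  shows "C1_with_grad U (\<lambda>x. \<Sum>i\<in>I. f i x) (\<lambda>x. \<Sum>i\<in>I. F i x)"
proof (cases "finite I")
  case True
  then show ?thesis using assms
    by (induction I rule: finite_induct) (auto intro: C1_with_grad_const C1_with_grad_add)
qed (simp add: C1_with_grad_const)

lemma C1_with_grad_compose:
  assumes g: "C1_with_grad U g G"
    and d: "\<And>x. x \<in> U \<Longrightarrow> (p has_real_derivative p' (g x)) (at (g x))"
    and c: "continuous_on (g ` closure U) p" "continuous_on (g ` closure U) p'"
  shows "C1_with_grad U (\<lambda>x. p (g x)) (\<lambda>x. p' (g x) *\<^sub>R G x)"
  unfolding C1_with_grad_def
proof (intro conjI ballI)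
  have gc: "continuous_on (closure U) g" and Gc: "continuous_on (closure U) G"
    using C1_with_gradD[OF g] by auto
  show "continuous_on (closure U) (\<lambda>x. p (g x))"
    by (rule continuous_on_compose2[OF c(1) gc]) auto
  have "continuous_on (closure U) (\<lambda>x. p' (g x))"
    by (rule continuous_on_compose2[OF c(2) gc]) auto
  then show "continuous_on (closure U) (\<lambda>x. p' (g x) *\<^sub>R G x)"
    using Gc by (intro continuous_intros)
  fix x assume x: "x \<in> U"
  from has_derivative_compose[OF C1_with_gradD(3)[OF g x]
      d[OF x, unfolded has_field_derivative_def]]
  show "((\<lambda>x. p (g x)) has_derivative (\<lambda>v. (p' (g x) *\<^sub>R G x) \<bullet> v)) (at x)"
    by simp
qed

lemma C1_with_grad_component: "C1_with_grad U (\<lambda>x. x $ i) (\<lambda>x. axis i 1)"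
proof -
  have "((\<lambda>x. x $ i) has_derivative (\<lambda>v. axis i 1 \<bullet> v)) (at x)" for x :: "real^'a"
    by (simp add: inner_commute inner_axis bounded_linear_vec_nth bounded_linear_imp_has_derivative)
  then show ?thesis
    by (auto simp: C1_with_grad_def intro!: continuous_intros)
qed

lemma C1_with_grad_UNIV_continuous:
  assumes "C1_with_grad UNIV g G"
  shows "continuous_on S g" "continuous_on S G"
  using assms by (auto simp: C1_with_grad_def intro: continuous_on_subset)

text \<open>The open sets \<open>W\<close> and \<open>- S\<close> cover the space; the extension is
  \<open>g\<close> on the first and zero on the second. On the overlap uniqueness of the derivative
  forces \<open>G = 0\<close>, so the two continuous pieces of the gradient fit together.\<close>

lemma C1_with_grad_zero_extension:
  assumes W: "open W" and S: "closed S" "S \<subseteq> W"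
    and d: "\<And>x. x \<in> W \<Longrightarrow> (g has_derivative (\<lambda>v. G x \<bullet> v)) (at x)"
    and G: "continuous_on W G" and z: "\<And>x. x \<in> W - S \<Longrightarrow> g x = 0"
  shows "C1_with_grad UNIV (\<lambda>x. if x \<in> W then g x else 0) (\<lambda>x. if x \<in> W then G x else 0)"
proof -
  let ?g = "\<lambda>x. if x \<in> W then g x else 0" and ?G = "\<lambda>x. if x \<in> W then G x else 0"
  have oS: "open (- S)" using S by auto
  have un: "W \<union> - S = UNIV" using S by auto
  have dW: "(?g has_derivative (\<lambda>v. ?G x \<bullet> v)) (at x)" if "x \<in> W" for x
  proof -
    have "(g has_derivative (\<lambda>v. ?G x \<bullet> v)) (at x)" using d that by simp
    then show ?thesis by (rule has_derivative_transform_within_open[OF _ W that]) auto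
  qed
  have z': "?g x = 0" if "x \<in> - S" for x using z that by auto
  have d0: "(?g has_derivative (\<lambda>v. 0)) (at x)" if "x \<in> - S" for x
    by (rule has_derivative_transform_within_open[OF has_derivative_const oS that]) (use z' in auto)
  have G0: "?G x = 0" if "x \<in> - S" for x
  proof (cases "x \<in> W")
    case True
    then have "(\<lambda>v. ?G x \<bullet> v) = (\<lambda>v. 0)"
      using has_derivative_unique[OF dW[OF True] d0[OF that]] by simp
    then have "?G x \<bullet> ?G x = 0" by metis
    then show ?thesis by simp
  qed simp
  have "(?g has_derivative (\<lambda>v. ?G x \<bullet> v)) (at x)" for x
  proof (cases "x \<in> W")
    case False
    then have "x \<in> - S" using S by auto
    then show ?thesis using d0 False by simp
  qed (rule dW)
  moreover have "continuous_on UNIV ?G"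
  proof -
    have "continuous_on W ?G"
      using G by (subst continuous_on_cong[OF refl, where g=G]) auto
    moreover have "continuous_on (- S) ?G"
      using G0 by (subst continuous_on_cong[OF refl, where g="\<lambda>x. 0"]) auto
    ultimately have "continuous_on (W \<union> - S) ?G"
      by (rule continuous_on_open_Un[OF W oS])
    then show ?thesis unfolding un .
  qed
  moreover have "continuous_on UNIV ?g"
    using calculation(1) by (intro continuous_at_imp_continuous_on ballI has_derivative_continuous)
  ultimately show ?thesis by (simp add: C1_with_grad_def)
qed

lemma C1_with_grad_eq_0:
  assumes "C1_with_grad U g G" "open V" "x \<in> V" "x \<in> U" and z: "\<And>y. y \<in> V \<Longrightarrow> g y = 0"
  shows "G x = 0"
proof -
  have "(g has_derivative (\<lambda>v. 0)) (at x)"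
    by (rule has_derivative_transform_within_open[OF has_derivative_const assms(2,3)]) (use z in auto)
  then have "(\<lambda>v. G x \<bullet> v) = (\<lambda>v. 0)"
    using C1_with_gradD(3)[OF assms(1,4)] has_derivative_unique by blast
  then have "G x \<bullet> G x = 0" by metis
  then show ?thesis by simp
qed

lemma C1_with_grad_UNIV_eq_0:
  assumes "C1_with_grad UNIV g G" "closed K" "x \<notin> K" and z: "\<And>y. y \<notin> K \<Longrightarrow> g y = 0"
  shows "G x = 0"
  using C1_with_grad_eq_0[OF assms(1), of "- K" x] assms by auto

text \<open>Meant for cutoffs at points where they attain the value \<open>1\<close>: the gradient
  vanishes there even when the plateau has no interior near the point.\<close>

lemma C1_with_grad_max_eq_0:
  assumes "C1_with_grad UNIV g G" and m: "\<And>y. g y \<le> g x"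
  shows "G x = 0"
proof -
  have "(\<lambda>v. G x \<bullet> v) = (\<lambda>v. 0)"
    by (rule differential_zero_maxmin[OF _ open_UNIV C1_with_gradD(3)[OF assms(1)]])
      (use m in auto)
  then have "G x \<bullet> G x = 0" by metis
  then show ?thesis by simp
qed

section \<open>Bump functions, partitions of unity and cutoffs of class \<open>C^1\<close>\<close>

definition pos_sq :: "real \<Rightarrow> real" where
  "pos_sq t = (max 0 t)\<^sup>2"

text \<open>Continuing \<open>1 / t\<close> below \<open>m\<close> by its tangent line makes it \<open>C\<^sup>1\<close> on the whole line and keeps
  \<open>0 \<le> t * recip_above m t \<le> 1\<close> for \<open>t \<ge> 0\<close>.\<close>

definition recip_above :: "real \<Rightarrow> real \<Rightarrow> real" where
  "recip_above m t = (if t \<ge> m then 1 / t else 1 / m - (t - m) / m\<^sup>2)"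

lemma DERIV_paste:
  fixes f g :: "real \<Rightarrow> real"
  assumes "\<And>t. t \<ge> m \<Longrightarrow> (f has_real_derivative f' t) (at t)"
    and "\<And>t. t \<le> m \<Longrightarrow> (g has_real_derivative g' t) (at t)"
    and "f m = g m" "f' m = g' m"
  shows "((\<lambda>t. if t \<ge> m then f t else g t) has_real_derivative
    (if t \<ge> m then f' t else g' t)) (at t)"
proof -
  have "((\<lambda>t. if t \<in> {m..} then f t else g t) has_vector_derivative
      (if t \<in> {m..} then f' t else g' t)) (at t within UNIV)"
  proof (rule has_vector_derivative_If_within_closures[where T="{..m}"])
    show "t \<in> {m..} \<union> {..m}" "(UNIV :: real set) = {m..} \<union> {..m}" by auto
    have cl: "{m..} \<union> closure {m..} \<inter> closure {..m} = {m..}" "{..m} \<union> closure {m..} \<inter> closure {..m} = {..m}"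
      by auto
    show "(f has_vector_derivative f' t) (at t within {m..} \<union> closure {m..} \<inter> closure {..m})"
      if "t \<in> {m..} \<union> closure {m..} \<inter> closure {..m}"
      using assms(1)[of t] that unfolding cl has_real_derivative_iff_has_vector_derivative
      by (simp add: has_vector_derivative_at_within)
    show "(g has_vector_derivative g' t) (at t within {..m} \<union> closure {m..} \<inter> closure {..m})"
      if "t \<in> {..m} \<union> closure {m..} \<inter> closure {..m}"
      using assms(2)[of t] that unfolding cl has_real_derivative_iff_has_vector_derivative
      by (simp add: has_vector_derivative_at_within)
    show "f t = g t" "f' t = g' t" if "t \<in> closure {m..}" "t \<in> closure {..m}"
      using that assms(3,4) by (auto dest: antisym)
  qed
  then show ?thesis by (simp add: has_real_derivative_iff_has_vector_derivative)
qed

lemma DERIV_pos_sq: "(pos_sq has_real_derivative 2 * max 0 t) (at t)"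
proof -
  have "((\<lambda>t::real. if t \<ge> 0 then t\<^sup>2 else 0) has_real_derivative (if t \<ge> 0 then 2 * t else 0)) (at t)"
    by (rule DERIV_paste) (auto intro!: derivative_eq_intros)
  moreover have "(\<lambda>t::real. if t \<ge> 0 then t\<^sup>2 else 0) = pos_sq"
    by (auto simp: pos_sq_def)
  ultimately show ?thesis by (simp add: max_def split: if_splits)
qed

lemma DERIV_recip_above:
  assumes "m > 0"
  shows "(recip_above m has_real_derivative - 1 / (max m t)\<^sup>2) (at t)"
proof -
  have "((\<lambda>t. if t \<ge> m then 1 / t else 1 / m - (t - m) / m\<^sup>2) has_real_derivative
      (if t \<ge> m then - 1 / t\<^sup>2 else - 1 / m\<^sup>2)) (at t)"
    by (rule DERIV_paste)
      (use assms in \<open>auto intro!: derivative_eq_intros simp: power2_eq_square\<close>)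
  moreover have "(\<lambda>t. if t \<ge> m then 1 / t else 1 / m - (t - m) / m\<^sup>2) = recip_above m"
    by (auto simp: recip_above_def)
  moreover have "(if t \<ge> m then - 1 / t\<^sup>2 else - 1 / m\<^sup>2) = - 1 / (max m t)\<^sup>2"
    by (simp add: max_def)
  ultimately show ?thesis by simp
qed

text \<open>Squaring the positive part makes this piecewise polynomial function \<open>C^1\<close>
  across the sphere of radius \<open>r\<close>.\<close>

definition bump :: "real^'n \<Rightarrow> real \<Rightarrow> real^'n \<Rightarrow> real" where
  "bump c r x = pos_sq (r\<^sup>2 - (x - c) \<bullet> (x - c))"

lemma C1_with_grad_inner_self: "C1_with_grad U (\<lambda>x. (x - c) \<bullet> (x - c)) (\<lambda>x. 2 *\<^sub>R (x - c))"
proof -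
  have "((\<lambda>x. (x - c) \<bullet> (x - c)) has_derivative (\<lambda>v. (x - c) \<bullet> v + v \<bullet> (x - c))) (at x)" for x
    by (rule has_derivative_eq_rhs, rule has_derivative_inner) (auto intro!: derivative_eq_intros)
  moreover have "(\<lambda>v. (x - c) \<bullet> v + v \<bullet> (x - c)) = (\<lambda>v. (2 *\<^sub>R (x - c)) \<bullet> v)" for x
    by (simp add: inner_commute)
  ultimately show ?thesis
    by (auto simp: C1_with_grad_def intro!: continuous_intros)
qed

lemma C1_with_grad_bump: "\<exists>G. C1_with_grad UNIV (bump c r) G"
proof -
  have "C1_with_grad UNIV (\<lambda>x. r\<^sup>2 - (x - c) \<bullet> (x - c)) (\<lambda>x. 0 - 2 *\<^sub>R (x - c))"
    by (rule C1_with_grad_diff[OF C1_with_grad_const C1_with_grad_inner_self])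
  from C1_with_grad_compose[OF this DERIV_pos_sq]
  have "C1_with_grad UNIV (\<lambda>x. pos_sq (r\<^sup>2 - (x - c) \<bullet> (x - c)))
      (\<lambda>x. (2 * max 0 (r\<^sup>2 - (x - c) \<bullet> (x - c))) *\<^sub>R (0 - 2 *\<^sub>R (x - c)))"
    by (simp add: pos_sq_def[abs_def] continuous_intros)
  moreover have "(\<lambda>x. pos_sq (r\<^sup>2 - (x - c) \<bullet> (x - c))) = bump c r"
    by (simp add: bump_def fun_eq_iff)
  ultimately show ?thesis by auto
qed

lemma bump_nonneg: "bump c r x \<ge> 0"
  by (simp add: bump_def pos_sq_def)

lemma bump_pos_iff:
  assumes "r > 0"
  shows "bump c r x > 0 \<longleftrightarrow> x \<in> ball c r"
proof -
  have "bump c r x > 0 \<longleftrightarrow> (norm (x - c))\<^sup>2 < r\<^sup>2"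
    by (auto simp: bump_def pos_sq_def power2_norm_eq_inner max_def)
  also have "\<dots> \<longleftrightarrow> norm (x - c) < r"
    using assms by (meson norm_ge_zero less_le power2_less_imp_less power_strict_mono zero_less_numeral)
  finally show ?thesis by (simp add: dist_norm norm_minus_commute)
qed

text \<open>Bumps on finitely many balls are divided by their sum \<open>S\<close>. As
  \<open>S\<close> vanishes somewhere, the division uses \<open>recip_above m\<close> with
  \<open>m\<close> a positive lower bound of \<open>S\<close> on \<open>K\<close>: the true
  reciprocal on \<open>K\<close>, \<open>C^1\<close> everywhere, and small enough to keep the total
  at most \<open>1\<close> off \<open>K\<close>.\<close>

lemma C1_partition_of_unity:
  fixes K :: "(real^'n) set"
  assumes "compact K" and r: "\<And>x. x \<in> K \<Longrightarrow> 0 < r x"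
  obtains I and \<theta> :: "real^'n \<Rightarrow> real^'n \<Rightarrow> real" and \<Theta> where
    "finite I" "I \<subseteq> K" "\<And>i. i \<in> I \<Longrightarrow> C1_with_grad UNIV (\<theta> i) (\<Theta> i)"
    "\<And>i x. i \<in> I \<Longrightarrow> 0 \<le> \<theta> i x" "\<And>i x. i \<in> I \<Longrightarrow> x \<notin> ball i (r i) \<Longrightarrow> \<theta> i x = 0"
    "\<And>x. (\<Sum>i\<in>I. \<theta> i x) \<le> 1" "\<And>x. x \<in> K \<Longrightarrow> (\<Sum>i\<in>I. \<theta> i x) = 1"
proof -
  obtain I where I: "I \<subseteq> K" "finite I" "K \<subseteq> (\<Union>i\<in>I. ball i (r i))"
  proof (rule compactE_image[OF assms(1), of K "\<lambda>x. ball x (r x)"])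
    show "K \<subseteq> (\<Union>c\<in>K. ball c (r c))" using r by force
  qed auto
  define b where "b i = bump i (r i)" for i :: "real^'n"
  obtain B where B: "\<And>i. C1_with_grad UNIV (b i) (B i)"
    unfolding b_def using C1_with_grad_bump choice[of "\<lambda>i. C1_with_grad UNIV (bump i (r i))"] by blast
  define S where "S x = (\<Sum>i\<in>I. b i x)" for x
  have S: "C1_with_grad UNIV S (\<lambda>x. \<Sum>i\<in>I. B i x)"
    unfolding S_def by (rule C1_with_grad_sum) (rule B)
  have b0: "b i x \<ge> 0" for i x by (simp add: b_def bump_nonneg)
  have Spos: "S x > 0" if xK: "x \<in> K" for x
  proof -
    obtain i where i: "i \<in> I" "x \<in> ball i (r i)" using I(3) xK by blast
    then have "b i x > 0" using bump_pos_iff[of "r i" i x] r[of i] I(1) by (auto simp: b_def)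
    then show ?thesis unfolding S_def using I i b0 by (intro sum_pos2[of I i]) auto
  qed
  obtain m where m: "m > 0" "\<And>x. x \<in> K \<Longrightarrow> m \<le> S x"
  proof (cases "K = {}")
    case False
    have "continuous_on K S" using S C1_with_grad_UNIV_continuous by blast
    then obtain y where "y \<in> K" "\<And>x. x \<in> K \<Longrightarrow> S y \<le> S x"
      using continuous_attains_inf[OF assms(1) False] by blast
    then show ?thesis using that[of "S y"] Spos by blast
  qed (use that[of 1] in auto)
  have R: "\<exists>R. C1_with_grad UNIV (\<lambda>x. recip_above m (S x)) R"
  proof -
    have c: "continuous_on X (recip_above m)" for X
      by (intro continuous_at_imp_continuous_on ballI) (rule DERIV_isCont[OF DERIV_recip_above[OF m(1)]])
    have c': "continuous_on X (\<lambda>t. - 1 / (max m t)\<^sup>2)" for X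
      using m(1) by (intro continuous_intros) auto
    from C1_with_grad_compose[OF S DERIV_recip_above[OF m(1)] c c'] show ?thesis by blast
  qed
  define \<theta> where "\<theta> i x = b i x * recip_above m (S x)" for i x
  have sum_eq: "(\<Sum>i\<in>I. \<theta> i x) = S x * recip_above m (S x)" for x
    by (simp add: \<theta>_def S_def sum_distrib_right)
  have Sn: "S x \<ge> 0" for x unfolding S_def by (intro sum_nonneg) (rule b0)
  obtain R where R': "C1_with_grad UNIV (\<lambda>x. recip_above m (S x)) R" using R by blast
  have "C1_with_grad UNIV (\<theta> i) (\<lambda>x. b i x *\<^sub>R R x + recip_above m (S x) *\<^sub>R B i x)" for i
    unfolding \<theta>_def by (rule C1_with_grad_mult[OF B R'])
  moreover have rec0: "recip_above m t \<ge> 0" if "t \<ge> 0" for t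
  proof (cases "t \<ge> m")
    case False
    have "recip_above m t = (2 * m - t) / m\<^sup>2"
      using False m(1) by (simp add: recip_above_def field_simps power2_eq_square)
    then show ?thesis using False m(1) by simp
  qed (use that in \<open>simp add: recip_above_def\<close>)
  moreover have "\<theta> i x \<ge> 0" for i x
    unfolding \<theta>_def using b0 rec0 Sn by simp
  moreover have "\<theta> i x = 0" if "i \<in> I" "x \<notin> ball i (r i)" for i x
  proof -
    have "\<not> b i x > 0" using bump_pos_iff[of "r i" i x] r I that by (auto simp: b_def)
    then show ?thesis using b0[of i x] by (simp add: \<theta>_def)
  qed
  moreover have "t * recip_above m t \<le> 1" if "t \<ge> 0" for t
  proof (cases "t \<ge> m")
    case False
    \<comment> \<open>Below \<open>m\<close> the product is \<open>t (2 m - t) / m^2\<close>, which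
      falls short of \<open>1\<close> by a perfect square.\<close>
    have "1 - t * recip_above m t = ((m - t) / m)\<^sup>2"
      using False m(1) by (simp add: recip_above_def field_simps power2_eq_square)
    then show ?thesis by (smt (verit) zero_le_power2)
  qed (use m in \<open>simp add: recip_above_def\<close>)
  moreover have "t * recip_above m t = 1" if "t \<ge> m" for t
    using that m by (simp add: recip_above_def)
  ultimately show ?thesis
    using that[OF I(2,1), of \<theta> "\<lambda>i x. b i x *\<^sub>R R x + recip_above m (S x) *\<^sub>R B i x"] sum_eq Sn m
    by simp
qed

text \<open>The sum of a partition of unity on \<open>K\<close> whose balls have their closed
  versions inside \<open>U\<close>; finitely many closed balls then form the compact set
  \<open>L\<close>.\<close>

lemma C1_cutoff:
  fixes K :: "(real^'n) set"
  assumes "compact K" "open U" "K \<subseteq> U"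
  obtains \<theta> \<Theta> L where "C1_with_grad UNIV \<theta> \<Theta>" "compact L" "L \<subseteq> U"
    "\<And>x. x \<notin> L \<Longrightarrow> \<theta> x = 0" "\<And>x. 0 \<le> \<theta> x" "\<And>x. \<theta> x \<le> 1" "\<And>x. x \<in> K \<Longrightarrow> \<theta> x = 1"
proof -
  have "\<forall>x\<in>K. \<exists>r. r > 0 \<and> cball x r \<subseteq> U"
    using assms(2,3) unfolding open_contains_cball by blast
  from bchoice[OF this] obtain r where "\<forall>x\<in>K. r x > 0 \<and> cball x (r x) \<subseteq> U" ..
  then have r: "\<And>x. x \<in> K \<Longrightarrow> 0 < r x" "\<And>x. x \<in> K \<Longrightarrow> cball x (r x) \<subseteq> U"
    by auto
  obtain I \<theta> \<Theta> where I: "finite I" "I \<subseteq> K"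
    "\<And>i. i \<in> I \<Longrightarrow> C1_with_grad UNIV (\<theta> i) (\<Theta> i)"
    "\<And>i x. i \<in> I \<Longrightarrow> 0 \<le> \<theta> i x" "\<And>i x. i \<in> I \<Longrightarrow> x \<notin> ball i (r i) \<Longrightarrow> \<theta> i x = 0"
    "\<And>x. (\<Sum>i\<in>I. \<theta> i x) \<le> 1" "\<And>x. x \<in> K \<Longrightarrow> (\<Sum>i\<in>I. \<theta> i x) = 1"
    by (rule C1_partition_of_unity[OF assms(1) r(1)]; (assumption | rule that; assumption))
  show ?thesis
  proof (rule that[of "\<lambda>x. \<Sum>i\<in>I. \<theta> i x" "\<lambda>x. \<Sum>i\<in>I. \<Theta> i x" "\<Union>i\<in>I. cball i (r i)"])
    show "compact (\<Union>i\<in>I. cball i (r i))" using I(1) by (intro compact_UN) auto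
    show "(\<Union>i\<in>I. cball i (r i)) \<subseteq> U" using r(2) I(2) by blast
    show "(\<Sum>i\<in>I. \<theta> i x) = 0" if "x \<notin> (\<Union>i\<in>I. cball i (r i))" for x
      using that ball_subset_cball I(5) by (intro sum.neutral) blast
  qed (use I in \<open>auto intro: C1_with_grad_sum sum_nonneg\<close>)
qed

subsection \<open>Integration by parts for compact supports\<close>

lemma integrable_lborel_compact_support:
  fixes w :: "real^'n \<Rightarrow> real"
  assumes "continuous_on K w" "compact K" "\<And>x. x \<notin> K \<Longrightarrow> w x = 0"
  shows "integrable lborel w"
proof -
  have "(\<lambda>x. indicator K x *\<^sub>R w x) = w"
    using assms(3) by (auto simp: indicator_def fun_eq_iff)
  then show ?thesis using borel_integrable_compact[OF assms(2,1)] by simp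
qed

lemma lborel_integral_translate:
  fixes g :: "real^'n \<Rightarrow> real"
  assumes [measurable]: "g \<in> borel_measurable borel"
  shows "(LINT x|lborel. g (x + c)) = (LINT x|lborel. g x)"
proof -
  have "(LINT x|lborel. g x) = (LINT x|distr lborel borel ((+) c). g x)"
    by (simp add: lborel_distr_plus)
  also have "\<dots> = (LINT x|lborel. g (c + x))"
    by (rule integral_distr) auto
  finally show ?thesis by (simp add: add.commute)
qed

text \<open>Supplies the uniform bound on difference quotients for dominated convergence. The
  gradient is bounded because it vanishes off \<open>K\<close>; the rest is the mean value
  inequality.\<close>

lemma C1_compact_support_lipschitz:
  fixes g :: "real^'n \<Rightarrow> real"
  assumes g: "C1_with_grad UNIV g G" and K: "compact K" "\<And>x. x \<notin> K \<Longrightarrow> g x = 0"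
  obtains C where "C \<ge> 0" "\<And>x y. \<bar>g x - g y\<bar> \<le> C * norm (x - y)"
proof -
  have "bounded (G ` K)"
    using compact_continuous_image[OF C1_with_grad_UNIV_continuous(2)[OF g] K(1)]
    by (rule compact_imp_bounded)
  then obtain C where C: "\<And>x. x \<in> K \<Longrightarrow> norm (G x) \<le> C" "C > 0"
    unfolding bounded_pos by blast
  have b: "norm (G x) \<le> C" for x
    using C C1_with_grad_UNIV_eq_0[OF g compact_imp_closed[OF K(1)] _ K(2)] by (cases "x \<in> K") auto
  have "norm (g x - g y) \<le> C * norm (x - y)" for x y
  proof (rule differentiable_bound[of UNIV g "\<lambda>x v. G x \<bullet> v"])
    show "onorm (\<lambda>v. G x \<bullet> v) \<le> C" for x
      by (rule onorm_le) (use b Cauchy_Schwarz_ineq2 mult_right_mono norm_ge_zero order_trans in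
        \<open>metis real_norm_def\<close>)
  qed (use C1_with_gradD(3)[OF g] in auto)
  then show ?thesis using that[of C] C(2) by auto
qed

text \<open>Dominated convergence: the quotients are bounded by the Lipschitz constant times
  \<open>norm e\<close> and vanish outside a common ball, on which the continuous weight
  \<open>w\<close> is bounded.\<close>

lemma difference_quotient_integral:
  fixes g w :: "real^'n \<Rightarrow> real"
  assumes g: "C1_with_grad UNIV g G" and K: "compact K" "\<And>x. x \<notin> K \<Longrightarrow> g x = 0"
    and w: "continuous_on UNIV w"
  shows "(\<lambda>n. LINT x|lborel. (g (x + (1 / real (Suc n)) *\<^sub>R e) - g x) / (1 / real (Suc n)) * w x)
           \<longlonglongrightarrow> (LINT x|lborel. (G x \<bullet> e) * w x)"
proof -
  obtain C where C: "C \<ge> 0" "\<And>x y. \<bar>g x - g y\<bar> \<le> C * norm (x - y)"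
    using C1_compact_support_lipschitz[OF g K] by blast
  obtain R where R: "\<And>x. x \<in> K \<Longrightarrow> norm x \<le> R"
    using compact_imp_bounded[OF K(1)] by (auto simp: bounded_iff)
  \<comment> \<open>No step is longer than \<open>norm e\<close>, so this ball contains the supports
    of all quotients.\<close>
  define L where "L = cball (0 :: real^'n) (R + norm e)"
  define q where "q n x = (g (x + (1 / real (Suc n)) *\<^sub>R e) - g x) / (1 / real (Suc n))" for n x
  have [measurable]: "g \<in> borel_measurable borel" "w \<in> borel_measurable borel" "G \<in> borel_measurable borel"
    using C1_with_grad_UNIV_continuous[OF g] w by (auto intro: borel_measurable_continuous_onI)
  have q_le: "\<bar>q n x\<bar> \<le> C * norm e" for n x
  proof -
    have "\<bar>g (x + (1 / real (Suc n)) *\<^sub>R e) - g x\<bar> \<le> C * norm ((1 / real (Suc n)) *\<^sub>R e)"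
      using C(2)[of "x + (1 / real (Suc n)) *\<^sub>R e" x] by simp
    also have "\<dots> = C * norm e * (1 / real (Suc n))" by simp
    finally show ?thesis
      unfolding q_def abs_divide by (simp add: field_simps)
  qed
  have q0: "q n x = 0" if "x \<notin> L" for n x
  proof -
    have "norm x > R + norm e" using that by (simp add: L_def)
    moreover have "norm ((1 / real (Suc n)) *\<^sub>R e) \<le> norm e"
      by (simp add: divide_le_eq algebra_simps)
    moreover have "norm x \<le> norm (x + (1 / real (Suc n)) *\<^sub>R e) + norm ((1 / real (Suc n)) *\<^sub>R e)"
      by (metis add_diff_cancel norm_triangle_ineq4)
    ultimately have "x \<notin> K" "x + (1 / real (Suc n)) *\<^sub>R e \<notin> K"
      using R[of x] R[of "x + (1 / real (Suc n)) *\<^sub>R e"] norm_ge_zero[of e] by linarith+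
    then show ?thesis by (simp add: q_def K(2))
  qed
  have "(\<lambda>n. LINT x|lborel. q n x * w x) \<longlonglongrightarrow> (LINT x|lborel. (G x \<bullet> e) * w x)"
  proof (rule integral_dominated_convergence[where w="\<lambda>x. indicator L x *\<^sub>R (C * norm e * \<bar>w x\<bar>)"])
    have "continuous_on L (\<lambda>x. C * norm e * \<bar>w x\<bar>)"
      using w by (intro continuous_intros) (auto intro: continuous_on_subset)
    then show "integrable lborel (\<lambda>x. indicator L x *\<^sub>R (C * norm e * \<bar>w x\<bar>))"
      by (intro borel_integrable_compact) (auto simp: L_def)
    show "AE x in lborel. (\<lambda>n. q n x * w x) \<longlonglongrightarrow> (G x \<bullet> e) * w x"
    proof (intro AE_I2 tendsto_mult tendsto_const)
      fix x :: "real^'n"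
      have a: "((\<lambda>t. x + t *\<^sub>R e) has_derivative (\<lambda>t. t *\<^sub>R e)) (at (0::real))"
        by (auto intro!: derivative_eq_intros)
      have b: "(g has_derivative (\<lambda>v. G x \<bullet> v)) (at (x + (0::real) *\<^sub>R e))"
        using C1_with_gradD(3)[OF g] by simp
      have "((\<lambda>t. g (x + t *\<^sub>R e)) has_real_derivative (G x \<bullet> e)) (at 0)"
        using has_derivative_compose[OF a b]
        by (simp add: has_field_derivative_def mult.commute[of _ "G x \<bullet> e"])
      then have l: "((\<lambda>t. (g (x + t *\<^sub>R e) - g x) / t) \<longlongrightarrow> G x \<bullet> e) (at 0)"
        by (simp add: has_field_derivative_iff)
      have "filterlim (\<lambda>n. 1 / real (Suc n)) (at 0) sequentially"
        by (rule filterlim_atI) (use LIMSEQ_inverse_real_of_nat in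
          \<open>auto simp: inverse_eq_divide simp del: of_nat_Suc\<close>)
      from filterlim_compose[OF l this]
      show "(\<lambda>n. q n x) \<longlonglongrightarrow> G x \<bullet> e" by (simp add: q_def)
    qed
    show "AE x in lborel. norm (q n x * w x) \<le> indicator L x *\<^sub>R (C * norm e * \<bar>w x\<bar>)" for n
      using q_le[of n] q0[of _ n] by (auto simp: indicator_def abs_mult mult_right_mono)
  qed (auto simp: q_def)
  then show ?thesis by (simp add: q_def)
qed

text \<open>Translation invariance makes every difference quotient of \<open>g\<close> integrate to
  zero; the limit with weight \<open>1\<close> is the claim.\<close>

lemma integral_gradient_compact_support:
  fixes g :: "real^'n \<Rightarrow> real"
  assumes g: "C1_with_grad UNIV g G" and K: "compact K" "\<And>x. x \<notin> K \<Longrightarrow> g x = 0"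
  shows "(LINT x|lborel. G x \<bullet> e) = 0"
proof -
  have [measurable]: "g \<in> borel_measurable borel"
    using C1_with_grad_UNIV_continuous[OF g] by (auto intro: borel_measurable_continuous_onI)
  have i: "integrable lborel (\<lambda>x. g (x + c))" for c
  proof (rule integrable_lborel_compact_support[of "(\<lambda>x. x - c) ` K"])
    show "continuous_on ((\<lambda>x. x - c) ` K) (\<lambda>x. g (x + c))"
      by (intro continuous_on_compose2[OF C1_with_grad_UNIV_continuous(1)[OF g, of UNIV]] continuous_intros) auto
    show "compact ((\<lambda>x. x - c) ` K)"
      by (intro compact_continuous_image continuous_intros K)
    show "g (x + c) = 0" if "x \<notin> (\<lambda>x. x - c) ` K" for x
      using that by (intro K(2)) (metis add_diff_cancel image_eqI)
  qed
  have "(LINT x|lborel. (g (x + (1 / real (Suc n)) *\<^sub>R e) - g x) / (1 / real (Suc n)) * 1) = 0" for n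
    using i[of "(1 / real (Suc n)) *\<^sub>R e"] i[of 0] lborel_integral_translate[of g]
    by (simp del: of_nat_Suc)
  moreover have "(\<lambda>n. LINT x|lborel. (g (x + (1 / real (Suc n)) *\<^sub>R e) - g x) / (1 / real (Suc n)) * 1)
      \<longlonglongrightarrow> (LINT x|lborel. (G x \<bullet> e) * 1)"
    by (rule difference_quotient_integral[OF g K]) auto
  ultimately show ?thesis
    by (simp add: LIMSEQ_const_iff del: of_nat_Suc)
qed

lemma C1_with_grad_translate:
  assumes g: "C1_with_grad UNIV g G"
  shows "C1_with_grad UNIV (\<lambda>x. g (x + c)) (\<lambda>x. G (x + c))"
  unfolding C1_with_grad_def
proof (intro conjI ballI)
  show "continuous_on (closure UNIV) (\<lambda>x. g (x + c))" "continuous_on (closure UNIV) (\<lambda>x. G (x + c))"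
    using C1_with_gradD(1,2)[OF g]
    by (auto intro!: continuous_on_compose2[where f="\<lambda>x. x + c" and t=UNIV] continuous_intros)
  fix x
  have a: "((\<lambda>x. x + c) has_derivative (\<lambda>v. v)) (at x)" by (auto intro!: derivative_eq_intros)
  show "((\<lambda>x. g (x + c)) has_derivative (\<lambda>v. G (x + c) \<bullet> v)) (at x)"
    using has_derivative_compose[OF a C1_with_gradD(3)[OF g UNIV_I]] .
qed

text \<open>Both functions are only \<open>C\<^sup>1\<close>, so one derivative is moved across as a difference quotient.\<close>

lemma integral_gradients_swap:
  fixes Y \<psi> :: "real^'n \<Rightarrow> real"
  assumes Y: "C1_with_grad UNIV Y Y'" and K: "compact K" "\<And>x. x \<notin> K \<Longrightarrow> Y x = 0"
    and \<psi>: "C1_with_grad UNIV \<psi> \<psi>'" and L: "compact L" "\<And>x. x \<notin> L \<Longrightarrow> \<psi> x = 0"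
  shows "(LINT x|lborel. (Y' x \<bullet> d) * (\<psi>' x \<bullet> e)) = (LINT x|lborel. (Y' x \<bullet> e) * (\<psi>' x \<bullet> d))"
proof -
  note cY = C1_with_grad_UNIV_continuous[OF Y, of UNIV] and c\<psi> = C1_with_grad_UNIV_continuous[OF \<psi>, of UNIV]
  have [measurable]: "Y \<in> borel_measurable borel" "Y' \<in> borel_measurable borel"
      "\<psi> \<in> borel_measurable borel" "\<psi>' \<in> borel_measurable borel"
    using cY c\<psi> by (auto intro: borel_measurable_continuous_onI)
  have Y'0: "Y' x = 0" if "x \<notin> K" for x
    using C1_with_grad_UNIV_eq_0[OF Y compact_imp_closed[OF K(1)] that K(2)] by simp
  have \<psi>'0: "\<psi>' x = 0" if "x \<notin> L" for x
    using C1_with_grad_UNIV_eq_0[OF \<psi> compact_imp_closed[OF L(1)] that L(2)] by simp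
  \<comment> \<open>Integrate the gradient of \<open>(Y (x + t d) - Y x) \<psi> x\<close> in
    direction \<open>e\<close>, then translate by \<open>t d\<close> in the shifted term. The
    difference moves from \<open>Y\<close> to \<open>\<psi>\<close>, with direction
    \<open>- d\<close> and the opposite sign, while the derivative in direction \<open>e\<close>
    moves from \<open>\<psi>\<close> to \<open>Y\<close>.\<close>
  have step: "(LINT x|lborel. (Y (x + t *\<^sub>R d) - Y x) / t * (\<psi>' x \<bullet> e))
      = (LINT x|lborel. (\<psi> (x + t *\<^sub>R (- d)) - \<psi> x) / t * - (Y' x \<bullet> e))" if "t \<noteq> 0" for t
  proof -
    let ?D = "\<lambda>x. Y (x + t *\<^sub>R d) - Y x" and ?D' = "\<lambda>x. Y' (x + t *\<^sub>R d) - Y' x"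
    have D: "C1_with_grad UNIV ?D ?D'"
      by (intro C1_with_grad_diff C1_with_grad_translate Y)
    have cs: "continuous_on S (\<lambda>x. Y' (x + t *\<^sub>R d))" "continuous_on S Y'" "continuous_on S \<psi>"
        "continuous_on S \<psi>'" "continuous_on S (\<lambda>x. Y (x + t *\<^sub>R d))" "continuous_on S Y"
        "continuous_on S (\<lambda>x. \<psi> (x + t *\<^sub>R (- d)))" for S
      by (rule continuous_on_subset[OF _ subset_UNIV],
          rule C1_with_grad_UNIV_continuous[OF C1_with_grad_translate[OF Y]] cY c\<psi>
            C1_with_grad_UNIV_continuous[OF C1_with_grad_translate[OF \<psi>]])+
    have i1: "integrable lborel (\<lambda>x. ?D x * (\<psi>' x \<bullet> e))"
      by (rule integrable_lborel_compact_support[OF _ L(1)])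
        (use cs \<psi>'0 in \<open>auto intro!: continuous_intros\<close>)
    have i2: "integrable lborel (\<lambda>x. \<psi> x * (Y' (x + t *\<^sub>R d) \<bullet> e))"
      by (rule integrable_lborel_compact_support[OF _ L(1)])
        (use cs L(2) in \<open>auto intro!: continuous_intros\<close>)
    have i3: "integrable lborel (\<lambda>x. \<psi> x * (Y' x \<bullet> e))"
      by (rule integrable_lborel_compact_support[OF _ L(1)])
        (use cs L(2) in \<open>auto intro!: continuous_intros\<close>)
    have i4: "integrable lborel (\<lambda>x. \<psi> (x + t *\<^sub>R (- d)) * (Y' x \<bullet> e))"
      by (rule integrable_lborel_compact_support[OF _ K(1)])
        (use cs Y'0 in \<open>auto intro!: continuous_intros\<close>)
    have "0 = (LINT x|lborel. (?D x *\<^sub>R \<psi>' x + \<psi> x *\<^sub>R ?D' x) \<bullet> e)"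
      by (rule integral_gradient_compact_support[symmetric, OF C1_with_grad_mult[OF D \<psi>] L(1)])
        (use L(2) in auto)
    also have "\<dots> = (LINT x|lborel. ?D x * (\<psi>' x \<bullet> e)
        + (\<psi> x * (Y' (x + t *\<^sub>R d) \<bullet> e) - \<psi> x * (Y' x \<bullet> e)))"
      by (intro Bochner_Integration.integral_cong)
        (auto simp: inner_add_left inner_diff_left algebra_simps)
    also have "\<dots> = (LINT x|lborel. ?D x * (\<psi>' x \<bullet> e))
        + ((LINT x|lborel. \<psi> x * (Y' (x + t *\<^sub>R d) \<bullet> e)) - (LINT x|lborel. \<psi> x * (Y' x \<bullet> e)))"
      using i1 i2 i3 by (subst Bochner_Integration.integral_add) auto
    also have "(LINT x|lborel. \<psi> x * (Y' (x + t *\<^sub>R d) \<bullet> e))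
        = (LINT x|lborel. \<psi> (x + t *\<^sub>R (- d)) * (Y' x \<bullet> e))"
      using lborel_integral_translate[of "\<lambda>x. \<psi> (x + t *\<^sub>R (- d)) * (Y' x \<bullet> e)" "t *\<^sub>R d"] by simp
    finally have "(LINT x|lborel. ?D x * (\<psi>' x \<bullet> e))
        = (LINT x|lborel. \<psi> x * (Y' x \<bullet> e) - \<psi> (x + t *\<^sub>R (- d)) * (Y' x \<bullet> e))"
      using i3 i4 by simp
    then have "(LINT x|lborel. ?D x * (\<psi>' x \<bullet> e)) / t
        = (LINT x|lborel. \<psi> x * (Y' x \<bullet> e) - \<psi> (x + t *\<^sub>R (- d)) * (Y' x \<bullet> e)) / t"
      by simp
    then have "(LINT x|lborel. ?D x * (\<psi>' x \<bullet> e) / t)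
        = (LINT x|lborel. (\<psi> x * (Y' x \<bullet> e) - \<psi> (x + t *\<^sub>R (- d)) * (Y' x \<bullet> e)) / t)"
      by (simp only: integral_divide_zero)
    then show ?thesis by (simp add: algebra_simps diff_divide_distrib)
  qed
  have "(\<lambda>n. LINT x|lborel. (Y (x + (1 / real (Suc n)) *\<^sub>R d) - Y x) / (1 / real (Suc n)) * (\<psi>' x \<bullet> e))
      \<longlonglongrightarrow> (LINT x|lborel. (Y' x \<bullet> d) * (\<psi>' x \<bullet> e))"
    by (rule difference_quotient_integral[OF Y K]) (use c\<psi> in \<open>auto intro!: continuous_intros\<close>)
  moreover have "(\<lambda>n. LINT x|lborel. (\<psi> (x + (1 / real (Suc n)) *\<^sub>R (- d)) - \<psi> x) / (1 / real (Suc n)) * - (Y' x \<bullet> e))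
      \<longlonglongrightarrow> (LINT x|lborel. (\<psi>' x \<bullet> (- d)) * - (Y' x \<bullet> e))"
    by (rule difference_quotient_integral[OF \<psi> L]) (use cY in \<open>auto intro!: continuous_intros\<close>)
  ultimately have "(LINT x|lborel. (Y' x \<bullet> d) * (\<psi>' x \<bullet> e)) = (LINT x|lborel. (\<psi>' x \<bullet> (- d)) * - (Y' x \<bullet> e))"
    using step[of "1 / real (Suc n)" for n] by (subst (asm) step) (auto intro: LIMSEQ_unique)
  then show ?thesis by (simp add: mult.commute)
qed

text \<open>Turns a function controlled only in \<open>\<Omega>\<close> into one on the whole space,
  to which the results on compact supports apply.\<close>

lemma C1_with_grad_mult_cutoff:
  assumes "open \<Omega>" and Y: "C1_with_grad UNIV Y Y'" and K: "compact K" "K \<subseteq> \<Omega>" "\<And>x. x \<notin> K \<Longrightarrow> Y x = 0"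
    and g: "C1_with_grad \<Omega> g G"
  shows "C1_with_grad UNIV (\<lambda>x. if x \<in> \<Omega> then Y x * g x else 0)
    (\<lambda>x. if x \<in> \<Omega> then Y x *\<^sub>R G x + g x *\<^sub>R Y' x else 0)"
proof (rule C1_with_grad_zero_extension[OF assms(1) compact_imp_closed[OF K(1)] K(2)])
  note m = C1_with_grad_mult[OF C1_with_grad_subset[OF Y subset_UNIV] g]
  show "((\<lambda>x. Y x * g x) has_derivative (\<lambda>v. (Y x *\<^sub>R G x + g x *\<^sub>R Y' x) \<bullet> v)) (at x)"
    if "x \<in> \<Omega>" for x using C1_with_gradD(3)[OF m that] .
  show "continuous_on \<Omega> (\<lambda>x. Y x *\<^sub>R G x + g x *\<^sub>R Y' x)"
    using C1_with_gradD(2)[OF m] closure_subset continuous_on_subset by blast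
qed (use K in auto)

lemma set_integral_gradient_cutoff:
  assumes "open \<Omega>" and Y: "C1_with_grad UNIV Y Y'" and K: "compact K" "K \<subseteq> \<Omega>" "\<And>x. x \<notin> K \<Longrightarrow> Y x = 0"
    and g: "C1_with_grad \<Omega> g G"
  shows "(LINT x:\<Omega>|lborel. (Y x *\<^sub>R G x + g x *\<^sub>R Y' x) \<bullet> e) = 0"
proof -
  have "(LINT x|lborel. (if x \<in> \<Omega> then Y x *\<^sub>R G x + g x *\<^sub>R Y' x else 0) \<bullet> e) = 0"
    by (rule integral_gradient_compact_support[OF C1_with_grad_mult_cutoff[OF assms] K(1)])
      (use K(3) in auto)
  then show ?thesis
    unfolding set_lebesgue_integral_def
    by (smt (verit, best) Bochner_Integration.integral_cong indicator_simps inner_zero_left scaleR_one scaleR_zero_left)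
qed

text \<open>Here \<open>\<psi>\<close> lacks compact support, so it is multiplied by a cutoff
  \<open>\<theta>\<close> equal to \<open>1\<close> on \<open>K\<close>. This changes neither
  integral: on \<open>K\<close> the gradient of \<open>\<theta>\<close> vanishes because
  \<open>\<theta>\<close> is maximal there, and off \<open>K\<close> the factor \<open>Y'\<close>
  vanishes.\<close>

lemma set_integral_gradients_swap:
  assumes "open \<Omega>" and Y: "C1_with_grad UNIV Y Y'" and K: "compact K" "K \<subseteq> \<Omega>" "\<And>x. x \<notin> K \<Longrightarrow> Y x = 0"
    and \<psi>: "C1_with_grad \<Omega> \<psi> \<psi>'"
  shows "(LINT x:\<Omega>|lborel. (Y' x \<bullet> d) * (\<psi>' x \<bullet> e)) = (LINT x:\<Omega>|lborel. (Y' x \<bullet> e) * (\<psi>' x \<bullet> d))"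
proof -
  obtain \<theta> \<Theta> L where \<theta>: "C1_with_grad UNIV \<theta> \<Theta>" "compact L" "L \<subseteq> \<Omega>"
    "\<And>x. x \<notin> L \<Longrightarrow> \<theta> x = 0" "\<And>x. 0 \<le> \<theta> x" "\<And>x. \<theta> x \<le> 1" "\<And>x. x \<in> K \<Longrightarrow> \<theta> x = 1"
    by (rule C1_cutoff[OF K(1) assms(1) K(2)]; (assumption | rule that; assumption))
  have \<Theta>0: "\<Theta> x = 0" if "x \<in> K" for x
    by (rule C1_with_grad_max_eq_0[OF \<theta>(1)]) (use \<theta>(6,7) that in simp)
  have Y'0: "Y' x = 0" if "x \<notin> K" for x
    using C1_with_grad_UNIV_eq_0[OF Y compact_imp_closed[OF K(1)] that K(3)] by simp
  let ?P = "\<lambda>x. if x \<in> \<Omega> then \<theta> x *\<^sub>R \<psi>' x + \<psi> x *\<^sub>R \<Theta> x else 0"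
  have eq: "(LINT x:\<Omega>|lborel. (Y' x \<bullet> a) * (\<psi>' x \<bullet> b)) = (LINT x|lborel. (Y' x \<bullet> a) * (?P x \<bullet> b))" for a b
    unfolding set_lebesgue_integral_def
  proof (rule Bochner_Integration.integral_cong[OF refl])
    fix x
    show "indicator \<Omega> x *\<^sub>R ((Y' x \<bullet> a) * (\<psi>' x \<bullet> b)) = (Y' x \<bullet> a) * (?P x \<bullet> b)"
      using \<Theta>0[of x] Y'0[of x] \<theta>(7)[of x] K(2) by (cases "x \<in> K") (auto simp: indicator_def)
  qed
  show ?thesis
    unfolding eq
    by (rule integral_gradients_swap[OF Y K(1,3) C1_with_grad_mult_cutoff[OF assms(1) \<theta>(1-4) \<psi>] \<theta>(2)])
      (use \<theta>(4) in auto)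
qed

text \<open>The fundamental lemma of the calculus of variations with \<open>C^1\<close> test
  functions. The sign \<open>s\<close> treats positive and negative values at once: a cutoff that is
  \<open>1\<close> on a small ball and supported where \<open>s * G\<close> is large would give a
  positive integral.\<close>

lemma continuous_eq_0_if_integral_test_0:
  fixes G :: "real^'n \<Rightarrow> real"
  assumes "open \<Omega>" and G: "continuous_on \<Omega> G"
    and t: "\<And>\<theta> \<Theta> K. C1_with_grad UNIV \<theta> \<Theta> \<Longrightarrow> compact K \<Longrightarrow> K \<subseteq> \<Omega> \<Longrightarrow> (\<And>x. x \<notin> K \<Longrightarrow> \<theta> x = 0)
      \<Longrightarrow> (LINT x:\<Omega>|lborel. G x * \<theta> x) = 0"
    and x: "x \<in> \<Omega>"
  shows "G x = 0"
proof -
  have no: "\<not> s * G x > 0" if "s = 1 \<or> s = -1" for s :: real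
  proof
    assume pos: "s * G x > 0"
    \<comment> \<open>Half the value at \<open>x\<close>, so that the lower bound persists on a ball
      around \<open>x\<close>.\<close>
    define c where "c = s * G x / 2"
    have c: "c > 0" "s * G x > c" using pos by (auto simp: c_def)
    have cs: "continuous_on \<Omega> (\<lambda>y. s * G y)" using G by (intro continuous_intros)
    have "open {y \<in> \<Omega>. s * G y > c}"
      using continuous_open_preimage[OF cs assms(1), of "{c<..}"]
      by (simp add: vimage_def Int_def)
    moreover have "x \<in> {y \<in> \<Omega>. s * G y > c}" using x c by auto
    ultimately obtain r where r: "r > 0" "cball x r \<subseteq> {y \<in> \<Omega>. s * G y > c}"
      using open_contains_cball by blast
    let ?U = "{y \<in> \<Omega>. s * G y > c}"
    obtain \<theta> \<Theta> L where \<theta>: "C1_with_grad UNIV \<theta> \<Theta>" "compact L" "L \<subseteq> ?U"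
      "\<And>x. x \<notin> L \<Longrightarrow> \<theta> x = 0" "\<And>x. 0 \<le> \<theta> x" "\<And>y. \<theta> y \<le> 1" "\<And>y. y \<in> cball x r \<Longrightarrow> \<theta> y = 1"
      by (rule C1_cutoff[OF compact_cball \<open>open ?U\<close> r(2)]; (assumption | rule that; assumption))
    have L\<Omega>: "L \<subseteq> \<Omega>" using \<theta>(3) by auto
    have i: "integrable lborel (\<lambda>y. indicator \<Omega> y *\<^sub>R (s * (G y * \<theta> y)))"
    proof (rule integrable_lborel_compact_support[OF _ \<theta>(2)])
      have "continuous_on L (\<lambda>y. s * (G y * \<theta> y))"
        using continuous_on_subset[OF G L\<Omega>] C1_with_grad_UNIV_continuous[OF \<theta>(1)]
        by (intro continuous_intros)
      then show "continuous_on L (\<lambda>y. indicator \<Omega> y *\<^sub>R (s * (G y * \<theta> y)))"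
        by (rule continuous_on_eq) (use L\<Omega> in auto)
    qed (use \<theta>(4) in auto)
    have i2: "integrable lborel (\<lambda>y. c * indicator (cball x r) y)"
      by (intro integrable_mult_right integrable_real_indicator) (auto intro: emeasure_compact_finite[unfolded infinity_ennreal_def])
    have "c * measure lborel (cball x r) = (LINT y|lborel. c * indicator (cball x r) y)"
      by simp
    also have "\<dots> \<le> (LINT y|lborel. indicator \<Omega> y *\<^sub>R (s * (G y * \<theta> y)))"
    proof (rule integral_mono[OF i2 i])
      fix y
      show "c * indicator (cball x r) y \<le> indicator \<Omega> y *\<^sub>R (s * (G y * \<theta> y))"
      proof (cases "y \<in> cball x r")
        case True
        then show ?thesis using r(2) \<theta>(7)[OF True] by (auto simp: indicator_def)
      next
        case False
        show ?thesis
        proof (cases "y \<in> L")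
          case True
          then have "s * G y > c" using \<theta>(3) by auto
          then have "0 \<le> (s * G y) * \<theta> y" using \<theta>(5)[of y] c(1) by simp
          then show ?thesis using False by (simp add: indicator_def mult.assoc)
        qed (use False \<theta>(4) in simp)
      qed
    qed
    also have "\<dots> = s * (LINT y:\<Omega>|lborel. G y * \<theta> y)"
      unfolding set_lebesgue_integral_def by (subst integral_mult_right_zero[symmetric]) (auto intro!: Bochner_Integration.integral_cong simp: algebra_simps)
    also have "\<dots> = 0" using t[OF \<theta>(1,2) L\<Omega> \<theta>(4)] by simp
    finally have "measure lborel (cball x r) \<le> 0" using c(1) by (simp add: mult_le_0_iff)
    moreover have "measure lborel (cball x r) > 0"
      using content_cball_pos[OF r(1)] by simp
    ultimately show False by simp
  qed
  show ?thesis using no[of 1] no[of "-1"] by auto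
qed

subsection \<open>Graphs\<close>

text \<open>The cubic Hermite step shifted to \<open>[1, 2]\<close>. It still vanishes up to
  \<open>1\<close>, so that after scaling its support keeps a positive distance from the level
  zero.\<close>

definition smooth_step :: "real \<Rightarrow> real" where
  "smooth_step t = (if t \<ge> 1 then if t \<ge> 2 then 1 else 3 * (t - 1)\<^sup>2 - 2 * (t - 1) ^ 3 else 0)"

text \<open>The derivative of \<open>smooth_step\<close>; the maximum cuts off the negative parts of
  the parabola outside \<open>[1, 2]\<close>. Having integral \<open>1\<close>, it yields an
  approximate identity after rescaling.\<close>

definition step_bump :: "real \<Rightarrow> real" where
  "step_bump t = max 0 (6 * (t - 1) * (2 - t))"

lemma step_bump_eq: "step_bump t = (if t \<ge> 1 then if t \<ge> 2 then 0 else 6 * (t - 1) * (2 - t) else 0)"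
  by (auto simp: step_bump_def max_def mult_le_0_iff zero_le_mult_iff)

lemma DERIV_smooth_step: "(smooth_step has_real_derivative step_bump t) (at t)"
proof -
  have "((\<lambda>t. if t \<ge> 1 then if t \<ge> 2 then 1 else 3 * (t - 1)\<^sup>2 - 2 * (t - 1) ^ 3 else 0)
      has_real_derivative (if t \<ge> 1 then if t \<ge> 2 then 0 else 6 * (t - 1) * (2 - t) else 0)) (at t)"
  proof (rule DERIV_paste)
    fix t :: real
    show "((\<lambda>t. if t \<ge> 2 then 1 else 3 * (t - 1)\<^sup>2 - 2 * (t - 1) ^ 3)
        has_real_derivative (if t \<ge> 2 then 0 else 6 * (t - 1) * (2 - t))) (at t)"
      by (rule DERIV_paste) (auto intro!: derivative_eq_intros simp: power2_eq_square algebra_simps)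
  qed auto
  then show ?thesis
    by (simp add: smooth_step_def[abs_def] step_bump_eq)
qed

lemma continuous_on_step_bump: "continuous_on S step_bump"
  unfolding step_bump_def by (intro continuous_intros)

lemma smooth_step_bounds: "0 \<le> smooth_step t" "smooth_step t \<le> 1"
proof -
  have "3 * u\<^sup>2 - 2 * u ^ 3 = u\<^sup>2 * (3 - 2 * u)" "1 - (3 * u\<^sup>2 - 2 * u ^ 3) = (1 - u)\<^sup>2 * (1 + 2 * u)" for u :: real
    by (auto simp: power2_eq_square power3_eq_cube algebra_simps)
  then have "0 \<le> 3 * u\<^sup>2 - 2 * u ^ 3 \<and> 3 * u\<^sup>2 - 2 * u ^ 3 \<le> 1" if "0 \<le> u" "u \<le> 1" for u :: real
    using that by (smt (verit) mult_nonneg_nonneg zero_le_power2)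
  from this[of "t - 1"] show "0 \<le> smooth_step t" "smooth_step t \<le> 1"
    by (auto simp: smooth_step_def)
qed

lemma smooth_step_simps: "t \<le> 1 \<Longrightarrow> smooth_step t = 0" "t \<ge> 2 \<Longrightarrow> smooth_step t = 1"
  by (auto simp: smooth_step_def)

lemma step_bump_nonneg: "0 \<le> step_bump t"
  by (simp add: step_bump_def)

lemma step_bump_eq_0: "t \<le> 1 \<Longrightarrow> step_bump t = 0"
  by (auto simp: step_bump_eq)

lemma has_bochner_integral_step_bump: "has_bochner_integral lborel step_bump 1"
proof -
  have "has_bochner_integral lborel (\<lambda>t. step_bump t * indicator {1..2} t) (smooth_step 2 - smooth_step 1)"
    using continuous_on_step_bump[of UNIV] DERIV_smooth_step
    by (intro has_bochner_integral_FTC_Icc_real) (auto simp: continuous_on_eq_continuous_at)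
  moreover have "(\<lambda>t. step_bump t * indicator {1..2} t) = step_bump"
    by (auto simp: step_bump_eq indicator_def fun_eq_iff)
  ultimately show ?thesis by (simp add: smooth_step_simps)
qed

lemma step_bump_measurable [measurable]: "step_bump \<in> borel_measurable borel"
  using continuous_on_step_bump by (rule borel_measurable_continuous_onI)

section \<open>Lebesgue measure in graph coordinates\<close>

lemma base_point_measurable [measurable]:
  "base_point k \<in> borel_measurable (PiM (Basis - {axis k 1}) (\<lambda>_. lborel))"
proof -
  have "(\<lambda>y. \<Sum>b\<in>Basis - {axis k 1}. y b *\<^sub>R b) \<in> borel_measurable (PiM (Basis - {axis k 1}) (\<lambda>_. lborel))"
    by (intro borel_measurable_sum borel_measurable_scaleR borel_measurable_const)
      (use measurable_component_singleton[where M="\<lambda>_. lborel"] in simp)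
  then show ?thesis by (simp add: base_point_def[abs_def])
qed

lemma axis_in_Basis: "axis k (1::real) \<in> Basis"
  by (auto simp: Basis_vec_def)

lemma base_point_inner:
  fixes b :: "real^'n"
  assumes "b \<in> Basis"
  shows "base_point k y \<bullet> b = (if b = axis k 1 then 0 else y b)"
proof -
  have "base_point k y \<bullet> b = (\<Sum>c\<in>Basis - {axis k 1}. y c * (c \<bullet> b))"
    by (simp add: base_point_def inner_sum_left)
  also have "\<dots> = (\<Sum>c\<in>Basis - {axis k 1}. if c = b then y c else 0)"
    by (intro sum.cong) (use assms in \<open>auto simp: inner_Basis\<close>)
  also have "\<dots> = (if b = axis k 1 then 0 else y b)"
    using assms by (simp add: sum.delta')
  finally show ?thesis .
qed

lemma base_point_nth: "base_point k y $ k = 0"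
  using base_point_inner[of "axis k 1" k y] by (simp add: axis_in_Basis inner_axis)

text \<open>Fubini with coordinate \<open>k\<close> innermost. For fixed \<open>y\<close> the shift
  by \<open>\<gamma> y\<close> and the reflection by \<open>s\<close> preserve one-dimensional
  Lebesgue measure, so \<open>t\<close> becomes the signed height over the graph without a
  Jacobian.\<close>

lemma lborel_graph_coordinates:
  fixes H :: "real^'n \<Rightarrow> real"
  assumes H: "integrable lborel H" and s: "s = 1 \<or> s = -1"
  shows "(LINT x|lborel. H x) = (LINT y|PiM (Basis - {axis k 1}) (\<lambda>_. lborel). LINT t|lborel.
      H (base_point k y + (\<gamma> y + s * t) *\<^sub>R axis k 1))"
proof -
  interpret product_sigma_finite "\<lambda>_::real^'n. lborel :: real measure" ..
  let ?e = "axis k 1 :: real^'n" and ?I = "Basis - {axis k 1 :: real^'n}"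
  have B: "Basis = insert ?e ?I" by (auto simp: axis_in_Basis)
  let ?T = "\<lambda>f. \<Sum>b\<in>Basis. f b *\<^sub>R (b :: real^'n)"
  have T [measurable]: "?T \<in> borel_measurable (\<Pi>\<^sub>M b\<in>Basis. lborel)"
    by (intro borel_measurable_sum borel_measurable_scaleR borel_measurable_const)
      (use measurable_component_singleton[where M="\<lambda>_. lborel"] in simp)
  have Hm [measurable]: "H \<in> borel_measurable borel"
    using borel_measurable_integrable[OF H] by simp
  have i: "integrable (\<Pi>\<^sub>M b\<in>insert ?e ?I. lborel) (\<lambda>f. H (?T f))"
    using H unfolding lborel_eq[where 'a="real^'n"] B[symmetric]
    by (subst (asm) integrable_distr_eq) auto
  have T2: "?T (y(?e := t)) = base_point k y + t *\<^sub>R ?e" for y t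
  proof -
    have "?T (y(?e := t)) = (y(?e := t)) ?e *\<^sub>R ?e + (\<Sum>b\<in>?I. (y(?e := t)) b *\<^sub>R b)"
      by (rule sum.remove) (auto simp: axis_in_Basis)
    also have "(\<Sum>b\<in>?I. (y(?e := t)) b *\<^sub>R b) = base_point k y"
      unfolding base_point_def by (intro sum.cong) auto
    finally show ?thesis by (simp add: add.commute)
  qed
  have "(LINT x|lborel. H x) = (LINT f|(\<Pi>\<^sub>M b\<in>Basis. lborel). H (?T f))"
    unfolding lborel_eq[where 'a="real^'n"] by (rule integral_distr) auto
  also have "\<dots> = (LINT f|(\<Pi>\<^sub>M b\<in>insert ?e ?I. lborel). H (?T f))"
    by (simp only: B[symmetric])
  also have "\<dots> = (LINT y|PiM ?I (\<lambda>_. lborel). LINT t|lborel. H (?T (y(?e := t))))"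
    by (rule product_integral_insert[OF _ _ i]) auto
  also have "\<dots> = (LINT y|PiM ?I (\<lambda>_. lborel). LINT t|lborel. H (base_point k y + (\<gamma> y + s * t) *\<^sub>R ?e))"
  proof (rule Bochner_Integration.integral_cong[OF refl])
    fix y
    have "s \<noteq> 0" "\<bar>s\<bar> = 1" using s by auto
    then show "(LINT t|lborel. H (?T (y(?e := t)))) = (LINT t|lborel. H (base_point k y + (\<gamma> y + s * t) *\<^sub>R ?e))"
      unfolding T2
      using lborel_integral_real_affine[of s "\<lambda>t. H (base_point k y + t *\<^sub>R ?e)" "\<gamma> y"] by simp
  qed
  finally show ?thesis .
qed

text \<open>The defining function of a patch: zero on the graph and positive on the side of the
  domain.\<close>

definition graph_level :: "'n \<Rightarrow> real \<Rightarrow> (real^'n \<Rightarrow> real) \<Rightarrow> real^'n \<Rightarrow> real" where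
  "graph_level k s \<gamma> x = s * (x $ k - \<gamma> x)"

definition graph_grad :: "'n \<Rightarrow> real \<Rightarrow> (real^'n \<Rightarrow> real) \<Rightarrow> real^'n \<Rightarrow> real^'n" where
  "graph_grad k s \<gamma> x = s *\<^sub>R (axis k 1 - grad UNIV \<gamma> x)"

definition graph_point :: "'n \<Rightarrow> (real^'n \<Rightarrow> real) \<Rightarrow> (real^'n \<Rightarrow> real) \<Rightarrow> real^'n" where
  "graph_point k \<gamma> y = base_point k y + \<gamma> (base_point k y) *\<^sub>R axis k 1"

section \<open>The defining function and the surface measure of one graph\<close>

locale graph_function =
  fixes k :: "'n::finite" and s :: real and \<gamma> :: "real^'n \<Rightarrow> real"
  assumes s: "s = 1 \<or> s = -1" and \<gamma>_smooth: "\<And>m. Ck_closure m UNIV \<gamma>"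
    and \<gamma>_indep: "\<And>x y. (\<And>i. i \<noteq> k \<Longrightarrow> x $ i = y $ i) \<Longrightarrow> \<gamma> x = \<gamma> y"
begin

abbreviation F where "F \<equiv> graph_level k s \<gamma>"
abbreviation F' where "F' \<equiv> graph_grad k s \<gamma>"
abbreviation M where "M \<equiv> PiM (Basis - {axis k 1 :: real^'n}) (\<lambda>_. lborel :: real measure)"

lemma ss: "s * s = 1"
  using s by auto

lemma C1_\<gamma>: "C1_with_grad UNIV \<gamma> (grad UNIV \<gamma>)"
  by (rule Ck_closure_1_C1_with_grad[OF \<gamma>_smooth])

lemma C1_F: "C1_with_grad UNIV F F'"
  unfolding graph_level_def graph_grad_def
  by (intro C1_with_grad_cmult C1_with_grad_diff C1_with_grad_component C1_\<gamma>)

lemma F_cont: "continuous_on S F" "continuous_on S F'" "continuous_on S \<gamma>" "continuous_on S (grad UNIV \<gamma>)"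
  using C1_with_grad_UNIV_continuous[OF C1_F] C1_with_grad_UNIV_continuous[OF C1_\<gamma>] by auto

lemma F_measurable [measurable]: "F \<in> borel_measurable borel" "F' \<in> borel_measurable borel"
    "\<gamma> \<in> borel_measurable borel" "grad UNIV \<gamma> \<in> borel_measurable borel"
  using F_cont by (auto intro: borel_measurable_continuous_onI)

lemma \<gamma>_shift: "\<gamma> (x + t *\<^sub>R axis k 1) = \<gamma> x"
  by (rule \<gamma>_indep) (simp add: axis_def)

lemma grad_\<gamma>_shift: "grad UNIV \<gamma> (x + t *\<^sub>R axis k 1) = grad UNIV \<gamma> x"
proof -
  have "C1_with_grad UNIV \<gamma> (\<lambda>x. grad UNIV \<gamma> (x + t *\<^sub>R axis k 1))"
    using C1_with_grad_translate[OF C1_\<gamma>, of "t *\<^sub>R axis k 1"] by (simp add: \<gamma>_shift)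
  from C1_with_grad_grad[OF open_UNIV this, of x] show ?thesis by simp
qed

lemma F_shift: "F (x + t *\<^sub>R axis k 1) = F x + s * t" "F' (x + t *\<^sub>R axis k 1) = F' x"
  by (auto simp: graph_level_def graph_grad_def \<gamma>_shift grad_\<gamma>_shift algebra_simps)

lemma grad_\<gamma>_k: "grad UNIV \<gamma> x $ k = 0"
proof -
  have a: "((\<lambda>t. x + t *\<^sub>R axis k 1) has_derivative (\<lambda>t. t *\<^sub>R axis k 1)) (at (0::real))"
    by (auto intro!: derivative_eq_intros)
  have b: "(\<gamma> has_derivative (\<lambda>v. grad UNIV \<gamma> x \<bullet> v)) (at (x + (0::real) *\<^sub>R axis k 1))"
    using C1_with_gradD(3)[OF C1_\<gamma>] by simp
  have "((\<lambda>t::real. \<gamma> x) has_derivative (\<lambda>t. grad UNIV \<gamma> x \<bullet> (t *\<^sub>R axis k 1))) (at 0)"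
    using has_derivative_compose[OF a b] by (simp add: \<gamma>_shift)
  then have "(\<lambda>t::real. grad UNIV \<gamma> x \<bullet> (t *\<^sub>R axis k 1)) = (\<lambda>t. 0)"
    using has_derivative_unique has_derivative_const by blast
  from fun_cong[OF this, of 1] show ?thesis by (simp add: inner_axis)
qed

text \<open>As \<open>\<gamma>\<close> has no derivative in direction \<open>k\<close>, the mixed
  term vanishes. The gradient of the defining function thus has exactly the area density of the
  graph as its norm, which is why a boundary layer of \<open>F\<close> produces surface
  measure.\<close>

lemma norm_F': "norm (F' x) = sqrt (1 + (norm (grad UNIV \<gamma> x))\<^sup>2)"
proof -
  have "(norm (F' x))\<^sup>2 = (axis k 1 - grad UNIV \<gamma> x) \<bullet> (axis k 1 - grad UNIV \<gamma> x)"
    unfolding power2_norm_eq_inner using ss by (simp add: graph_grad_def flip: mult.assoc)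
  also have "\<dots> = 1 + (norm (grad UNIV \<gamma> x))\<^sup>2"
    using grad_\<gamma>_k[of x]
    by (simp add: inner_diff_left inner_diff_right inner_axis inner_axis' power2_norm_eq_inner)
  finally show ?thesis by (metis norm_ge_zero real_sqrt_unique)
qed

lemma norm_F'_pos: "norm (F' x) \<ge> 1" "F' x \<noteq> 0"
proof -
  show "norm (F' x) \<ge> 1" unfolding norm_F' by simp
  then show "F' x \<noteq> 0" by auto
qed

lemma graph_point_shift: "F (graph_point k \<gamma> y + (s * t) *\<^sub>R axis k 1) = t"
proof -
  have "F (graph_point k \<gamma> y) = 0"
    by (simp add: graph_point_def graph_level_def base_point_nth \<gamma>_shift)
  then show ?thesis using ss by (simp add: F_shift flip: mult.assoc)
qed

lemma F_graph_point: "F (graph_point k \<gamma> y) = 0"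
  using graph_point_shift[of y 0] by simp

lemma F'_graph_point: "F' (graph_point k \<gamma> y) = F' (base_point k y)"
  by (simp add: graph_point_def F_shift)

lemma graph_point_inner:
  "b \<in> Basis - {axis k 1} \<Longrightarrow> (graph_point k \<gamma> y + t *\<^sub>R axis k 1) \<bullet> b = y b"
  by (auto simp: graph_point_def inner_add_left base_point_inner inner_Basis axis_in_Basis)

lemma graph_point_measurable [measurable]: "graph_point k \<gamma> \<in> borel_measurable M"
proof -
  have "(\<lambda>y. \<gamma> (base_point k y)) \<in> borel_measurable M"
    by (rule measurable_compose[OF base_point_measurable F_measurable(3)])
  then show ?thesis
    unfolding graph_point_def[abs_def]
    by (intro borel_measurable_add borel_measurable_scaleR base_point_measurable borel_measurable_const)
qed

lemma graph_measure_altdef: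
  "graph_measure c r k \<gamma> = density (distr (density M (\<lambda>y. ennreal (norm (F' (graph_point k \<gamma> y))))) borel
     (graph_point k \<gamma>)) (\<lambda>x. ennreal (indicator (ball c r) x))"
  unfolding graph_measure_def F'_graph_point norm_F'
  by (simp add: ennreal_indicator graph_point_def[abs_def])

lemma sets_graph_measure [measurable_cong]: "sets (graph_measure c r k \<gamma>) = sets borel"
  by (simp add: graph_measure_def)

lemma space_graph_measure: "space (graph_measure c r k \<gamma>) = UNIV"
  by (simp add: graph_measure_def)

lemma integral_graph_measure:
  fixes Q :: "real^'n \<Rightarrow> real"
  assumes [measurable]: "Q \<in> borel_measurable borel"
  shows "(LINT x|graph_measure c r k \<gamma>. Q x) =
    (LINT y|M. norm (F' (graph_point k \<gamma> y)) * (indicator (ball c r) (graph_point k \<gamma> y) * Q (graph_point k \<gamma> y)))"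
proof -
  have [measurable]: "(\<lambda>y. norm (F' (graph_point k \<gamma> y))) \<in> borel_measurable M"
    by (rule measurable_compose[OF graph_point_measurable]) simp
  have [measurable]: "ball c r \<in> sets borel" by simp
  have m2 [measurable]: "(\<lambda>x. indicator (ball c r) x * Q x) \<in> borel_measurable borel" by measurable
  have m3 [measurable]: "(\<lambda>y. indicator (ball c r) (graph_point k \<gamma> y) * Q (graph_point k \<gamma> y)) \<in> borel_measurable M"
    by (rule measurable_compose[OF graph_point_measurable m2])
  show ?thesis
    unfolding graph_measure_altdef
    using assms by (subst integral_density) (auto simp: integral_distr integral_density)
qed

lemma AE_graph_measure: "AE x in graph_measure c r k \<gamma>. F x = 0"
proof -
  have "AE x in distr (density M (\<lambda>y. ennreal (norm (F' (graph_point k \<gamma> y))))) borel (graph_point k \<gamma>). F x = 0"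
    by (subst AE_distr_iff) (auto simp: F_graph_point)
  then show ?thesis
    unfolding graph_measure_altdef by (subst AE_density) (auto intro: borel_measurable_indicator)
qed

lemma bounded_box_measure:
  "emeasure M (PiE (Basis - {axis k 1}) (\<lambda>_. {- R..R})) < \<infinity>"
proof -
  interpret product_sigma_finite "\<lambda>_::real^'n. lborel :: real measure" ..
  show ?thesis
    by (subst emeasure_PiM) (auto simp: emeasure_lborel_Icc_eq prod_constant power_less_top_ennreal)
qed

text \<open>Moving along \<open>axis k 1\<close> keeps the other coordinates equal to those of
  \<open>y\<close>; if one of them exceeds \<open>R\<close> in absolute value, the whole vertical
  line misses \<open>K\<close>. The box has finite measure and dominates integrals over
  \<open>M\<close>.\<close>

lemma graph_point_outside:
  assumes K: "\<And>x. x \<in> K \<Longrightarrow> norm x \<le> R" and y: "y \<in> space M"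
    and "y \<notin> PiE (Basis - {axis k 1}) (\<lambda>_. {- R..R})"
  shows "graph_point k \<gamma> y + t *\<^sub>R axis k 1 \<notin> K"
proof
  assume *: "graph_point k \<gamma> y + t *\<^sub>R axis k 1 \<in> K"
  have "y b \<in> {- R..R}" if "b \<in> Basis - {axis k 1}" for b
    using Basis_le_norm[of b "graph_point k \<gamma> y + t *\<^sub>R axis k 1"] K[OF *] graph_point_inner[OF that, of y t] that
    by auto
  then have "y \<in> PiE (Basis - {axis k 1}) (\<lambda>_. {- R..R})"
    using y by (simp add: space_PiM PiE_def Pi_def)
  with assms(3) show False by simp
qed

text \<open>Only parameters in a bounded box reach the ball, and the area density is bounded on the
  closed ball.\<close>

lemma finite_graph_measure: "emeasure (graph_measure c r k \<gamma>) UNIV < \<infinity>"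
proof -
  obtain R where R: "\<And>x. x \<in> cball c r \<Longrightarrow> norm x \<le> R"
    using bounded_cball[of c r] unfolding bounded_iff by blast
  have "bounded ((\<lambda>x. norm (F' x)) ` cball c r)"
    by (intro compact_imp_bounded compact_continuous_image continuous_intros F_cont) auto
  then obtain C where C: "\<And>x. x \<in> cball c r \<Longrightarrow> norm (F' x) \<le> C"
    unfolding bounded_iff by (auto simp del: mem_cball)
  let ?B = "PiE (Basis - {axis k 1}) (\<lambda>_. {- R..R})"
  have [measurable]: "(\<lambda>y. ennreal (norm (F' (graph_point k \<gamma> y)))) \<in> borel_measurable M"
    by (intro measurable_compose[OF graph_point_measurable]) simp
  have m1 [measurable]: "(\<lambda>x. ennreal (indicator (ball c r) x)) \<in> borel_measurable borel"
    by (intro measurable_compose[OF borel_measurable_indicator]) auto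
  have m2 [measurable]: "(\<lambda>y. ennreal (indicator (ball c r) (graph_point k \<gamma> y))) \<in> borel_measurable M"
    by (rule measurable_compose[OF graph_point_measurable m1])
  have B: "?B \<in> sets M" by (rule sets_PiM_I_finite) auto
  have "emeasure (graph_measure c r k \<gamma>) UNIV
      = (\<integral>\<^sup>+ y. ennreal (norm (F' (graph_point k \<gamma> y))) * ennreal (indicator (ball c r) (graph_point k \<gamma> y)) \<partial>M)"
    unfolding graph_measure_altdef
    using m1 m2 by (subst emeasure_density) (auto simp: nn_integral_distr nn_integral_density)
  also have "\<dots> \<le> (\<integral>\<^sup>+ y. ennreal C * indicator ?B y \<partial>M)"
  proof (rule nn_integral_mono)
    fix y assume y: "y \<in> space M"
    show "ennreal (norm (F' (graph_point k \<gamma> y))) * ennreal (indicator (ball c r) (graph_point k \<gamma> y)) \<le> ennreal C * indicator ?B y"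
    proof (cases "graph_point k \<gamma> y \<in> ball c r")
      case True
      then have "graph_point k \<gamma> y + 0 *\<^sub>R axis k 1 \<in> cball c r" by auto
      then have "y \<in> ?B" using graph_point_outside[of "cball c r" R y 0, OF R y] by blast
      then show ?thesis using True C[of "graph_point k \<gamma> y"] by (auto simp: ennreal_leI)
    qed (simp add: indicator_def)
  qed
  also have "\<dots> = ennreal C * emeasure M ?B" using B by (rule nn_integral_cmult_indicator)
  also have "\<dots> < \<infinity>" using bounded_box_measure[of R] by (simp add: ennreal_mult_less_top)
  finally show ?thesis .
qed

text \<open>In graph coordinates \<open>F\<close> is the height \<open>t\<close>, and the rescaled
  bump is an approximate identity living on heights between \<open>1\<close> and \<open>2\<close>
  divided by \<open>Suc n\<close>. These lie on the side where \<open>G\<close> is continuous up to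
  the graph. Dominated convergence is applied in \<open>t\<close> for fixed \<open>y\<close>, and
  again in \<open>y\<close>.\<close>

lemma step_bump_concentrates:
  fixes G :: "real^'n \<Rightarrow> real"
  assumes G: "continuous_on {x. F x \<ge> 0} G" and K: "compact K" "\<And>x. x \<notin> K \<Longrightarrow> G x = 0"
    and neg: "\<And>x. F x < 0 \<Longrightarrow> G x = 0"
  shows "(\<lambda>n. LINT x|lborel. G x * (real (Suc n) * step_bump (real (Suc n) * F x)))
    \<longlonglongrightarrow> (LINT y|M. G (graph_point k \<gamma> y))"
proof -
  have closed: "closed {x. F x \<ge> 0}"
    using continuous_closed_preimage[OF F_cont(1)[of UNIV] closed_UNIV, of "{0..}"] by (simp add: vimage_def)
  have "(\<lambda>x. indicator {x. F x \<ge> 0} x *\<^sub>R G x) = G"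
    using neg by (force simp: indicator_def fun_eq_iff)
  then have Gm [measurable]: "G \<in> borel_measurable borel"
    using borel_measurable_continuous_on_indicator[OF _ G] closed by (metis borel_closed)
  have cK: "compact (K \<inter> {x. F x \<ge> 0})" using K(1) closed by blast
  have "bounded (G ` (K \<inter> {x. F x \<ge> 0}))"
    by (intro compact_imp_bounded compact_continuous_image cK continuous_on_subset[OF G]) auto
  then obtain C where C: "\<And>x. x \<in> K \<inter> {x. F x \<ge> 0} \<Longrightarrow> \<bar>G x\<bar> \<le> C" "C > 0"
    unfolding bounded_pos by auto
  have Cb: "\<bar>G x\<bar> \<le> C" for x
    using C K(2)[of x] neg[of x] by (cases "x \<in> K \<inter> {x. F x \<ge> 0}") (auto simp: not_le)
  obtain R where R: "\<And>x. x \<in> K \<Longrightarrow> norm x \<le> R"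
    using compact_imp_bounded[OF K(1)] by (auto simp: bounded_iff)
  let ?B = "PiE (Basis - {axis k 1}) (\<lambda>_. {- R..R})"
  let ?p = "graph_point k \<gamma>" and ?e = "axis k 1 :: real^'n"
  \<comment> \<open>The inner integral after rescaling the height; the substitution absorbs the
    factor \<open>Suc n\<close>.\<close>
  define J where "J n y = (LINT t|lborel. G (?p y + (s * (t / real (Suc n))) *\<^sub>R ?e) * step_bump t)" for n y
  have step_int: "integrable lborel step_bump" "(LINT t|lborel. step_bump t) = 1"
    using has_bochner_integral_step_bump by (auto simp: has_bochner_integral_iff)
  have eq: "(LINT x|lborel. G x * (real (Suc n) * step_bump (real (Suc n) * F x))) = (LINT y|M. J n y)" for n
  proof -
    let ?N = "real (Suc n)"
    have i: "integrable lborel (\<lambda>x. G x * (?N * step_bump (?N * F x)))"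
    proof (rule integrable_lborel_compact_support[OF _ cK])
      have "continuous_on UNIV (\<lambda>x. step_bump (?N * F x))"
        by (rule continuous_on_compose2[OF continuous_on_step_bump]) (auto intro!: continuous_intros F_cont)
      then show "continuous_on (K \<inter> {x. F x \<ge> 0}) (\<lambda>x. G x * (?N * step_bump (?N * F x)))"
        using G by (intro continuous_intros) (auto intro: continuous_on_subset)
    qed (use K(2) neg in \<open>auto simp: not_le\<close>)
    have "(LINT x|lborel. G x * (?N * step_bump (?N * F x))) = (LINT y|M. LINT t|lborel.
        G (?p y + (s * t) *\<^sub>R ?e) * (?N * step_bump (?N * F (?p y + (s * t) *\<^sub>R ?e))))"
      by (subst lborel_graph_coordinates[OF i s, where k=k and \<gamma>="\<lambda>y. \<gamma> (base_point k y)"])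
        (simp add: graph_point_def scaleR_add_left add.assoc)
    also have "\<dots> = (LINT y|M. J n y)"
    proof (rule Bochner_Integration.integral_cong[OF refl])
      fix y
      show "(LINT t|lborel. G (?p y + (s * t) *\<^sub>R ?e) * (?N * step_bump (?N * F (?p y + (s * t) *\<^sub>R ?e)))) = J n y"
        unfolding graph_point_shift J_def
        by (subst lborel_integral_real_affine[where c="1 / ?N" and t=0])
          (simp_all add: mult.left_commute[of _ "real (Suc n)"] del: of_nat_Suc)
    qed
    finally show ?thesis .
  qed
  have J_lim: "(\<lambda>n. J n y) \<longlonglongrightarrow> G (?p y)" for y
  proof -
    have "(\<lambda>n. J n y) \<longlonglongrightarrow> (LINT t|lborel. G (?p y) * step_bump t)"
      unfolding J_def
    proof (rule integral_dominated_convergence[where w="\<lambda>t. C * step_bump t"])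
      show "integrable lborel (\<lambda>t. C * step_bump t)" using step_int by simp
      show "AE t in lborel. (\<lambda>n. G (?p y + (s * (t / real (Suc n))) *\<^sub>R ?e) * step_bump t) \<longlonglongrightarrow> G (?p y) * step_bump t"
      proof (rule AE_I2)
        fix t :: real
        show "(\<lambda>n. G (?p y + (s * (t / real (Suc n))) *\<^sub>R ?e) * step_bump t) \<longlonglongrightarrow> G (?p y) * step_bump t"
        \<comment> \<open>Continuity of \<open>G\<close> is known only on the side
          \<open>F \<ge> 0\<close>; for \<open>t \<le> 0\<close> the bump vanishes, and for
          \<open>t > 0\<close> the points approach the graph within that side.\<close>
        proof (cases "t \<le> 0")
          case True
          then show ?thesis by (simp add: step_bump_eq_0)
        next
          case False
          have "(\<lambda>n. t / real (Suc n)) \<longlonglongrightarrow> 0"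
            using tendsto_mult[OF tendsto_const[of t] LIMSEQ_inverse_real_of_nat]
            by (simp add: divide_inverse del: of_nat_Suc)
          then have l: "(\<lambda>n. ?p y + (s * (t / real (Suc n))) *\<^sub>R ?e) \<longlonglongrightarrow> ?p y + (s * 0) *\<^sub>R ?e"
            by (intro tendsto_intros)
          have "(\<lambda>n. G (?p y + (s * (t / real (Suc n))) *\<^sub>R ?e)) \<longlonglongrightarrow> G (?p y + (s * 0) *\<^sub>R ?e)"
            by (rule continuous_on_tendsto_compose[OF G l])
              (use False in \<open>simp_all only: mem_Collect_eq graph_point_shift, auto\<close>)
          then show ?thesis by (intro tendsto_mult tendsto_const) simp
        qed
      qed
      show "AE t in lborel. norm (G (?p y + (s * (t / real (Suc n))) *\<^sub>R ?e) * step_bump t) \<le> C * step_bump t" for n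
        using Cb step_bump_nonneg by (simp add: abs_mult mult_right_mono)
    qed auto
    then show ?thesis using step_int by simp
  qed
  have "(\<lambda>n. LINT y|M. J n y) \<longlonglongrightarrow> (LINT y|M. G (?p y))"
  proof (rule integral_dominated_convergence[where w="\<lambda>y. C * indicator ?B y"])
    show "(\<lambda>y. G (?p y)) \<in> borel_measurable M"
      by (rule measurable_compose[OF graph_point_measurable Gm])
    show "J n \<in> borel_measurable M" for n
      unfolding J_def
    proof (rule lborel.borel_measurable_lebesgue_integral)
      have "(\<lambda>p. ?p (fst p) + (s * (snd p / real (Suc n))) *\<^sub>R ?e) \<in> borel_measurable (M \<Otimes>\<^sub>M lborel)"
        by (intro borel_measurable_add borel_measurable_scaleR borel_measurable_const
            measurable_compose[OF measurable_fst graph_point_measurable]) measurable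
      then have [measurable]: "(\<lambda>p. G (?p (fst p) + (s * (snd p / real (Suc n))) *\<^sub>R ?e)) \<in> borel_measurable (M \<Otimes>\<^sub>M lborel)"
        by (rule measurable_compose[OF _ Gm])
      show "(\<lambda>(y, t). G (?p y + (s * (t / real (Suc n))) *\<^sub>R ?e) * step_bump t) \<in> borel_measurable (M \<Otimes>\<^sub>M lborel)"
        unfolding case_prod_beta by measurable
    qed
    have B: "?B \<in> sets M" by (rule sets_PiM_I_finite) auto
    then show "integrable M (\<lambda>y. C * indicator ?B y)"
      using bounded_box_measure[of R] by (intro integrable_mult_right integrable_real_indicator) auto
    show "AE y in M. (\<lambda>n. J n y) \<longlonglongrightarrow> G (?p y)" using J_lim by simp
    show "AE y in M. norm (J n y) \<le> C * indicator ?B y" for n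
    proof (rule AE_I2)
      fix y assume y: "y \<in> space M"
      show "norm (J n y) \<le> C * indicator ?B y"
      proof (cases "y \<in> ?B")
        case True
        have [measurable]: "(\<lambda>t. G (?p y + (s * (t / real (Suc n))) *\<^sub>R ?e)) \<in> borel_measurable lborel"
          by (rule measurable_compose[OF _ Gm]) measurable
        have "integrable lborel (\<lambda>t. G (?p y + (s * (t / real (Suc n))) *\<^sub>R ?e) * step_bump t)"
          by (rule Bochner_Integration.integrable_bound[of lborel "\<lambda>t. C * step_bump t"])
            (use step_int Cb step_bump_nonneg C(2) in \<open>auto simp: abs_mult mult_right_mono\<close>)
        then have "(LINT t|lborel. norm (G (?p y + (s * (t / real (Suc n))) *\<^sub>R ?e) * step_bump t))
            \<le> (LINT t|lborel. C * step_bump t)"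
          by (intro integral_mono integrable_norm)
            (use step_int Cb step_bump_nonneg in \<open>auto simp: abs_mult mult_right_mono\<close>)
        then have "norm (J n y) \<le> (LINT t|lborel. C * step_bump t)"
          unfolding J_def by (rule order_trans[OF integral_norm_bound])
        then show ?thesis using step_int True by simp
      next
        case False
        have "G (?p y + (s * (t / real (Suc n))) *\<^sub>R ?e) = 0" for t
          by (rule K(2)[OF graph_point_outside[OF R y False]])
        then show ?thesis using False by (simp add: J_def)
      qed
    qed
  qed
  then show ?thesis by (simp only: eq)
qed

text \<open>Division by \<open>norm (F' x)\<close> cancels the area density, and the restriction to
  the ball is harmless because \<open>G\<close> is supported in \<open>K\<close>.\<close>

lemma step_bump_concentrates_graph_measure:
  fixes G :: "real^'n \<Rightarrow> real"
  assumes G: "continuous_on {x. F x \<ge> 0} G" and K: "compact K" "K \<subseteq> ball c r" "\<And>x. x \<notin> K \<Longrightarrow> G x = 0"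
    and neg: "\<And>x. F x < 0 \<Longrightarrow> G x = 0"
  shows "(\<lambda>n. LINT x|lborel. G x * (real (Suc n) * step_bump (real (Suc n) * F x)))
    \<longlonglongrightarrow> (LINT x|graph_measure c r k \<gamma>. G x / norm (F' x))"
proof -
  have closed: "closed {x. F x \<ge> 0}"
    using continuous_closed_preimage[OF F_cont(1)[of UNIV] closed_UNIV, of "{0..}"] by (simp add: vimage_def)
  have "(\<lambda>x. indicator {x. F x \<ge> 0} x *\<^sub>R G x) = G"
    using neg by (force simp: indicator_def fun_eq_iff)
  then have Gm [measurable]: "G \<in> borel_measurable borel"
    using borel_measurable_continuous_on_indicator[OF _ G] closed by (metis borel_closed)
  have "(LINT x|graph_measure c r k \<gamma>. G x / norm (F' x)) = (LINT y|M. G (graph_point k \<gamma> y))"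
    by (subst integral_graph_measure, measurable, intro Bochner_Integration.integral_cong refl)
      (use K norm_F'_pos in \<open>auto simp: indicator_def simp del: mem_ball\<close>)
  then show ?thesis using step_bump_concentrates[OF G K(1) K(3) neg] by simp
qed

end

subsection \<open>Graph patches of a domain\<close>

lemma set_integrable_continuous_closure:
  fixes g :: "real^'n \<Rightarrow> real"
  assumes "open \<Omega>" "bounded \<Omega>" "continuous_on (closure \<Omega>) g"
  shows "set_integrable lborel \<Omega> g"
proof -
  have "set_integrable lborel (closure \<Omega>) g"
    unfolding set_integrable_def
    by (rule borel_integrable_compact) (use assms in \<open>auto simp: compact_closure\<close>)
  then show ?thesis
    by (rule set_integrable_subset) (use assms closure_subset in auto)
qed

text \<open>The defining function increases into the domain, hence the sign. The formula also makes
  sense off the boundary, so it extends the normal field to the whole space.\<close>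

definition graph_normal :: "'n \<Rightarrow> real \<Rightarrow> (real^'n \<Rightarrow> real) \<Rightarrow> real^'n \<Rightarrow> real^'n" where
  "graph_normal k s \<gamma> x = - (1 / norm (graph_grad k s \<gamma> x)) *\<^sub>R graph_grad k s \<gamma> x"

locale domain_patch =
  fixes \<Omega> :: "(real^'n::finite) set" and c :: "real^'n" and r :: real and k :: 'n and s :: real
    and \<gamma> :: "real^'n \<Rightarrow> real"
  assumes patch: "graph_patch \<Omega> c r k s \<gamma>" and open_domain: "open \<Omega>" and bounded_domain: "bounded \<Omega>"
begin

sublocale graph_function k s \<gamma>
  using patch unfolding graph_patch_def by unfold_locales blast+

abbreviation N where "N \<equiv> graph_normal k s \<gamma>"
abbreviation \<mu> where "\<mu> \<equiv> graph_measure c r k \<gamma>"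

lemma in_domain_iff: "x \<in> ball c r \<Longrightarrow> x \<in> \<Omega> \<longleftrightarrow> F x > 0"
  using patch unfolding graph_patch_def graph_level_def by blast

text \<open>A point with \<open>F x \<ge> 0\<close> is approached from inside by steps along
  \<open>axis k 1\<close>, which raise \<open>F\<close>; the part of the ball with
  \<open>F x < 0\<close> is open and misses \<open>\<Omega>\<close>.\<close>

lemma in_closure_iff:
  assumes x: "x \<in> ball c r"
  shows "x \<in> closure \<Omega> \<longleftrightarrow> F x \<ge> 0"
proof
  assume "x \<in> closure \<Omega>"
  show "F x \<ge> 0"
  proof (rule ccontr)
    assume "\<not> F x \<ge> 0"
    have "open (ball c r \<inter> {x. F x < 0})"
      using F_cont(1)[of UNIV] by (intro open_Int open_Collect_less) auto
    moreover have "x \<in> ball c r \<inter> {x. F x < 0}" using x \<open>\<not> F x \<ge> 0\<close> by simp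
    ultimately obtain y where "y \<in> \<Omega>" "y \<in> ball c r \<inter> {x. F x < 0}"
      using \<open>x \<in> closure \<Omega>\<close> open_Int_closure_eq_empty by blast
    then show False using in_domain_iff[of y] by auto
  qed
next
  assume *: "F x \<ge> 0"
  define q where "q n = x + (s * (1 / real (Suc n))) *\<^sub>R axis k 1" for n
  have "(\<lambda>n. 1 / real (Suc n)) \<longlonglongrightarrow> 0"
    using LIMSEQ_inverse_real_of_nat by (simp add: inverse_eq_divide)
  then have "q \<longlonglongrightarrow> x + (s * 0) *\<^sub>R axis k 1"
    unfolding q_def by (intro tendsto_intros)
  then have l: "q \<longlonglongrightarrow> x" by simp
  then have "\<forall>\<^sub>F n in sequentially. q n \<in> ball c r"
    using x open_ball topological_tendstoD by blast
  moreover have "F (q n) > 0" for n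
  proof -
    have "F (q n) = F x + 1 / real (Suc n)" using ss by (simp add: q_def F_shift flip: mult.assoc)
    moreover have "1 / real (Suc n) > 0" by simp
    ultimately show ?thesis using * by linarith
  qed
  ultimately have "\<forall>\<^sub>F n in sequentially. q n \<in> closure \<Omega>"
    using in_domain_iff closure_subset by (auto elim!: eventually_mono)
  then show "x \<in> closure \<Omega>"
    using Lim_in_closed_set[OF closed_closure _ sequentially_bot l] by blast
qed

lemma in_frontier_iff: "x \<in> ball c r \<Longrightarrow> x \<in> frontier \<Omega> \<longleftrightarrow> F x = 0"
  using in_closure_iff[of x] in_domain_iff[of x] open_domain by (auto simp: frontier_def interior_open)

lemma N_simps: "norm (N x) = 1" "N x \<bullet> N x = 1" "F' x \<bullet> N x = - norm (F' x)"
    "F' x \<bullet> e / norm (F' x) = - (N x \<bullet> e)"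
proof -
  show n: "norm (N x) = 1" using norm_F'_pos[of x] by (simp add: graph_normal_def)
  show "N x \<bullet> N x = 1" using n by (simp add: dot_square_norm)
  show "F' x \<bullet> N x = - norm (F' x)"
    using norm_F'_pos[of x] by (simp add: graph_normal_def dot_square_norm power2_eq_square)
  show "F' x \<bullet> e / norm (F' x) = - (N x \<bullet> e)" by (simp add: graph_normal_def)
qed

lemma N_continuous: "continuous_on S N"
  unfolding graph_normal_def using norm_F'_pos by (intro continuous_intros F_cont) auto

lemma F_line_derivative: "((\<lambda>t. F (p + t *\<^sub>R v)) has_real_derivative F' p \<bullet> v) (at 0)"
proof -
  have a: "((\<lambda>t. p + t *\<^sub>R v) has_derivative (\<lambda>t. t *\<^sub>R v)) (at (0::real))"
    by (auto intro!: derivative_eq_intros)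
  have b: "(F has_derivative (\<lambda>v. F' p \<bullet> v)) (at (p + (0::real) *\<^sub>R v))"
    using C1_with_gradD(3)[OF C1_F] by simp
  from has_derivative_compose[OF a b] show ?thesis
    by (simp add: has_field_derivative_def mult.commute[of _ "F' p \<bullet> v"])
qed

lemma line_in_ball:
  assumes "p \<in> ball c r"
  shows "\<forall>\<^sub>F t in at_right 0. p + t *\<^sub>R v \<in> ball c r"
proof -
  have "((\<lambda>t. p + t *\<^sub>R v) \<longlongrightarrow> p + 0 *\<^sub>R v) (at_right 0)"
    by (intro tendsto_intros)
  then show ?thesis
    using topological_tendstoD[of _ p "at_right 0" "ball c r"] assms by simp
qed

text \<open>That \<open>N p\<close> qualifies follows by differentiating \<open>F\<close> along
  curves in the boundary and along the normal line. Uniqueness needs enough curves: lifts of lines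
  to the graph give the whole tangent space, which leaves only multiples of \<open>F' p\<close>;
  unit length leaves two, and the inward one is excluded since its ray enters the closure.\<close>

lemma outer_normal_eq:
  assumes p: "p \<in> frontier \<Omega>" "p \<in> ball c r"
  shows "outer_normal \<Omega> p = N p"
  unfolding outer_normal_def
proof (rule the_equality)
  have Fp: "F p = 0" using in_frontier_iff p by simp
  let ?P = "\<lambda>v. norm v = 1 \<and> (\<forall>g d. (\<forall>t. g t \<in> frontier \<Omega>) \<and> g 0 = p \<and>
      (g has_vector_derivative d) (at (0::real)) \<longrightarrow> v \<bullet> d = 0) \<and>
      (\<forall>\<^sub>F t in at_right 0. p + t *\<^sub>R v \<notin> closure \<Omega>)"
  show "?P (N p)"
  proof (intro conjI allI impI)
    show "norm (N p) = 1" by (rule N_simps)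
    fix g :: "real \<Rightarrow> real^'n" and d
    assume g: "(\<forall>t. g t \<in> frontier \<Omega>) \<and> g 0 = p \<and> (g has_vector_derivative d) (at 0)"
    then have gd: "(g has_derivative (\<lambda>t. t *\<^sub>R d)) (at 0)"
      by (simp add: has_vector_derivative_def)
    have "g \<midarrow>0\<rightarrow> g 0"
      using has_derivative_continuous[OF gd] by (simp add: isCont_def)
    then have "\<forall>\<^sub>F t in at 0. g t \<in> ball c r"
      using topological_tendstoD[of g "g 0" "at 0" "ball c r"] g p by simp
    then have ev: "\<forall>\<^sub>F t in at 0. (0::real) = F (g t)"
      by eventually_elim (use g in_frontier_iff in auto)
    have "(F has_derivative (\<lambda>v. F' p \<bullet> v)) (at (g 0))"
      using C1_with_gradD(3)[OF C1_F, of p] g by simp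
    from has_derivative_compose[OF gd this]
    have "((\<lambda>t. F (g t)) has_derivative (\<lambda>t. F' p \<bullet> (t *\<^sub>R d))) (at 0)" .
    moreover have "((\<lambda>t. F (g t)) has_derivative (\<lambda>t. 0)) (at 0)"
    proof (rule has_derivative_transform_eventually[OF has_derivative_const])
      show "\<forall>\<^sub>F t in at 0 within UNIV. 0 = F (g t)" using ev by simp
      show "0 = F (g 0)" using g Fp by simp
    qed simp
    ultimately have "(\<lambda>t. F' p \<bullet> (t *\<^sub>R d)) = (\<lambda>t. 0)"
      using has_derivative_unique by blast
    from fun_cong[OF this, of 1] show "N p \<bullet> d = 0" by (simp add: graph_normal_def)
  next
    have "F' p \<bullet> N p < 0" using N_simps(3)[of p] norm_F'_pos(1)[of p] by linarith
    from DERIV_neg_dec_right[OF F_line_derivative this]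
    obtain \<delta> where "\<delta> > 0" "\<forall>t>0. t < \<delta> \<longrightarrow> F (p + (0 + t) *\<^sub>R N p) < F (p + 0 *\<^sub>R N p)"
      by blast
    then have "\<delta> > 0" "\<forall>t>0. t < \<delta> \<longrightarrow> F (p + t *\<^sub>R N p) < 0"
      using Fp by simp_all
    then have "\<forall>\<^sub>F t in at_right 0. F (p + t *\<^sub>R N p) < 0"
      unfolding eventually_at_right_field by blast
    then show "\<forall>\<^sub>F t in at_right 0. p + t *\<^sub>R N p \<notin> closure \<Omega>"
      using line_in_ball[OF p(2), of "N p"] by eventually_elim (use in_closure_iff in force)
  qed
  fix v assume P: "?P v"
  let ?e = "axis k 1 :: real^'n" and ?g = "grad UNIV \<gamma> p"
  \<comment> \<open>The vector is the velocity of the line \<open>p + t w\<close> lifted to the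
    graph of \<open>\<gamma>\<close>.\<close>
  have tangent: "v \<bullet> (w + (?g \<bullet> w) *\<^sub>R ?e) = 0" if w: "w $ k = 0" for w
  proof -
    define q where "q t = p + t *\<^sub>R w + (\<gamma> (p + t *\<^sub>R w) - \<gamma> p) *\<^sub>R ?e" for t :: real
    have a: "((\<lambda>t. p + t *\<^sub>R w) has_derivative (\<lambda>t. t *\<^sub>R w)) (at (0::real))"
      by (auto intro!: derivative_eq_intros)
    have b: "(\<gamma> has_derivative (\<lambda>v. ?g \<bullet> v)) (at (p + (0::real) *\<^sub>R w))"
      using C1_with_gradD(3)[OF C1_\<gamma>] by simp
    have "(q has_derivative (\<lambda>t. t *\<^sub>R w + (?g \<bullet> (t *\<^sub>R w)) *\<^sub>R ?e)) (at 0)"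
      unfolding q_def
      by (rule derivative_eq_intros has_derivative_compose[OF a b] a refl | simp)+
    then have qd: "(q has_vector_derivative (w + (?g \<bullet> w) *\<^sub>R ?e)) (at 0)"
      by (simp add: has_vector_derivative_def scaleR_add_right)
    have q0: "q 0 = p" by (simp add: q_def)
    have Fq: "F (q t) = 0" for t
      using Fp w s unfolding q_def by (auto simp: F_shift) (auto simp: graph_level_def)
    \<comment> \<open>Curves in \<open>outer_normal\<close> must stay in the frontier for all
      parameters; the lift is known to do so only inside the ball and is replaced by
      \<open>p\<close> elsewhere.\<close>
    define g where "g t = (if q t \<in> ball c r then q t else p)" for t
    have "isCont q 0" using qd by (rule has_vector_derivative_continuous)
    then have "\<forall>\<^sub>F t in at 0. q t \<in> ball c r"
      using topological_tendstoD[of q "q 0" "at 0" "ball c r"] p(2) q0 by (simp add: isCont_def)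
    then have "\<forall>\<^sub>F t in at 0. q t = g t"
      by eventually_elim (simp add: g_def)
    then have "(g has_vector_derivative (w + (?g \<bullet> w) *\<^sub>R ?e)) (at 0)"
      unfolding has_vector_derivative_def
      by (intro has_derivative_transform_eventually[OF qd[unfolded has_vector_derivative_def]])
        (use p q0 in \<open>auto simp: g_def\<close>)
    moreover have "g t \<in> frontier \<Omega>" for t
      using in_frontier_iff[of "q t"] Fq p by (auto simp: g_def)
    moreover have "g 0 = p" using q0 by (simp add: g_def)
    ultimately show ?thesis using P by blast
  qed
  \<comment> \<open>Chosen so that \<open>w \<bullet> w\<close> is the product of \<open>v\<close>
    with the tangent vector generated by \<open>w\<close>. That product is zero, and
    \<open>w = 0\<close> says that \<open>v\<close> is a multiple of \<open>?e - ?g\<close>.\<close>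
  define w where "w = v - (v $ k) *\<^sub>R ?e + (v $ k) *\<^sub>R ?g"
  have wk: "w $ k = 0" "?e \<bullet> w = 0" using grad_\<gamma>_k[of p] by (auto simp: w_def inner_axis')
  have "w \<bullet> w = v \<bullet> w + (v $ k) * (?g \<bullet> w)"
    using wk(2) by (simp add: w_def inner_add_left inner_diff_left)
  also have "\<dots> = v \<bullet> (w + (?g \<bullet> w) *\<^sub>R ?e)"
    by (simp add: inner_add_right inner_axis algebra_simps)
  finally have "w = 0" using tangent[OF wk(1)] by simp
  then have "v = (v $ k) *\<^sub>R (?e - ?g)" by (simp add: w_def algebra_simps eq_diff_eq)
  also have "\<dots> = (v $ k * s) *\<^sub>R F' p" using ss by (simp add: graph_grad_def mult.assoc)
  finally have vF: "v = (v $ k * s) *\<^sub>R F' p" .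
  define a where "a = v $ k * s * norm (F' p)"
  have va: "v = - a *\<^sub>R N p"
    using vF norm_F'_pos[of p] by (simp add: a_def graph_normal_def)
  have "\<bar>a\<bar> = 1" using P N_simps(1)[of p] va by (metis abs_minus_cancel mult.right_neutral norm_scaleR)
  moreover have "a \<noteq> 1"
  proof
    assume "a = 1"
    then have v: "v = - N p" using va by simp
    have "F' p \<bullet> v > 0" using N_simps(3)[of p] norm_F'_pos[of p] v by simp
    from DERIV_pos_inc_right[OF F_line_derivative this]
    obtain \<delta> where "\<delta> > 0" "\<forall>t>0. t < \<delta> \<longrightarrow> F (p + 0 *\<^sub>R v) < F (p + (0 + t) *\<^sub>R v)"
      by blast
    then have "\<delta> > 0" "\<forall>t>0. t < \<delta> \<longrightarrow> F (p + t *\<^sub>R v) > 0"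
      using Fp by simp_all
    then have "\<forall>\<^sub>F t in at_right 0. F (p + t *\<^sub>R v) > 0"
      unfolding eventually_at_right_field by blast
    then have "\<forall>\<^sub>F t in at_right 0. p + t *\<^sub>R v \<in> closure \<Omega>"
      using line_in_ball[OF p(2), of v] by eventually_elim (use in_closure_iff in force)
    moreover have "\<forall>\<^sub>F t in at_right 0. p + t *\<^sub>R v \<notin> closure \<Omega>" using P by blast
    ultimately have "\<forall>\<^sub>F t in at_right (0::real). False" by eventually_elim simp
    then show False by (simp add: trivial_limit_at_right_real)
  qed
  ultimately have "a = - 1" by linarith
  then show "v = N p" using va by simp
qed

text \<open>\<open>\<theta>\<close> switched off in the layer where \<open>F\<close> is at most
  \<open>1 / Suc n\<close>. In \<open>cut_grad\<close> the large term along \<open>F'\<close>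
  concentrates on the graph as \<open>n\<close> grows.\<close>

definition cut where
  "cut \<theta> n x = (if x \<in> \<Omega> \<inter> ball c r then \<theta> x * smooth_step (real (Suc n) * F x) else 0)"

definition cut_grad where
  "cut_grad \<theta> \<Theta> n x = (if x \<in> \<Omega> \<inter> ball c r then
     \<theta> x *\<^sub>R ((real (Suc n) * step_bump (real (Suc n) * F x)) *\<^sub>R F' x)
       + smooth_step (real (Suc n) * F x) *\<^sub>R \<Theta> x else 0)"

lemma
  assumes \<theta>: "C1_with_grad UNIV \<theta> \<Theta>" and K: "compact K" "K \<subseteq> ball c r" "\<And>x. x \<notin> K \<Longrightarrow> \<theta> x = 0"
  shows C1_cut: "C1_with_grad UNIV (cut \<theta> n) (cut_grad \<theta> \<Theta> n)"
    and cut_support: "\<exists>L. compact L \<and> L \<subseteq> \<Omega> \<and> (\<forall>x. x \<notin> L \<longrightarrow> cut \<theta> n x = 0)"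
proof -
  let ?m = "real (Suc n)"
  \<comment> \<open>The step vanishes up to \<open>1\<close>, so this set at positive height
    contains the support and lies inside \<open>\<Omega>\<close>.\<close>
  let ?L = "K \<inter> {x. ?m * F x \<ge> 1}"
  have "closed {x. ?m * F x \<ge> 1}"
    using F_cont(1)[of UNIV] by (intro closed_Collect_le continuous_intros) auto
  then have L: "compact ?L" using K(1) by blast
  have pos: "F x > 0" if "x \<in> ?L" for x
  proof -
    have "?m * F x > 0" using that by auto
    then show ?thesis by (simp add: zero_less_mult_iff del: of_nat_Suc)
  qed
  have LW: "?L \<subseteq> \<Omega> \<inter> ball c r" using pos K(2) in_domain_iff by blast
  have z: "\<theta> x * smooth_step (?m * F x) = 0" if "x \<notin> ?L" for x
    using that K(3)[of x] smooth_step_simps(1)[of "?m * F x"] by auto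
  then have "cut \<theta> n x = 0" if "x \<notin> ?L" for x using that by (simp add: cut_def)
  then show "\<exists>L. compact L \<and> L \<subseteq> \<Omega> \<and> (\<forall>x. x \<notin> L \<longrightarrow> cut \<theta> n x = 0)"
    using L LW by blast
  have "C1_with_grad UNIV (\<lambda>x. smooth_step (?m * F x)) (\<lambda>x. step_bump (?m * F x) *\<^sub>R (?m *\<^sub>R F' x))"
    by (rule C1_with_grad_compose[OF C1_with_grad_cmult[OF C1_F] DERIV_smooth_step])
      (auto intro: continuous_on_step_bump continuous_at_imp_continuous_on DERIV_isCont[OF DERIV_smooth_step])
  from C1_with_grad_mult[OF \<theta> this]
  have m: "C1_with_grad UNIV (\<lambda>x. \<theta> x * smooth_step (?m * F x))
      (\<lambda>x. \<theta> x *\<^sub>R ((?m * step_bump (?m * F x)) *\<^sub>R F' x) + smooth_step (?m * F x) *\<^sub>R \<Theta> x)"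
    by (simp add: mult.commute del: of_nat_Suc)
  have cut_eq: "cut \<theta> n = (\<lambda>x. if x \<in> \<Omega> \<inter> ball c r then \<theta> x * smooth_step (?m * F x) else 0)"
    by (simp add: cut_def fun_eq_iff)
  have grad_eq: "cut_grad \<theta> \<Theta> n = (\<lambda>x. if x \<in> \<Omega> \<inter> ball c r then
      \<theta> x *\<^sub>R ((?m * step_bump (?m * F x)) *\<^sub>R F' x) + smooth_step (?m * F x) *\<^sub>R \<Theta> x else 0)"
    by (simp add: cut_grad_def fun_eq_iff)
  show "C1_with_grad UNIV (cut \<theta> n) (cut_grad \<theta> \<Theta> n)"
    unfolding cut_eq grad_eq
    by (rule C1_with_grad_zero_extension[OF _ compact_imp_closed[OF L] LW])
      (use open_domain C1_with_gradD(3)[OF m] C1_with_grad_UNIV_continuous(2)[OF m] z in auto)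
qed

lemma cut_bounds:
  assumes "\<And>x. \<theta> x \<ge> 0"
  shows "0 \<le> cut \<theta> n x" "cut \<theta> n x \<le> \<theta> x"
  using assms smooth_step_bounds[of "real (Suc n) * F x"]
  by (auto simp: cut_def mult_left_le simp del: of_nat_Suc)

lemma smooth_step_F_tendsto:
  assumes "F x > 0"
  shows "(\<lambda>n. smooth_step (real (Suc n) * F x)) \<longlonglongrightarrow> 1"
proof -
  obtain n0 :: nat where n0: "2 / F x < real n0" using reals_Archimedean2 by blast
  have "smooth_step (real (Suc n) * F x) = 1" if "n \<ge> n0" for n
  proof -
    have "2 / F x \<le> real (Suc n)" using n0 that by linarith
    then show ?thesis
      using assms by (intro smooth_step_simps(2)) (simp add: pos_divide_le_eq del: of_nat_Suc)
  qed
  then have "\<forall>\<^sub>F n in sequentially. smooth_step (real (Suc n) * F x) = 1"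
    unfolding eventually_sequentially by blast
  then show ?thesis by (rule tendsto_eventually)
qed

lemma cut_tendsto:
  assumes "x \<in> \<Omega>" "\<And>x. x \<notin> ball c r \<Longrightarrow> \<theta> x = 0"
  shows "(\<lambda>n. cut \<theta> n x) \<longlonglongrightarrow> \<theta> x"
proof (cases "x \<in> ball c r")
  case True
  then have "F x > 0" using assms in_domain_iff by blast
  from tendsto_mult[OF tendsto_const[of "\<theta> x"] smooth_step_F_tendsto[OF this]]
  show ?thesis using True assms(1) by (simp add: cut_def del: of_nat_Suc)
next
  case False
  then show ?thesis using assms(2)[OF False] by (simp add: cut_def)
qed

text \<open>The product rule splits the gradient into a term that converges to
  \<open>\<Theta>\<close> under a bound and a layer term that concentrates on the graph. The latter
  carries \<open>F' / norm F' = - N\<close>, whence the minus sign.\<close>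

lemma cut_grad_integral_tendsto:
  assumes \<theta>: "C1_with_grad UNIV \<theta> \<Theta>" and K: "compact K" "K \<subseteq> ball c r" "\<And>x. x \<notin> K \<Longrightarrow> \<theta> x = 0"
    and G: "continuous_on (closure \<Omega>) G"
  shows "(\<lambda>n. LINT x:\<Omega>|lborel. G x * (cut_grad \<theta> \<Theta> n x \<bullet> e))
    \<longlonglongrightarrow> (LINT x:\<Omega>|lborel. G x * (\<Theta> x \<bullet> e)) - (LINT x:frontier \<Omega>|\<mu>. G x * \<theta> x * (N x \<bullet> e))"
proof -
  let ?c = "\<lambda>n x. real (Suc n) * step_bump (real (Suc n) * F x)"
  have \<Theta>0: "\<Theta> x = 0" if "x \<notin> K" for x
    using C1_with_grad_UNIV_eq_0[OF \<theta> compact_imp_closed[OF K(1)] that K(3)] by simp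
  \<comment> \<open>\<open>G\<close> is controlled only on \<open>closure \<Omega>\<close>, which
    inside \<open>K\<close> is the set \<open>F x \<ge> 0\<close>. Extension by zero makes the
    function continuous on all of that side of the graph, as the concentration lemma
    demands.\<close>
  define G0 where "G0 x = (if x \<in> K \<and> F x \<ge> 0 then G x * \<theta> x * (F' x \<bullet> e) else 0)" for x
  define A where "A n x = indicator \<Omega> x *\<^sub>R (G x * smooth_step (real (Suc n) * F x) * (\<Theta> x \<bullet> e))" for n x
  have ptw: "indicator \<Omega> x *\<^sub>R (G x * (cut_grad \<theta> \<Theta> n x \<bullet> e)) = A n x + G0 x * ?c n x" for n x
  proof (cases "x \<in> K")
    case True
    then have b: "x \<in> ball c r" using K(2) by blast
    show ?thesis
    proof (cases "x \<in> \<Omega>")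
      case True
      then show ?thesis using b in_domain_iff[OF b] \<open>x \<in> K\<close>
        by (simp add: cut_grad_def A_def G0_def algebra_simps inner_add_left del: of_nat_Suc)
    next
      case False
      then have "F x \<le> 0" using in_domain_iff[OF b] by simp
      then have "F x \<ge> 0 \<Longrightarrow> F x = 0" by simp
      then show ?thesis using False by (auto simp: A_def G0_def step_bump_eq_0)
    qed
  next
    case False
    then show ?thesis using \<Theta>0[OF False] K(3)[OF False]
      by (simp add: cut_grad_def A_def G0_def)
  qed
  have Gi: "integrable lborel (\<lambda>x. indicator \<Omega> x *\<^sub>R (G x * (cut_grad \<theta> \<Theta> n x \<bullet> e)))" for n
  proof -
    have "C1_with_grad UNIV (cut \<theta> n) (cut_grad \<theta> \<Theta> n)"
      by (rule C1_cut[OF \<theta> K])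
    then have "continuous_on (closure \<Omega>) (\<lambda>x. G x * (cut_grad \<theta> \<Theta> n x \<bullet> e))"
      by (intro continuous_intros G C1_with_grad_UNIV_continuous(2))
    from set_integrable_continuous_closure[OF open_domain bounded_domain this]
    show ?thesis by (simp add: set_integrable_def)
  qed
  have ss_cont: "continuous_on S (\<lambda>x. smooth_step (real (Suc n) * F x))" for S n
    by (rule continuous_on_compose2[OF continuous_at_imp_continuous_on[of UNIV smooth_step]])
      (auto intro!: continuous_intros F_cont DERIV_isCont[OF DERIV_smooth_step])
  have Ai: "integrable lborel (A n)" for n
  proof -
    have "continuous_on (closure \<Omega>) (\<lambda>x. G x * smooth_step (real (Suc n) * F x) * (\<Theta> x \<bullet> e))"
      by (intro continuous_on_mult continuous_on_inner continuous_on_const G ss_cont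
          C1_with_grad_UNIV_continuous(2)[OF \<theta>])
    from set_integrable_continuous_closure[OF open_domain bounded_domain this]
    show ?thesis by (simp only: set_integrable_def A_def[abs_def])
  qed
  have Bi: "integrable lborel (\<lambda>x. G0 x * ?c n x)" for n
  proof -
    have "(\<lambda>x. G0 x * ?c n x) = (\<lambda>x. indicator \<Omega> x *\<^sub>R (G x * (cut_grad \<theta> \<Theta> n x \<bullet> e)) - A n x)"
      using ptw by (auto simp: fun_eq_iff)
    then show ?thesis using Gi Ai by simp
  qed
  have Di: "integrable lborel (\<lambda>x. indicator \<Omega> x *\<^sub>R (G x * (\<Theta> x \<bullet> e)))"
  proof -
    have "continuous_on (closure \<Omega>) (\<lambda>x. G x * (\<Theta> x \<bullet> e))"
      by (intro continuous_intros G C1_with_grad_UNIV_continuous(2)[OF \<theta>])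
    from set_integrable_continuous_closure[OF open_domain bounded_domain this]
    show ?thesis by (simp only: set_integrable_def)
  qed
  have A_lim: "(\<lambda>n. LINT x|lborel. A n x) \<longlonglongrightarrow> (LINT x:\<Omega>|lborel. G x * (\<Theta> x \<bullet> e))"
    unfolding set_lebesgue_integral_def
  proof (rule integral_dominated_convergence[where w="\<lambda>x. norm (indicator \<Omega> x *\<^sub>R (G x * (\<Theta> x \<bullet> e)))"])
    show "integrable lborel (\<lambda>x. norm (indicator \<Omega> x *\<^sub>R (G x * (\<Theta> x \<bullet> e))))"
      using Di by (rule integrable_norm)
    show "(\<lambda>x. indicator \<Omega> x *\<^sub>R (G x * (\<Theta> x \<bullet> e))) \<in> borel_measurable lborel"
      using Di by (rule borel_measurable_integrable)
    show "A n \<in> borel_measurable lborel" for n using Ai by (rule borel_measurable_integrable)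
    show "AE x in lborel. norm (A n x) \<le> norm (indicator \<Omega> x *\<^sub>R (G x * (\<Theta> x \<bullet> e)))" for n
    proof (rule AE_I2)
      fix x
      have "\<bar>smooth_step (real (Suc n) * F x)\<bar> \<le> 1" using smooth_step_bounds[of "real (Suc n) * F x"] by simp
      from mult_right_mono[OF this, of "\<bar>G x * (\<Theta> x \<bullet> e)\<bar>"]
      show "norm (A n x) \<le> norm (indicator \<Omega> x *\<^sub>R (G x * (\<Theta> x \<bullet> e)))"
        by (auto simp: A_def indicator_def abs_mult mult.assoc mult.left_commute simp del: of_nat_Suc)
    qed
    show "AE x in lborel. (\<lambda>n. A n x) \<longlonglongrightarrow> indicator \<Omega> x *\<^sub>R (G x * (\<Theta> x \<bullet> e))"
    proof (rule AE_I2)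
      fix x
      show "(\<lambda>n. A n x) \<longlonglongrightarrow> indicator \<Omega> x *\<^sub>R (G x * (\<Theta> x \<bullet> e))"
      proof (cases "x \<in> \<Omega> \<inter> K")
        case True
        then have "F x > 0" using in_domain_iff K(2) by blast
        then have "(\<lambda>n. indicator \<Omega> x *\<^sub>R (G x * smooth_step (real (Suc n) * F x) * (\<Theta> x \<bullet> e)))
            \<longlonglongrightarrow> indicator \<Omega> x *\<^sub>R (G x * 1 * (\<Theta> x \<bullet> e))"
          by (intro tendsto_intros smooth_step_F_tendsto)
        then show ?thesis by (simp add: A_def)
      next
        case False
        then show ?thesis using \<Theta>0[of x] by (cases "x \<in> \<Omega>") (auto simp: A_def)
      qed
    qed
  qed
  have cl: "closed {x. F x \<ge> 0}"
    using F_cont(1)[of UNIV] by (intro closed_Collect_le) auto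
  have G0c: "continuous_on {x. F x \<ge> 0} G0"
  proof -
    \<comment> \<open>On \<open>?S\<close> the function is the plain product, because
      \<open>\<theta>\<close> vanishes off \<open>K\<close>; on \<open>?T\<close> it is zero. Both
      are relatively open, so continuity may be checked on each.\<close>
    let ?S = "{x. F x \<ge> 0} \<inter> ball c r" and ?T = "{x. F x \<ge> 0} \<inter> - K"
    have un: "?S \<union> ?T = {x. F x \<ge> 0}" using K(2) by blast
    have "continuous_on (?S \<union> ?T) G0"
    proof (rule continuous_on_Un_local_open)
      show "openin (top_of_set (?S \<union> ?T)) ?S" "openin (top_of_set (?S \<union> ?T)) ?T"
        unfolding un using compact_imp_closed[OF K(1)] by (auto intro: openin_open_Int)
      have "continuous_on ?S (\<lambda>x. G x * \<theta> x * (F' x \<bullet> e))"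
        using in_closure_iff C1_with_grad_UNIV_continuous(1)[OF \<theta>]
        by (intro continuous_intros F_cont continuous_on_subset[OF G]) auto
      then show "continuous_on ?S G0"
        by (rule continuous_on_eq) (use K(3) in \<open>auto simp: G0_def\<close>)
      show "continuous_on ?T G0"
        by (rule continuous_on_eq[OF continuous_on_const[of _ 0]]) (auto simp: G0_def)
    qed
    then show ?thesis unfolding un .
  qed
  have B_lim: "(\<lambda>n. LINT x|lborel. G0 x * ?c n x) \<longlonglongrightarrow> (LINT x|\<mu>. G0 x / norm (F' x))"
    by (rule step_bump_concentrates_graph_measure[OF G0c K(1,2)]) (auto simp: G0_def)
  have "(LINT x|\<mu>. G0 x / norm (F' x)) = - (LINT x:frontier \<Omega>|\<mu>. G x * \<theta> x * (N x \<bullet> e))"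
  proof -
    have "(LINT x|\<mu>. G0 x / norm (F' x)) = (LINT x|\<mu>. indicator (frontier \<Omega>) x *\<^sub>R (G x * \<theta> x * - (N x \<bullet> e)))"
    proof (rule integral_cong_AE)
      have "G0 = (\<lambda>x. indicator {x. F x \<ge> 0} x *\<^sub>R G0 x)" by (auto simp: G0_def indicator_def fun_eq_iff)
      also have "\<dots> \<in> borel_measurable borel"
        by (rule borel_measurable_continuous_on_indicator[OF borel_closed[OF cl] G0c])
      finally have "G0 \<in> borel_measurable borel" .
      then show "(\<lambda>x. G0 x / norm (F' x)) \<in> borel_measurable \<mu>"
        by measurable
      have "(\<lambda>x. indicator (frontier \<Omega>) x *\<^sub>R (G x * \<theta> x * - (N x \<bullet> e))) \<in> borel_measurable borel"
        using C1_with_grad_UNIV_continuous(1)[OF \<theta>]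
        by (intro borel_measurable_continuous_on_indicator continuous_intros N_continuous
            continuous_on_subset[OF G]) (auto simp: frontier_def)
      then show "(\<lambda>x. indicator (frontier \<Omega>) x *\<^sub>R (G x * \<theta> x * - (N x \<bullet> e))) \<in> borel_measurable \<mu>"
        by measurable
      show "AE x in \<mu>. G0 x / norm (F' x) = indicator (frontier \<Omega>) x *\<^sub>R (G x * \<theta> x * - (N x \<bullet> e))"
        using AE_graph_measure
      proof eventually_elim
        case (elim x)
        show ?case
        proof (cases "x \<in> K")
          case True
          then have "x \<in> frontier \<Omega>" using in_frontier_iff elim K(2) by blast
          then show ?thesis using True elim N_simps(4)[of x e] by (simp add: G0_def flip: times_divide_eq_right)
        next
          case False
          then show ?thesis using K(3)[OF False] by (simp add: G0_def)
        qed
      qed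
    qed
    then show ?thesis by (simp add: set_lebesgue_integral_def)
  qed
  then have "(\<lambda>n. (LINT x|lborel. A n x) + (LINT x|lborel. G0 x * ?c n x))
      \<longlonglongrightarrow> (LINT x:\<Omega>|lborel. G x * (\<Theta> x \<bullet> e)) - (LINT x:frontier \<Omega>|\<mu>. G x * \<theta> x * (N x \<bullet> e))"
    using tendsto_add[OF A_lim B_lim] by simp
  moreover have "(LINT x:\<Omega>|lborel. G x * (cut_grad \<theta> \<Theta> n x \<bullet> e))
      = (LINT x|lborel. A n x) + (LINT x|lborel. G0 x * ?c n x)" for n
    unfolding set_lebesgue_integral_def ptw using Ai Bi by (rule Bochner_Integration.integral_add)
  ultimately show ?thesis by simp
qed

text \<open>Each \<open>cut \<theta> n\<close> has compact support in \<open>\<Omega>\<close>, so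
  its gradient integrates to zero; the limit with \<open>G = 1\<close> balances the volume term
  against the boundary term.\<close>

lemma local_divergence:
  assumes \<theta>: "C1_with_grad UNIV \<theta> \<Theta>" and K: "compact K" "K \<subseteq> ball c r" "\<And>x. x \<notin> K \<Longrightarrow> \<theta> x = 0"
  shows "(LINT x:\<Omega>|lborel. \<Theta> x \<bullet> e) = (LINT x:frontier \<Omega>|\<mu>. \<theta> x * (N x \<bullet> e))"
proof -
  have "(LINT x:\<Omega>|lborel. 1 * (cut_grad \<theta> \<Theta> n x \<bullet> e)) = 0" for n
  proof -
    obtain L where L: "compact L" "L \<subseteq> \<Omega>" "\<And>x. x \<notin> L \<Longrightarrow> cut \<theta> n x = 0"
      using cut_support[OF \<theta> K] by blast
    have "C1_with_grad UNIV (cut \<theta> n) (cut_grad \<theta> \<Theta> n)"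
      by (rule C1_cut[OF \<theta> K])
    then have "(LINT x:\<Omega>|lborel. (cut \<theta> n x *\<^sub>R 0 + 1 *\<^sub>R cut_grad \<theta> \<Theta> n x) \<bullet> e) = 0"
      by (rule set_integral_gradient_cutoff[OF open_domain _ L C1_with_grad_const])
    then show ?thesis by simp
  qed
  then have "(\<lambda>n. 0) \<longlonglongrightarrow> (LINT x:\<Omega>|lborel. 1 * (\<Theta> x \<bullet> e)) - (LINT x:frontier \<Omega>|\<mu>. 1 * \<theta> x * (N x \<bullet> e))"
    using cut_grad_integral_tendsto[OF \<theta> K continuous_on_const, of 1 e] by simp
  then show ?thesis by (simp add: LIMSEQ_const_iff)
qed

end

subsection \<open>The surface measure\<close>

lemma set_integrable_continuous_finite_measure:
  fixes g :: "real^'n \<Rightarrow> real"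
  assumes "sets M = sets borel" "emeasure M UNIV < \<infinity>" "compact S" "continuous_on S g"
  shows "set_integrable M S g"
proof -
  have "bounded (g ` S)" using assms by (intro compact_imp_bounded compact_continuous_image)
  then obtain C where C: "\<And>x. x \<in> S \<Longrightarrow> \<bar>g x\<bar> \<le> C" unfolding bounded_iff by auto
  have sp: "space M = UNIV" using sets_eq_imp_space_eq[OF assms(1)] by simp
  interpret finite_measure M using assms(2) sp by (intro finite_measureI) auto
  have "(\<lambda>x. indicator S x *\<^sub>R g x) \<in> borel_measurable borel"
    by (rule borel_measurable_continuous_on_indicator) (use assms in \<open>auto intro: borel_compact\<close>)
  then have m: "(\<lambda>x. indicator S x *\<^sub>R g x) \<in> borel_measurable M"
    by (simp add: measurable_cong_sets[OF assms(1) refl])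
  show ?thesis
    unfolding set_integrable_def
    by (rule integrable_const_bound[OF _ m, of "\<bar>C\<bar>"]) (use C in \<open>force simp: indicator_def\<close>)
qed

lemma emeasure_density_indicator:
  assumes "sets M = sets borel" "A \<in> sets borel" "X \<in> sets borel"
  shows "emeasure (density M (indicator A)) X = emeasure M (X \<inter> A)"
proof -
  have "(indicator A :: _ \<Rightarrow> ennreal) \<in> borel_measurable M"
    using assms by (intro borel_measurable_indicator) simp
  from emeasure_density[OF this, of X] show ?thesis
    using assms by (simp add: indicator_inter_arith[symmetric] Int_commute)
qed

text \<open>Cutoffs for a compact exhaustion of \<open>U\<close>. They transfer equality of
  integrals of \<open>C^1\<close> functions to measures of open sets.\<close>

lemma indicator_open_C1_limit:
  fixes U :: "(real^'n) set"
  assumes "open U"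
  obtains \<theta> \<Theta> K where "\<And>n. C1_with_grad UNIV (\<theta> n) (\<Theta> n)" "\<And>n. compact (K n)" "\<And>n. K n \<subseteq> U"
    "\<And>n x. x \<notin> K n \<Longrightarrow> \<theta> n x = 0" "\<And>n x. 0 \<le> \<theta> n x" "\<And>n x. \<theta> n x \<le> 1"
    "\<And>x. (\<lambda>n. \<theta> n x) \<longlonglongrightarrow> indicator U x"
proof -
  obtain C :: "nat \<Rightarrow> (real^'n) set" where C: "\<And>n. compact (C n)" "\<And>n. C n \<subseteq> U"
      "\<And>K. \<lbrakk>compact K; K \<subseteq> U\<rbrakk> \<Longrightarrow> \<exists>N. \<forall>n\<ge>N. K \<subseteq> C n"
    by (rule open_Union_compact_subsets[OF assms]; blast)
  have "\<exists>\<theta> \<Theta> L. C1_with_grad UNIV \<theta> \<Theta> \<and> compact L \<and> L \<subseteq> U \<and> (\<forall>x. x \<notin> L \<longrightarrow> \<theta> x = 0) \<and>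
      (\<forall>x. 0 \<le> \<theta> x) \<and> (\<forall>x. \<theta> x \<le> 1) \<and> (\<forall>x. x \<in> C n \<longrightarrow> \<theta> x = (1::real))" for n
    by (rule C1_cutoff[OF C(1) assms C(2)], blast)
  then obtain \<theta> \<Theta> L where *: "\<And>n. C1_with_grad UNIV (\<theta> n) (\<Theta> n) \<and> compact (L n) \<and> L n \<subseteq> U \<and>
      (\<forall>x. x \<notin> L n \<longrightarrow> \<theta> n x = 0) \<and> (\<forall>x. 0 \<le> \<theta> n x) \<and> (\<forall>x. \<theta> n x \<le> 1) \<and> (\<forall>x. x \<in> C n \<longrightarrow> \<theta> n x = (1::real))"
    by metis
  have "(\<lambda>n. \<theta> n x) \<longlonglongrightarrow> indicator U x" for x
  proof (cases "x \<in> U")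
    case True
    then obtain N where "\<forall>n\<ge>N. {x} \<subseteq> C n" using C(3)[of "{x}"] by auto
    then have "\<forall>\<^sub>F n in sequentially. \<theta> n x = 1"
      unfolding eventually_sequentially using * by blast
    then show ?thesis using True by (simp add: tendsto_eventually)
  next
    case False
    then have "x \<notin> L n" for n using * by blast
    then have "\<theta> n x = 0" for n using * by blast
    then show ?thesis using False by simp
  qed
  then show ?thesis using that[of \<theta> \<Theta> L] * by blast
qed

lemma borel_measure_eqI_open:
  fixes M N :: "(real^'n) measure"
  assumes "sets M = sets borel" "sets N = sets borel" "emeasure M UNIV \<noteq> \<infinity>"
    and "\<And>U. open U \<Longrightarrow> emeasure M U = emeasure N U"
  shows "M = N"
  by (rule measure_eqI_generator_eq[of "{S. open S}" UNIV _ _ "\<lambda>_. UNIV"])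
    (use assms in \<open>auto simp: Int_stable_def sets_borel\<close>)

text \<open>Provides an explicit candidate for the surface measure; countable additivity survives
  because a finite sum commutes with the series.\<close>

lemma exists_sum_measure:
  fixes M :: "nat \<Rightarrow> (real^'n) measure"
  assumes "\<And>i. sets (M i) = sets borel"
  shows "\<exists>T. sets T = sets borel \<and> (\<forall>X\<in>sets borel. emeasure T X = (\<Sum>i<m. emeasure (M i) X))"
proof -
  let ?f = "\<lambda>X. \<Sum>i<m. emeasure (M i) X"
  let ?T = "measure_of UNIV (sets borel) ?f"
  have sT: "sets ?T = sets borel"
    using sets.sigma_sets_eq[of "borel :: (real^'n) measure"] by (simp add: sets_measure_of_conv)
  have "emeasure ?T X = ?f X" if "X \<in> sets borel" for X
  proof (rule emeasure_measure_of_sigma)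
    show "sigma_algebra UNIV (sets (borel :: (real^'n) measure))"
      using sets.sigma_algebra_axioms[of "borel :: (real^'n) measure"] by simp
    show "positive (sets borel) ?f" by (simp add: positive_def)
    show "countably_additive (sets borel) ?f"
    proof (rule countably_additiveI)
      fix A :: "nat \<Rightarrow> (real^'n) set"
      assume A: "range A \<subseteq> sets borel" "disjoint_family A" "(\<Union>i. A i) \<in> sets borel"
      have "(\<Sum>j. ?f (A j)) = (\<Sum>i<m. \<Sum>j. emeasure (M i) (A j))"
        by (rule suminf_sum) auto
      also have "\<dots> = ?f (\<Union>i. A i)"
        using A assms by (intro sum.cong refl suminf_emeasure) auto
      finally show "(\<Sum>j. ?f (A j)) = ?f (\<Union>i. A i)" .
    qed
  qed (use that in auto)
  then show ?thesis using sT by blast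
qed

text \<open>Two derivatives of \<open>\<gamma>\<close> enter here; the radicand is at least
  \<open>1\<close>, which keeps the inverse square root \<open>C^1\<close>. The result makes
  \<open>\<theta> N_j\<close> admissible in \<open>local_divergence\<close>.\<close>

lemma (in graph_function) C1_graph_normal:
  "\<exists>D. C1_with_grad UNIV (\<lambda>x. graph_normal k s \<gamma> x $ j) D"
proof -
  have p: "C1_with_grad UNIV (partial UNIV i \<gamma>) (grad UNIV (partial UNIV i \<gamma>))" for i
    using \<gamma>_smooth[of 2] by (intro Ck_closure_1_C1_with_grad) (simp add: numeral_2_eq_2)
  let ?S = "\<lambda>x. 1 + (\<Sum>i\<in>UNIV. partial UNIV i \<gamma> x * partial UNIV i \<gamma> x)"
  define D where "D x = 0 + (\<Sum>i\<in>UNIV. partial UNIV i \<gamma> x *\<^sub>R grad UNIV (partial UNIV i \<gamma>) x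
      + partial UNIV i \<gamma> x *\<^sub>R grad UNIV (partial UNIV i \<gamma>) x)" for x
  have D: "C1_with_grad UNIV ?S D"
    unfolding D_def by (intro C1_with_grad_add C1_with_grad_const C1_with_grad_sum C1_with_grad_mult p)
  have S1: "?S x \<ge> 1" for x by (simp add: sum_nonneg)
  have "C1_with_grad UNIV (\<lambda>x. - inverse (sqrt (?S x))) (\<lambda>x. (inverse (sqrt (?S x)) ^ 3 / 2) *\<^sub>R D x)"
  proof (rule C1_with_grad_compose[OF D, of "\<lambda>t. - inverse (sqrt t)" "\<lambda>t. inverse (sqrt t) ^ 3 / 2"])
    show "((\<lambda>t. - inverse (sqrt t)) has_real_derivative inverse (sqrt (?S x)) ^ 3 / 2) (at (?S x))" for x
      using S1[of x] by (auto intro!: derivative_eq_intros simp: power3_eq_cube)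
    have "t > 0" if "t \<in> ?S ` closure UNIV" for t
      using that S1 by (auto intro: less_le_trans[OF zero_less_one])
    then have "\<forall>t\<in>?S ` closure UNIV. sqrt t \<noteq> 0" by fastforce
    then show "continuous_on (?S ` closure UNIV) (\<lambda>t. - inverse (sqrt t))"
      and "continuous_on (?S ` closure UNIV) (\<lambda>t. inverse (sqrt t) ^ 3 / 2)"
      by (auto intro!: continuous_intros)
  qed
  moreover have "C1_with_grad UNIV (\<lambda>x. s * ((axis k 1 :: real^'n) $ j - partial UNIV j \<gamma> x))
      (\<lambda>x. s *\<^sub>R (0 - grad UNIV (partial UNIV j \<gamma>) x))"
    by (intro C1_with_grad_cmult C1_with_grad_diff C1_with_grad_const p)
  ultimately have "\<exists>D. C1_with_grad UNIV (\<lambda>x. - inverse (sqrt (?S x)) * (s * ((axis k 1 :: real^'n) $ j - partial UNIV j \<gamma> x))) D"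
    using C1_with_grad_mult by blast
  moreover have "graph_normal k s \<gamma> x $ j = - inverse (sqrt (?S x)) * (s * ((axis k 1 :: real^'n) $ j - partial UNIV j \<gamma> x))" for x
  proof -
    have "(norm (grad UNIV \<gamma> x))\<^sup>2 = (\<Sum>i\<in>UNIV. partial UNIV i \<gamma> x * partial UNIV i \<gamma> x)"
      unfolding power2_norm_eq_inner by (simp add: inner_vec_def grad_def)
    then have "norm (F' x) = sqrt (?S x)" using norm_F' by simp
    then show ?thesis
      by (simp add: graph_normal_def divide_inverse) (simp add: graph_grad_def grad_def)
  qed
  ultimately show ?thesis by simp
qed

section \<open>Agreement of the measures of overlapping patches\<close>

context domain_patch
begin

lemma frontier_compact: "compact (frontier \<Omega>)"
  using bounded_domain by (rule compact_frontier_bounded)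

lemma \<mu>_set_integrable:
  fixes g :: "real^'n \<Rightarrow> real"
  shows "continuous_on (frontier \<Omega>) g \<Longrightarrow> set_integrable \<mu> (frontier \<Omega>) g"
  by (rule set_integrable_continuous_finite_measure[OF sets_graph_measure finite_graph_measure frontier_compact])

text \<open>Inserting \<open>1 = |N|^2\<close> produces integrals with a factor
  \<open>N $ j\<close>, the form that a divergence theorem can evaluate.\<close>

lemma integral_split_normal:
  assumes "continuous_on (frontier \<Omega>) \<theta>"
  shows "(LINT x:frontier \<Omega>|\<mu>. \<theta> x) = (\<Sum>j\<in>UNIV. LINT x:frontier \<Omega>|\<mu>. \<theta> x * (N x $ j * N x $ j))"
proof -
  have i: "integrable \<mu> (\<lambda>x. indicator (frontier \<Omega>) x *\<^sub>R (\<theta> x * (N x $ j * N x $ j)))" for j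
    using assms by (intro \<mu>_set_integrable[unfolded set_integrable_def] continuous_intros N_continuous)
  have "(\<Sum>j\<in>UNIV. N x $ j * N x $ j) = 1" for x
    using N_simps(2)[of x] by (simp add: inner_vec_def)
  then have e: "(\<Sum>j\<in>UNIV. indicator (frontier \<Omega>) x *\<^sub>R (\<theta> x * (N x $ j * N x $ j)))
      = indicator (frontier \<Omega>) x *\<^sub>R \<theta> x" for x
    by (metis (no_types) mult.right_neutral scaleR_sum_right sum_distrib_left)
  show ?thesis
    unfolding set_lebesgue_integral_def
    by (subst Bochner_Integration.integral_sum[symmetric, OF i]) (simp only: e)
qed

lemma \<mu>_outside_ball:
  assumes "X \<in> sets borel"
  shows "emeasure \<mu> X = emeasure \<mu> (X \<inter> ball c r)"
proof -
  have [measurable]: "ball c r \<in> sets borel" by simp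
  let ?D = "distr (density M (\<lambda>y. ennreal (norm (F' (graph_point k \<gamma> y))))) borel (graph_point k \<gamma>)"
  have \<mu>: "\<mu> = density ?D (indicator (ball c r))"
    unfolding graph_measure_altdef by (simp add: ennreal_indicator)
  have "emeasure \<mu> X = (\<integral>\<^sup>+ x. indicator (ball c r) x * indicator X x \<partial>?D)"
    unfolding \<mu> using assms by (subst emeasure_density) auto
  also have "\<dots> = (\<integral>\<^sup>+ x. indicator (ball c r) x * indicator (X \<inter> ball c r) x \<partial>?D)"
    by (intro nn_integral_cong) (auto simp: indicator_def)
  also have "\<dots> = emeasure \<mu> (X \<inter> ball c r)"
    unfolding \<mu> using assms by (subst emeasure_density) auto
  finally show ?thesis .
qed

lemma \<mu>_outside_frontier:
  assumes X: "X \<in> sets borel"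
  shows "emeasure \<mu> X = emeasure \<mu> (X \<inter> frontier \<Omega>)"
proof -
  have fr: "frontier \<Omega> \<in> sets borel" by simp
  have "emeasure \<mu> (X \<inter> ball c r) = emeasure \<mu> (X \<inter> frontier \<Omega> \<inter> ball c r)"
  proof (rule emeasure_eq_AE)
    show "AE x in \<mu>. (x \<in> X \<inter> ball c r) = (x \<in> X \<inter> frontier \<Omega> \<inter> ball c r)"
      using AE_graph_measure by eventually_elim (use in_frontier_iff in blast)
  qed (use X fr in \<open>auto simp: sets_graph_measure\<close>)
  then show ?thesis using \<mu>_outside_ball[OF X] \<mu>_outside_ball[of "X \<inter> frontier \<Omega>"] X fr by auto
qed

end

text \<open>The two patches may be graphs over different coordinate hyperplanes.  Instead of a change of
  variables, the divergence theorem of each patch for \<open>\<theta> N\<^sub>j\<close> identifies the integrals of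
  \<open>\<theta> N\<^sub>j\<^sup>2\<close>, and \<open>|N| = 1\<close>.\<close>

lemma graph_measures_agree:
  assumes "domain_patch \<Omega> c1 r1 k1 s1 \<gamma>1" "domain_patch \<Omega> c2 r2 k2 s2 \<gamma>2"
    and X: "X \<in> sets borel" "X \<subseteq> ball c1 r1 \<inter> ball c2 r2"
  shows "emeasure (graph_measure c1 r1 k1 \<gamma>1) X = emeasure (graph_measure c2 r2 k2 \<gamma>2) X"
proof -
  interpret P1: domain_patch \<Omega> c1 r1 k1 s1 \<gamma>1 by fact
  interpret P2: domain_patch \<Omega> c2 r2 k2 s2 \<gamma>2 by fact
  let ?O = "ball c1 r1 \<inter> ball c2 r2" and ?S = "frontier \<Omega>"
  \<comment> \<open>Both agree with \<open>outer_normal\<close>, whose definition mentions no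
    patch.\<close>
  have N_eq: "P1.N x = P2.N x" if "x \<in> ?S" "x \<in> ?O" for x
    using P1.outer_normal_eq[of x] P2.outer_normal_eq[of x] that by simp
  have eq\<theta>: "(LINT x:?S|P1.\<mu>. \<theta> x) = (LINT x:?S|P2.\<mu>. \<theta> x)"
    if \<theta>: "C1_with_grad UNIV \<theta> \<Theta>" and K: "compact K" "K \<subseteq> ?O" "\<And>x. x \<notin> K \<Longrightarrow> \<theta> x = 0" for \<theta> \<Theta> K
  proof -
    have K12: "K \<subseteq> ball c1 r1" "K \<subseteq> ball c2 r2" using K(2) by auto
    have c\<theta>: "continuous_on S \<theta>" for S by (rule C1_with_grad_UNIV_continuous(1)[OF \<theta>])
    have j: "(LINT x:?S|P1.\<mu>. \<theta> x * (P1.N x $ j * P1.N x $ j)) = (LINT x:?S|P2.\<mu>. \<theta> x * (P2.N x $ j * P2.N x $ j))" for j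
    proof -
      obtain D where D: "C1_with_grad UNIV (\<lambda>x. P1.N x $ j) D" using P1.C1_graph_normal by blast
      \<comment> \<open>The same function, built with the normal of the first patch, enters both
        local divergence theorems; their volume integrals then coincide.\<close>
      note m = C1_with_grad_mult[OF \<theta> D]
      have z: "\<theta> x * P1.N x $ j = 0" if "x \<notin> K" for x using K(3)[OF that] by simp
      have "(LINT x:?S|P1.\<mu>. \<theta> x * P1.N x $ j * (P1.N x \<bullet> axis j 1)) = (LINT x:?S|P2.\<mu>. \<theta> x * P1.N x $ j * (P2.N x \<bullet> axis j 1))"
        using P1.local_divergence[OF m K(1) K12(1) z, of "axis j 1"]
          P2.local_divergence[OF m K(1) K12(2) z, of "axis j 1"] by simp
      also have "\<dots> = (LINT x:?S|P2.\<mu>. \<theta> x * P2.N x $ j * (P2.N x \<bullet> axis j 1))"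
        unfolding set_lebesgue_integral_def
      proof (rule Bochner_Integration.integral_cong[OF refl])
        fix x
        show "indicator ?S x *\<^sub>R (\<theta> x * P1.N x $ j * (P2.N x \<bullet> axis j 1))
            = indicator ?S x *\<^sub>R (\<theta> x * P2.N x $ j * (P2.N x \<bullet> axis j 1))"
        proof (cases "x \<in> ?S \<inter> K")
          case True
          then have "P1.N x = P2.N x" using N_eq K(2) by blast
          then show ?thesis by simp
        next
          case False
          then show ?thesis using K(3)[of x] by (cases "x \<in> ?S") auto
        qed
      qed
      finally show ?thesis by (simp add: inner_axis mult.assoc)
    qed
    show ?thesis
      unfolding P1.integral_split_normal[OF c\<theta>] P2.integral_split_normal[OF c\<theta>] using j by simp
  qed
  have eqU: "emeasure P1.\<mu> U = emeasure P2.\<mu> U" if U: "open U" "U \<subseteq> ?O" for U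
  proof -
    obtain \<theta> \<Theta> K where \<theta>: "\<And>n. C1_with_grad UNIV (\<theta> n) (\<Theta> n)" "\<And>n. compact (K n)" "\<And>n. K n \<subseteq> U"
      "\<And>n x. x \<notin> K n \<Longrightarrow> \<theta> n x = 0" "\<And>n x. 0 \<le> \<theta> n x" "\<And>n x. \<theta> n x \<le> 1"
      "\<And>x. (\<lambda>n. \<theta> n x) \<longlonglongrightarrow> indicator U x"
      by (rule indicator_open_C1_limit[OF U(1)]; blast)
    have lim: "(\<lambda>n. LINT x:?S|\<nu>. \<theta> n x) \<longlonglongrightarrow> measure \<nu> (U \<inter> ?S)"
      if \<nu>: "sets \<nu> = sets borel" "emeasure \<nu> UNIV < \<infinity>" for \<nu> :: "(real^'a) measure"
    proof -
      have sp: "space \<nu> = UNIV" using sets_eq_imp_space_eq[OF \<nu>(1)] by simp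
      interpret finite_measure \<nu> using \<nu>(2) sp by (intro finite_measureI) auto
      have m: "(\<lambda>x. indicator ?S x *\<^sub>R \<theta> n x) \<in> borel_measurable \<nu>" for n
        unfolding measurable_cong_sets[OF \<nu>(1) refl]
        by (rule borel_measurable_continuous_on_indicator)
          (auto intro: C1_with_grad_UNIV_continuous(1)[OF \<theta>(1)])
      have US: "U \<inter> ?S \<in> sets \<nu>" using U(1) \<nu>(1) by auto
      have "(\<lambda>n. LINT x|\<nu>. indicator ?S x *\<^sub>R \<theta> n x) \<longlonglongrightarrow> (LINT x|\<nu>. indicator (U \<inter> ?S) x)"
      proof (rule integral_dominated_convergence[where w="\<lambda>x. 1"])
        show "AE x in \<nu>. (\<lambda>n. indicator ?S x *\<^sub>R \<theta> n x) \<longlonglongrightarrow> indicator (U \<inter> ?S) x"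
        proof (rule AE_I2)
          fix x
          show "(\<lambda>n. indicator ?S x *\<^sub>R \<theta> n x) \<longlonglongrightarrow> indicator (U \<inter> ?S) x"
            using \<theta>(7)[of x] by (auto simp: indicator_def)
        qed
        show "AE x in \<nu>. norm (indicator ?S x *\<^sub>R \<theta> n x) \<le> 1" for n
          using \<theta>(5,6) by (auto simp: indicator_def)
      qed (use m US in auto)
      then show ?thesis using US sp by (simp add: set_lebesgue_integral_def)
    qed
    have KO: "K n \<subseteq> ?O" for n using \<theta>(3)[of n] U(2) by blast
    have "(LINT x:?S|P1.\<mu>. \<theta> n x) = (LINT x:?S|P2.\<mu>. \<theta> n x)" for n
      by (rule eq\<theta>[OF \<theta>(1,2) KO \<theta>(4)])
    then have "(\<lambda>n. LINT x:?S|P1.\<mu>. \<theta> n x) \<longlonglongrightarrow> measure P2.\<mu> (U \<inter> ?S)"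
      using lim[OF P2.sets_graph_measure P2.finite_graph_measure, of c2 r2] by simp
    then have "measure P1.\<mu> (U \<inter> ?S) = measure P2.\<mu> (U \<inter> ?S)"
      using lim[OF P1.sets_graph_measure P1.finite_graph_measure, of c1 r1] LIMSEQ_unique by blast
    moreover have "emeasure P1.\<mu> (U \<inter> ?S) = ennreal (measure P1.\<mu> (U \<inter> ?S))"
    proof -
      interpret finite_measure P1.\<mu>
        using P1.finite_graph_measure[of c1 r1] by (intro finite_measureI) (auto simp: P1.space_graph_measure)
      show ?thesis by (rule emeasure_eq_measure)
    qed
    moreover have "emeasure P2.\<mu> (U \<inter> ?S) = ennreal (measure P2.\<mu> (U \<inter> ?S))"
    proof -
      interpret finite_measure P2.\<mu>
        using P2.finite_graph_measure[of c2 r2] by (intro finite_measureI) (auto simp: P2.space_graph_measure)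
      show ?thesis by (rule emeasure_eq_measure)
    qed
    ultimately show ?thesis
      using P1.\<mu>_outside_frontier[of U] P2.\<mu>_outside_frontier[of U] U(1) by simp
  qed
  have O: "?O \<in> sets borel" by simp
  have dens: "emeasure (density P1.\<mu> (indicator ?O)) Y = emeasure P1.\<mu> (Y \<inter> ?O)"
    "emeasure (density P2.\<mu> (indicator ?O)) Y = emeasure P2.\<mu> (Y \<inter> ?O)" if "Y \<in> sets borel" for Y
    using that O by (simp_all add: emeasure_density_indicator P1.sets_graph_measure P2.sets_graph_measure)
  \<comment> \<open>Restriction to the overlap gives finite Borel measures that agree on all open
    sets, and these determine them.\<close>
  have "density P1.\<mu> (indicator ?O) = density P2.\<mu> (indicator ?O)"
  proof (rule borel_measure_eqI_open)
    show "sets (density P1.\<mu> (indicator ?O)) = sets borel" "sets (density P2.\<mu> (indicator ?O)) = sets borel"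
      by (simp_all add: P1.sets_graph_measure P2.sets_graph_measure)
    have "emeasure P1.\<mu> (UNIV \<inter> ?O) \<le> emeasure P1.\<mu> UNIV"
      by (intro emeasure_mono) (auto simp: P1.sets_graph_measure)
    also have "\<dots> < \<infinity>" by (rule P1.finite_graph_measure)
    finally show "emeasure (density P1.\<mu> (indicator ?O)) UNIV \<noteq> \<infinity>" by (simp add: dens)
    show "emeasure (density P1.\<mu> (indicator ?O)) U = emeasure (density P2.\<mu> (indicator ?O)) U"
      if "open U" for U using eqU[of "U \<inter> ?O"] that by (auto simp: dens)
  qed
  then show ?thesis using dens[OF X(1)] X(2) by (metis inf.absorb1)
qed

lemma partial_const: "partial U i (\<lambda>x. c) = (\<lambda>x. ext_closure U (\<lambda>x. 0) x)"
  by (simp add: partial_def frechet_derivative_const)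

lemma Ck_closure_const: "Ck_closure m UNIV (\<lambda>x. c)"
  by (induction m arbitrary: c) (simp_all add: partial_const ext_closure_def)

text \<open>With a graph below the ball, interior points need no separate treatment.\<close>

lemma graph_patch_interior:
  assumes "open \<Omega>" "p \<in> \<Omega>"
  shows "\<exists>r k s \<gamma>. graph_patch \<Omega> p r k s \<gamma>"
proof -
  obtain r where r: "r > 0" "ball p r \<subseteq> \<Omega>" using assms open_contains_ball by blast
  fix k
  have "x $ k > p $ k - r" if "x \<in> ball p r" for x
    using component_le_norm_cart[of "x - p" k] that by (auto simp: dist_norm norm_minus_commute)
  then have "graph_patch \<Omega> p r k 1 (\<lambda>x. p $ k - r)"
    using r Ck_closure_const by (auto simp: graph_patch_def)
  then show ?thesis by blast
qed

section \<open>The global surface measure of a smooth domain\<close>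

locale smooth_domain =
  fixes \<Omega> :: "(real^'n::finite) set"
  assumes domain: "bounded_smooth_domain \<Omega>"
begin

lemma open_\<Omega>: "open \<Omega>" and bounded_\<Omega>: "bounded \<Omega>" and nonempty_\<Omega>: "\<Omega> \<noteq> {}"
  using domain by (auto simp: bounded_smooth_domain_def)

lemma domain_patch_iff: "domain_patch \<Omega> c r k s \<gamma> \<longleftrightarrow> graph_patch \<Omega> c r k s \<gamma>"
  using open_\<Omega> bounded_\<Omega> by (auto simp: domain_patch_def)

lemma exists_patch:
  assumes "p \<in> closure \<Omega>"
  shows "\<exists>r k s \<gamma>. graph_patch \<Omega> p r k s \<gamma>"
proof (cases "p \<in> \<Omega>")
  case True
  then show ?thesis using graph_patch_interior open_\<Omega> by blast
next
  case False
  then have "p \<in> frontier \<Omega>" using assms open_\<Omega> by (simp add: frontier_def interior_open)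
  then show ?thesis
    using domain by (auto simp: bounded_smooth_domain_def smooth_boundary_def)
qed

lemma patch_choice:
  obtains r k s \<gamma> where "\<And>p. p \<in> closure \<Omega> \<Longrightarrow> graph_patch \<Omega> p (r p) (k p) (s p) (\<gamma> p)"
proof -
  have "\<forall>p\<in>closure \<Omega>. \<exists>q. graph_patch \<Omega> p (fst q) (fst (snd q)) (fst (snd (snd q))) (snd (snd (snd q)))"
  proof
    fix p assume "p \<in> closure \<Omega>"
    from exists_patch[OF this] obtain r k s \<gamma> where "graph_patch \<Omega> p r k s \<gamma>" by blast
    then show "\<exists>q. graph_patch \<Omega> p (fst q) (fst (snd q)) (fst (snd (snd q))) (snd (snd (snd q)))"
      by (intro exI[of _ "(r, k, s, \<gamma>)"]) simp
  qed
  from bchoice[OF this] show ?thesis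
    using that[of "\<lambda>p. fst (q p)" "\<lambda>p. fst (snd (q p))" "\<lambda>p. fst (snd (snd (q p)))"
        "\<lambda>p. snd (snd (snd (q p)))" for q] by blast
qed

abbreviation \<sigma> where "\<sigma> \<equiv> surface_measure \<Omega>"

abbreviation patch_measures where
  "patch_measures \<equiv> {graph_measure c r k \<gamma> | c r k s \<gamma>. graph_patch \<Omega> c r k s \<gamma>}"

lemma sets_surface_measure: "sets \<sigma> = sets borel"
proof -
  have s: "space m = UNIV" "sets m = sets borel" if "m \<in> patch_measures" for m
    using that by (auto simp: graph_measure_def)
  \<comment> \<open>The supremum of an empty family would not be a measure on the Borel sets; a
    patch exists because \<open>\<Omega>\<close> is nonempty and interior points have patches
    too.\<close>
  have ne: "patch_measures \<noteq> {}"
  proof -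
    obtain p where "p \<in> closure \<Omega>" using nonempty_\<Omega> closure_subset by fast
    from exists_patch[OF this] obtain r k s \<gamma> where "graph_patch \<Omega> p r k s \<gamma>" by blast
    then have "graph_measure p r k \<gamma> \<in> patch_measures" by blast
    then show ?thesis by blast
  qed
  have "sets \<sigma> = sigma_sets UNIV (\<Union>m\<in>patch_measures. sets m)"
    unfolding surface_measure_def by (rule sets_Sup_eq[OF s(1) ne])
  also have "(\<Union>m\<in>patch_measures. sets m) = sets borel" using s(2) ne by auto
  also have "sigma_sets UNIV (sets borel) = sets (borel :: (real^'n) measure)"
    using sets.sigma_sets_eq[of "borel :: (real^'n) measure"] by simp
  finally show ?thesis .
qed

text \<open>The supremum is identified with an explicit measure \<open>T\<close>: finitely many
  patch balls cover the compact frontier, they are made disjoint, and the patch measures restricted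
  to the pieces are added. Agreement on overlaps puts every patch measure below \<open>T\<close>;
  conversely, on each piece \<open>T\<close> is a patch measure and hence below
  \<open>\<sigma>\<close>.\<close>

lemma surface_measure_properties:
  "emeasure \<sigma> UNIV < \<infinity> \<and> (\<forall>c r k s \<gamma> X. graph_patch \<Omega> c r k s \<gamma> \<longrightarrow> X \<in> sets borel \<longrightarrow> X \<subseteq> ball c r \<longrightarrow>
     emeasure \<sigma> X = emeasure (graph_measure c r k \<gamma>) X)"
proof -
  let ?S = "frontier \<Omega>"
  obtain r k s \<gamma> where "\<And>p. p \<in> closure \<Omega> \<Longrightarrow> graph_patch \<Omega> p (r p) (k p) (s p) (\<gamma> p)"
    using patch_choice by blast
  then have gp: "graph_patch \<Omega> p (r p) (k p) (s p) (\<gamma> p)" if "p \<in> ?S" for p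
    using that by (simp add: frontier_def)
  have rp: "r p > 0" if "p \<in> ?S" for p using gp[OF that] by (simp add: graph_patch_def)
  have cS: "compact ?S" using bounded_\<Omega> by (rule compact_frontier_bounded)
  obtain I where I: "I \<subseteq> ?S" "finite I" "?S \<subseteq> (\<Union>p\<in>I. ball p (r p))"
  proof (rule compactE_image[OF cS, of ?S "\<lambda>p. ball p (r p)"])
    show "?S \<subseteq> (\<Union>c\<in>?S. ball c (r c))" using rp by force
  qed auto
  obtain h where h: "bij_betw h {0..<card I} I" using ex_bij_betw_nat_finite[OF I(2)] by blast
  define m where "m = card I"
  have hI: "h i \<in> ?S" if "i < m" for i
    using bij_betwE[OF h] that I(1) by (auto simp: m_def)
  \<comment> \<open>\<open>disjointed\<close> acts on sequences; empty sets from \<open>m\<close> on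
    leave only finitely many pieces.\<close>
  define B where "B i = (if i < m then ball (h i) (r (h i)) else {})" for i
  define D where "D = disjointed B"
  have DB: "D i \<subseteq> B i" for i by (simp add: D_def disjointed_subset)
  have Dm [measurable]: "D i \<in> sets borel" for i
  proof -
    have "range B \<subseteq> sets borel" by (auto simp: B_def)
    then show ?thesis using sets.range_disjointed_sets[of B borel] by (auto simp: D_def)
  qed
  have Ddisj: "disjoint_family_on D {..<m}"
    using disjoint_family_disjointed[of B] by (auto simp: D_def disjoint_family_on_def)
  have Dempty: "D i = {}" if "i \<ge> m" for i using DB[of i] that by (simp add: B_def)
  have "(\<Union>i. D i) = (\<Union>i. B i)" by (simp add: D_def UN_disjointed_eq)
  also have "?S \<subseteq> (\<Union>i. B i)"
  proof
    fix x assume "x \<in> ?S"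
    then obtain p where "p \<in> I" "x \<in> ball p (r p)" using I(3) by blast
    then have "p \<in> h ` {0..<card I}" using h by (simp add: bij_betw_def)
    then obtain i where "i < m" "p = h i" by (auto simp: m_def)
    then have "x \<in> B i" using \<open>x \<in> ball p (r p)\<close> by (simp add: B_def)
    then show "x \<in> (\<Union>i. B i)" by blast
  qed
  finally have "?S \<subseteq> (\<Union>i. D i)" .
  moreover have "(\<Union>i. D i) \<subseteq> (\<Union>i<m. D i)"
  proof
    fix x assume "x \<in> (\<Union>i. D i)"
    then obtain i where "x \<in> D i" by blast
    moreover from this have "i < m" using Dempty[of i] by (cases "i < m") auto
    ultimately show "x \<in> (\<Union>i<m. D i)" by blast
  qed
  ultimately have cover: "?S \<subseteq> (\<Union>i<m. D i)" by (rule order_trans)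
  define \<mu> where "\<mu> i = graph_measure (h i) (r (h i)) (k (h i)) (\<gamma> (h i))" for i
  have s\<mu>: "sets (\<mu> i) = sets borel" for i by (simp add: \<mu>_def graph_measure_def)
  have patch_i: "domain_patch \<Omega> (h i) (r (h i)) (k (h i)) (s (h i)) (\<gamma> (h i))" if "i < m" for i
    using gp[OF hI[OF that]] by (simp add: domain_patch_iff)
  obtain T where sT: "sets T = sets borel"
    and T: "\<And>X. X \<in> sets borel \<Longrightarrow> emeasure T X = (\<Sum>i<m. emeasure (density (\<mu> i) (indicator (D i))) X)"
    using exists_sum_measure[of "\<lambda>i. density (\<mu> i) (indicator (D i))" m] s\<mu> by auto
  have T: "emeasure T X = (\<Sum>i<m. emeasure (\<mu> i) (X \<inter> D i))" if X: "X \<in> sets borel" for X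
    unfolding T[OF X]
    using X Dm s\<mu> by (intro sum.cong refl emeasure_density_indicator) auto
  have split: "emeasure \<nu> (X \<inter> (\<Union>i<m. D i)) = (\<Sum>i<m. emeasure \<nu> (X \<inter> D i))"
    if "sets \<nu> = sets borel" "X \<in> sets borel" for \<nu> :: "(real^'n) measure" and X
  proof -
    have "X \<inter> (\<Union>i<m. D i) = (\<Union>i<m. X \<inter> D i)" by blast
    moreover have "(\<Sum>i<m. emeasure \<nu> (X \<inter> D i)) = emeasure \<nu> (\<Union>i<m. X \<inter> D i)"
      using that Ddisj by (intro sum_emeasure) (auto simp: disjoint_family_on_def)
    ultimately show ?thesis by simp
  qed
  \<comment> \<open>An arbitrary patch measure lives on its ball and on the frontier, which the
    pieces cover; on each piece it may be exchanged for \<open>\<mu> i\<close>.\<close>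
  have local: "emeasure \<nu> X = (\<Sum>i<m. emeasure (\<mu> i) (X \<inter> ball c' r' \<inter> D i))"
    if p: "graph_patch \<Omega> c' r' k' s' \<gamma>'" and \<nu>: "\<nu> = graph_measure c' r' k' \<gamma>'" and X: "X \<in> sets borel" for c' r' k' s' \<gamma>' \<nu> X
  proof -
    interpret P: domain_patch \<Omega> c' r' k' s' \<gamma>' using p by (simp add: domain_patch_iff)
    have X': "X \<inter> ball c' r' \<in> sets borel" using X by simp
    have "emeasure \<nu> X = emeasure \<nu> (X \<inter> ball c' r')"
      unfolding \<nu> by (rule P.\<mu>_outside_ball[OF X])
    also have "\<dots> = emeasure \<nu> ((X \<inter> ball c' r') \<inter> (\<Union>i<m. D i) \<inter> ?S)"
    proof -
      have e: "X \<inter> ball c' r' \<inter> (\<Union>i<m. D i) \<inter> ?S = X \<inter> ball c' r' \<inter> ?S" using cover by blast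
      show ?thesis unfolding \<nu> e by (rule P.\<mu>_outside_frontier[OF X'])
    qed
    also have "\<dots> = emeasure \<nu> ((X \<inter> ball c' r') \<inter> (\<Union>i<m. D i))"
      unfolding \<nu> by (rule P.\<mu>_outside_frontier[symmetric]) (use X' in auto)
    also have "\<dots> = (\<Sum>i<m. emeasure \<nu> (X \<inter> ball c' r' \<inter> D i))"
      by (rule split) (use X' in \<open>auto simp: \<nu> P.sets_graph_measure\<close>)
    also have "\<dots> = (\<Sum>i<m. emeasure (\<mu> i) (X \<inter> ball c' r' \<inter> D i))"
    proof (intro sum.cong refl)
      fix i assume "i \<in> {..<m}"
      then have i: "i < m" by simp
      have "D i \<subseteq> ball (h i) (r (h i))" using DB[of i] i by (simp add: B_def)
      then show "emeasure \<nu> (X \<inter> ball c' r' \<inter> D i) = emeasure (\<mu> i) (X \<inter> ball c' r' \<inter> D i)"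
        unfolding \<nu> \<mu>_def using X' Dm
        by (intro graph_measures_agree[OF P.domain_patch_axioms patch_i[OF i]]) auto
    qed
    finally show ?thesis .
  qed
  have "\<sigma> \<le> T"
    unfolding surface_measure_def
  proof (rule Sup_least)
    fix \<nu> assume "\<nu> \<in> patch_measures"
    then obtain c' r' k' s' \<gamma>' where p: "\<nu> = graph_measure c' r' k' \<gamma>'" "graph_patch \<Omega> c' r' k' s' \<gamma>'" by blast
    have s\<nu>: "sets \<nu> = sets borel" by (simp add: p(1) graph_measure_def)
    have "emeasure \<nu> X \<le> emeasure T X" if X: "X \<in> sets borel" for X
      unfolding local[OF p(2,1) X] T[OF X]
      using X Dm s\<mu> by (intro sum_mono emeasure_mono) auto
    then show "\<nu> \<le> T" using s\<nu> sT by (simp add: le_measure)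
  qed
  moreover have "T \<le> \<sigma>"
  proof -
    have "emeasure T X \<le> emeasure \<sigma> X" if X: "X \<in> sets borel" for X
    proof -
      have "emeasure (\<mu> i) Y \<le> emeasure \<sigma> Y" if "i < m" "Y \<in> sets borel" for i Y
      proof -
        have "\<mu> i \<in> patch_measures" using gp[OF hI[OF that(1)]] unfolding \<mu>_def by blast
        then have "\<mu> i \<le> \<sigma>" unfolding surface_measure_def by (rule Sup_upper)
        then show ?thesis using that(2) s\<mu> sets_surface_measure by (simp add: le_measure)
      qed
      then have "emeasure T X \<le> (\<Sum>i<m. emeasure \<sigma> (X \<inter> D i))"
        unfolding T[OF X] using X by (intro sum_mono) auto
      also have "\<dots> = emeasure \<sigma> (X \<inter> (\<Union>i<m. D i))"
        by (rule split[symmetric]) (use X sets_surface_measure in auto)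
      also have "\<dots> \<le> emeasure \<sigma> X"
        using X sets_surface_measure by (intro emeasure_mono) auto
      finally show ?thesis .
    qed
    then show ?thesis using sT sets_surface_measure by (simp add: le_measure)
  qed
  ultimately have \<sigma>T: "\<sigma> = T" by (rule antisym)
  have "emeasure T UNIV < \<infinity>"
  proof -
    have "emeasure (\<mu> i) (UNIV \<inter> D i) < \<infinity>" if i: "i < m" for i
    proof -
      interpret P: domain_patch \<Omega> "h i" "r (h i)" "k (h i)" "s (h i)" "\<gamma> (h i)" by (rule patch_i[OF i])
      have "emeasure (\<mu> i) (UNIV \<inter> D i) \<le> emeasure (\<mu> i) UNIV"
        using s\<mu> by (intro emeasure_mono) auto
      also have "\<dots> < \<infinity>" unfolding \<mu>_def by (rule P.finite_graph_measure)
      finally show ?thesis .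
    qed
    then have "(\<Sum>i<m. emeasure (\<mu> i) (UNIV \<inter> D i)) < \<infinity>"
      by (auto simp: ennreal_sum_less_top infinity_ennreal_def)
    then show ?thesis using T[of UNIV] by simp
  qed
  moreover have "emeasure T X = emeasure (graph_measure c' r' k' \<gamma>') X"
    if p: "graph_patch \<Omega> c' r' k' s' \<gamma>'" and X: "X \<in> sets borel" "X \<subseteq> ball c' r'" for c' r' k' s' \<gamma>' X
  proof -
    have "X \<inter> ball c' r' = X" using X(2) by blast
    then show ?thesis using local[OF p refl X(1)] T[OF X(1)] by simp
  qed
  ultimately show ?thesis unfolding \<sigma>T by blast
qed

lemma finite_surface_measure: "emeasure \<sigma> UNIV < \<infinity>"
  using surface_measure_properties by blast

lemma frontier_compact: "compact (frontier \<Omega>)"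
  using bounded_\<Omega> by (rule compact_frontier_bounded)

lemma \<sigma>_set_integrable:
  fixes g :: "real^'n \<Rightarrow> real"
  shows "continuous_on (frontier \<Omega>) g \<Longrightarrow> set_integrable \<sigma> (frontier \<Omega>) g"
  by (rule set_integrable_continuous_finite_measure[OF sets_surface_measure finite_surface_measure frontier_compact])

text \<open>The patch measure is \<open>\<sigma>\<close> with the indicator of the ball as density,
  and off the ball the integrand contributes nothing.\<close>

lemma surface_integral_patch:
  fixes g :: "real^'n \<Rightarrow> real"
  assumes p: "graph_patch \<Omega> c r k s \<gamma>" and g: "continuous_on (frontier \<Omega>) g"
    and z: "\<And>x. x \<in> frontier \<Omega> \<Longrightarrow> x \<notin> ball c r \<Longrightarrow> g x = 0"
  shows "(LINT x:frontier \<Omega>|\<sigma>. g x) = (LINT x:frontier \<Omega>|graph_measure c r k \<gamma>. g x)"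
proof -
  interpret P: domain_patch \<Omega> c r k s \<gamma> using p by (simp add: domain_patch_iff)
  have b [measurable]: "ball c r \<in> sets borel" by simp
  have \<mu>: "P.\<mu> = density \<sigma> (\<lambda>x. ennreal (indicator (ball c r) x))"
  proof (rule measure_eqI)
    show "sets P.\<mu> = sets (density \<sigma> (\<lambda>x. ennreal (indicator (ball c r) x)))"
      by (simp add: P.sets_graph_measure sets_surface_measure)
    fix X assume "X \<in> sets P.\<mu>"
    then have X: "X \<in> sets borel" by (simp add: P.sets_graph_measure)
    have "emeasure (density \<sigma> (indicator (ball c r))) X = emeasure \<sigma> (X \<inter> ball c r)"
      using X b by (intro emeasure_density_indicator sets_surface_measure)
    also have "\<dots> = emeasure P.\<mu> (X \<inter> ball c r)"
      using surface_measure_properties p X by auto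
    also have "\<dots> = emeasure P.\<mu> X" by (rule P.\<mu>_outside_ball[OF X, symmetric])
    finally show "emeasure P.\<mu> X = emeasure (density \<sigma> (\<lambda>x. ennreal (indicator (ball c r) x))) X"
      by (simp add: ennreal_indicator)
  qed
  have m: "(\<lambda>x. indicator (frontier \<Omega>) x *\<^sub>R g x) \<in> borel_measurable \<sigma>"
    using \<sigma>_set_integrable[OF g] by (auto simp: set_integrable_def)
  have mb: "(\<lambda>x. indicator (ball c r) x :: real) \<in> borel_measurable \<sigma>"
    using b by (intro borel_measurable_indicator) (simp add: sets_surface_measure)
  have "(LINT x:frontier \<Omega>|P.\<mu>. g x) = (LINT x|\<sigma>. indicator (ball c r) x *\<^sub>R (indicator (frontier \<Omega>) x *\<^sub>R g x))"
    unfolding set_lebesgue_integral_def \<mu> by (rule integral_density[OF m mb]) auto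
  also have "\<dots> = (LINT x|\<sigma>. indicator (frontier \<Omega>) x *\<^sub>R g x)"
    by (intro Bochner_Integration.integral_cong refl) (use z in \<open>auto simp: indicator_def simp del: mem_ball\<close>)
  finally show ?thesis by (simp add: set_lebesgue_integral_def)
qed

end

subsection \<open>Divergence theorems\<close>

context smooth_domain
begin

abbreviation \<nu> where "\<nu> \<equiv> outer_normal \<Omega>"

lemma outer_normal_patch:
  assumes "graph_patch \<Omega> c r k s \<gamma>" "x \<in> frontier \<Omega>" "x \<in> ball c r"
  shows "\<nu> x = graph_normal k s \<gamma> x"
  using domain_patch.outer_normal_eq[of \<Omega> c r k s \<gamma> x] assms by (simp add: domain_patch_iff)

text \<open>Near each boundary point the normal is a \<open>graph_normal\<close>, and continuity is
  local.\<close>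

lemma continuous_on_outer_normal: "continuous_on (frontier \<Omega>) \<nu>"
  unfolding continuous_on_eq_continuous_within
proof
  fix p assume p: "p \<in> frontier \<Omega>"
  then have "p \<in> closure \<Omega>" by (simp add: frontier_def)
  then obtain r k s \<gamma> where gp: "graph_patch \<Omega> p r k s \<gamma>" using exists_patch by blast
  interpret P: domain_patch \<Omega> p r k s \<gamma> using gp by (simp add: domain_patch_iff)
  have r: "r > 0" using gp by (simp add: graph_patch_def)
  have "continuous (at p within frontier \<Omega>) P.N"
    using P.N_continuous p continuous_on_eq_continuous_within by blast
  then show "continuous (at p within frontier \<Omega>) \<nu>"
    by (rule continuous_transform_within[OF _ r p])
      (use outer_normal_patch[OF gp] in \<open>auto simp: dist_commute\<close>)
qed

text \<open>The local cuts are summed over a partition of unity on \<open>closure \<Omega>\<close>.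
  Since the weights add up to \<open>1\<close>, their gradients cancel in \<open>\<Omega>\<close>;
  the volume terms of the local limits disappear and only the surface integral remains.\<close>

lemma surface_cutoff:
  obtains \<zeta> :: "nat \<Rightarrow> real^'n \<Rightarrow> real" and Z where
    "\<And>n. C1_with_grad UNIV (\<zeta> n) (Z n)"
    "\<And>n. \<exists>L. compact L \<and> L \<subseteq> \<Omega> \<and> (\<forall>x. x \<notin> L \<longrightarrow> \<zeta> n x = 0)"
    "\<And>n x. 0 \<le> \<zeta> n x" "\<And>n x. \<zeta> n x \<le> 1"
    "\<And>x. x \<in> \<Omega> \<Longrightarrow> (\<lambda>n. \<zeta> n x) \<longlonglongrightarrow> 1"
    "\<And>G e. continuous_on (closure \<Omega>) G \<Longrightarrow>
      (\<lambda>n. LINT x:\<Omega>|lborel. G x * (Z n x \<bullet> e)) \<longlonglongrightarrow> - (LINT x:frontier \<Omega>|\<sigma>. G x * (\<nu> x \<bullet> e))"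
proof -
  let ?S = "frontier \<Omega>"
  obtain r k s \<gamma> where gp: "\<And>p. p \<in> closure \<Omega> \<Longrightarrow> graph_patch \<Omega> p (r p) (k p) (s p) (\<gamma> p)"
    using patch_choice by blast
  \<comment> \<open>With half the radius the closed balls containing the supports stay inside the
    patch balls, as the local limits require.\<close>
  have rp: "r p / 2 > 0" if "p \<in> closure \<Omega>" for p using gp[OF that] by (simp add: graph_patch_def)
  have cS: "compact (closure \<Omega>)" using bounded_\<Omega> by (simp add: compact_closure)
  obtain I and \<theta> :: "real^'n \<Rightarrow> real^'n \<Rightarrow> real" and \<Theta> where I: "finite I" "I \<subseteq> closure \<Omega>"
    "\<And>i. i \<in> I \<Longrightarrow> C1_with_grad UNIV (\<theta> i) (\<Theta> i)"
    "\<And>i x. i \<in> I \<Longrightarrow> 0 \<le> \<theta> i x" "\<And>i x. i \<in> I \<Longrightarrow> x \<notin> ball i (r i / 2) \<Longrightarrow> \<theta> i x = 0"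
    "\<And>x. (\<Sum>i\<in>I. \<theta> i x) \<le> 1" "\<And>x. x \<in> closure \<Omega> \<Longrightarrow> (\<Sum>i\<in>I. \<theta> i x) = 1"
    by (rule C1_partition_of_unity[OF cS rp]; (assumption | rule that; assumption))
  have dp: "domain_patch \<Omega> i (r i) (k i) (s i) (\<gamma> i)" if "i \<in> I" for i
    using gp I(2) that by (auto simp: domain_patch_iff)
  define K where "K i = cball i (r i / 2)" for i
  have K: "compact (K i)" "K i \<subseteq> ball i (r i)" "\<And>x. x \<notin> K i \<Longrightarrow> \<theta> i x = 0" if "i \<in> I" for i
  proof -
    show "compact (K i)" by (simp add: K_def)
    have "r i > 0" using rp[of i] I(2) that by auto
    then show "K i \<subseteq> ball i (r i)" by (auto simp: K_def)
    show "\<theta> i x = 0" if "x \<notin> K i" for x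
      using I(5)[OF \<open>i \<in> I\<close>, of x] that by (auto simp: K_def)
  qed
  define ct where "ct i = domain_patch.cut \<Omega> i (r i) (k i) (s i) (\<gamma> i) (\<theta> i)" for i
  define ct' where "ct' i = domain_patch.cut_grad \<Omega> i (r i) (k i) (s i) (\<gamma> i) (\<theta> i) (\<Theta> i)" for i
  have ct: "C1_with_grad UNIV (ct i n) (ct' i n)" if "i \<in> I" for i n
    unfolding ct_def ct'_def by (rule domain_patch.C1_cut[OF dp[OF that] I(3)[OF that] K[OF that]])
  have ct_supp: "\<exists>L. compact L \<and> L \<subseteq> \<Omega> \<and> (\<forall>x. x \<notin> L \<longrightarrow> ct i n x = 0)" if "i \<in> I" for i n
    unfolding ct_def by (rule domain_patch.cut_support[OF dp[OF that] I(3)[OF that] K[OF that]])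
  have ct_bd: "0 \<le> ct i n x" "ct i n x \<le> \<theta> i x" if "i \<in> I" for i n x
    unfolding ct_def
    using domain_patch.cut_bounds[OF dp[OF that], of "\<theta> i"] I(4)[OF that] by auto
  have ct_lim: "(\<lambda>n. ct i n x) \<longlonglongrightarrow> \<theta> i x" if "i \<in> I" "x \<in> \<Omega>" for i x
    unfolding ct_def
    by (rule domain_patch.cut_tendsto[OF dp[OF that(1)] that(2)]) (use K[OF that(1)] in blast)
  define \<zeta> where "\<zeta> n x = (\<Sum>i\<in>I. ct i n x)" for n x
  define Z where "Z n x = (\<Sum>i\<in>I. ct' i n x)" for n x
  have \<zeta>: "C1_with_grad UNIV (\<zeta> n) (Z n)" for n
    unfolding \<zeta>_def[abs_def] Z_def[abs_def] by (rule C1_with_grad_sum) (rule ct)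
  moreover have "\<exists>L. compact L \<and> L \<subseteq> \<Omega> \<and> (\<forall>x. x \<notin> L \<longrightarrow> \<zeta> n x = 0)" for n
  proof -
    have "\<forall>i\<in>I. \<exists>L. compact L \<and> L \<subseteq> \<Omega> \<and> (\<forall>x. x \<notin> L \<longrightarrow> ct i n x = 0)" using ct_supp by blast
    from bchoice[OF this] obtain L where L: "\<forall>i\<in>I. compact (L i) \<and> L i \<subseteq> \<Omega> \<and> (\<forall>x. x \<notin> L i \<longrightarrow> ct i n x = 0)" ..
    have "compact (\<Union>i\<in>I. L i)" using L I(1) by (intro compact_UN) auto
    moreover have "(\<Union>i\<in>I. L i) \<subseteq> \<Omega>" using L by blast
    moreover have "\<zeta> n x = 0" if "x \<notin> (\<Union>i\<in>I. L i)" for x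
      unfolding \<zeta>_def using L that by (intro sum.neutral) blast
    ultimately show ?thesis by blast
  qed
  moreover have "0 \<le> \<zeta> n x" for n x
    unfolding \<zeta>_def by (intro sum_nonneg ct_bd)
  moreover have "\<zeta> n x \<le> 1" for n x
    using sum_mono[of I "\<lambda>i. ct i n x" "\<lambda>i. \<theta> i x"] ct_bd(2) I(6)[of x] by (simp add: \<zeta>_def)
  moreover have "(\<lambda>n. \<zeta> n x) \<longlonglongrightarrow> 1" if "x \<in> \<Omega>" for x
  proof -
    have "(\<lambda>n. \<zeta> n x) \<longlonglongrightarrow> (\<Sum>i\<in>I. \<theta> i x)"
      unfolding \<zeta>_def by (intro tendsto_sum ct_lim that)
    then show ?thesis using I(7)[OF subsetD[OF closure_subset that]] by simp
  qed
  moreover have "(\<lambda>n. LINT x:\<Omega>|lborel. G x * (Z n x \<bullet> e)) \<longlonglongrightarrow> - (LINT x:?S|\<sigma>. G x * (\<nu> x \<bullet> e))"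
    if G: "continuous_on (closure \<Omega>) G" for G e
  proof -
    have GS: "continuous_on ?S G" using G by (rule continuous_on_subset) (auto simp: frontier_def)
    have \<theta>c: "continuous_on S (\<theta> i)" "continuous_on S (\<Theta> i)" if "i \<in> I" for i S
      using C1_with_grad_UNIV_continuous[OF I(3)[OF that]] by auto
    have surf: "(LINT x:?S|graph_measure i (r i) (k i) (\<gamma> i). G x * \<theta> i x * (graph_normal (k i) (s i) (\<gamma> i) x \<bullet> e))
        = (LINT x:?S|\<sigma>. G x * \<theta> i x * (\<nu> x \<bullet> e))" if i: "i \<in> I" for i
    proof -
      have p: "graph_patch \<Omega> i (r i) (k i) (s i) (\<gamma> i)" using gp I(2) i by auto
      have z: "\<theta> i x = 0" if "x \<notin> ball i (r i)" for x
        using K(2,3)[OF i] that by blast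
      have "(LINT x:?S|graph_measure i (r i) (k i) (\<gamma> i). G x * \<theta> i x * (graph_normal (k i) (s i) (\<gamma> i) x \<bullet> e))
          = (LINT x:?S|graph_measure i (r i) (k i) (\<gamma> i). G x * \<theta> i x * (\<nu> x \<bullet> e))"
        unfolding set_lebesgue_integral_def
      proof (rule Bochner_Integration.integral_cong[OF refl])
        fix x
        show "indicator ?S x *\<^sub>R (G x * \<theta> i x * (graph_normal (k i) (s i) (\<gamma> i) x \<bullet> e))
            = indicator ?S x *\<^sub>R (G x * \<theta> i x * (\<nu> x \<bullet> e))"
          using outer_normal_patch[OF p, of x] z[of x]
          by (cases "x \<in> ?S"; cases "x \<in> ball i (r i)") (simp_all del: mem_ball)
      qed
      also have "\<dots> = (LINT x:?S|\<sigma>. G x * \<theta> i x * (\<nu> x \<bullet> e))"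
        by (rule surface_integral_patch[OF p, symmetric])
          (use z in \<open>auto intro!: continuous_intros GS \<theta>c[OF i] continuous_on_outer_normal simp del: mem_ball\<close>)
      finally show ?thesis .
    qed
    have iZ: "set_integrable lborel \<Omega> (\<lambda>x. G x * (ct' i n x \<bullet> e))" if "i \<in> I" for i n
      using C1_with_grad_UNIV_continuous(2)[OF ct[OF that]]
      by (intro set_integrable_continuous_closure open_\<Omega> bounded_\<Omega> continuous_intros G) auto
    have i\<Theta>: "set_integrable lborel \<Omega> (\<lambda>x. G x * (\<Theta> i x \<bullet> e))" if "i \<in> I" for i
      by (intro set_integrable_continuous_closure open_\<Omega> bounded_\<Omega> continuous_intros G \<theta>c[OF that])
    have i\<sigma>: "set_integrable \<sigma> ?S (\<lambda>x. G x * \<theta> i x * (\<nu> x \<bullet> e))" if "i \<in> I" for i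
      by (intro \<sigma>_set_integrable continuous_intros GS \<theta>c[OF that] continuous_on_outer_normal)
    have "(\<lambda>n. \<Sum>i\<in>I. LINT x:\<Omega>|lborel. G x * (ct' i n x \<bullet> e)) \<longlonglongrightarrow>
        (\<Sum>i\<in>I. (LINT x:\<Omega>|lborel. G x * (\<Theta> i x \<bullet> e)) - (LINT x:?S|\<sigma>. G x * \<theta> i x * (\<nu> x \<bullet> e)))"
    proof (rule tendsto_sum)
      fix i assume i: "i \<in> I"
      from domain_patch.cut_grad_integral_tendsto[OF dp[OF i] I(3)[OF i] K[OF i] G]
      show "(\<lambda>n. LINT x:\<Omega>|lborel. G x * (ct' i n x \<bullet> e)) \<longlonglongrightarrow>
          (LINT x:\<Omega>|lborel. G x * (\<Theta> i x \<bullet> e)) - (LINT x:?S|\<sigma>. G x * \<theta> i x * (\<nu> x \<bullet> e))"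
        unfolding ct'_def surf[OF i, symmetric] by blast
    qed
    moreover have "(\<Sum>i\<in>I. LINT x:\<Omega>|lborel. G x * (ct' i n x \<bullet> e)) = (LINT x:\<Omega>|lborel. G x * (Z n x \<bullet> e))" for n
      unfolding set_lebesgue_integral_def
      by (subst Bochner_Integration.integral_sum[symmetric])
        (use iZ in \<open>auto simp: Z_def inner_sum_left sum_distrib_left set_integrable_def\<close>)
    moreover have "(\<Sum>i\<in>I. LINT x:\<Omega>|lborel. G x * (\<Theta> i x \<bullet> e)) = 0"
    proof -
      have \<Theta>0: "(\<Sum>i\<in>I. \<Theta> i x) = 0" if "x \<in> \<Omega>" for x
      proof -
        have d: "C1_with_grad UNIV (\<lambda>x. (\<Sum>i\<in>I. \<theta> i x) - 1) (\<lambda>x. (\<Sum>i\<in>I. \<Theta> i x) - 0)"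
          by (intro C1_with_grad_diff C1_with_grad_sum I(3) C1_with_grad_const)
        have "(\<Sum>i\<in>I. \<theta> i y) - 1 = 0" if "y \<in> \<Omega>" for y
          using I(7)[OF subsetD[OF closure_subset that]] by simp
        from C1_with_grad_eq_0[OF d open_\<Omega> that UNIV_I this]
        have "(\<Sum>i\<in>I. \<Theta> i x) - 0 = 0" .
        then show ?thesis by simp
      qed
      have "(\<Sum>i\<in>I. LINT x:\<Omega>|lborel. G x * (\<Theta> i x \<bullet> e)) = (LINT x|lborel. (\<Sum>i\<in>I. indicator \<Omega> x *\<^sub>R (G x * (\<Theta> i x \<bullet> e))))"
        unfolding set_lebesgue_integral_def
        by (rule Bochner_Integration.integral_sum[symmetric]) (use i\<Theta> in \<open>auto simp: set_integrable_def\<close>)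
      also have "\<dots> = (LINT x|lborel. indicator \<Omega> x *\<^sub>R (G x * ((\<Sum>i\<in>I. \<Theta> i x) \<bullet> e)))"
        by (simp add: inner_sum_left sum_distrib_left)
      also have "\<dots> = (LINT x|(lborel :: (real^'n) measure). 0)"
        by (intro Bochner_Integration.integral_cong refl) (auto simp: indicator_def \<Theta>0)
      finally show ?thesis by simp
    qed
    moreover have "(\<Sum>i\<in>I. LINT x:?S|\<sigma>. G x * \<theta> i x * (\<nu> x \<bullet> e)) = (LINT x:?S|\<sigma>. G x * (\<nu> x \<bullet> e))"
    proof -
      have "(\<Sum>i\<in>I. LINT x:?S|\<sigma>. G x * \<theta> i x * (\<nu> x \<bullet> e))
          = (LINT x|\<sigma>. (\<Sum>i\<in>I. indicator ?S x *\<^sub>R (G x * \<theta> i x * (\<nu> x \<bullet> e))))"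
        unfolding set_lebesgue_integral_def
        by (rule Bochner_Integration.integral_sum[symmetric]) (use i\<sigma> in \<open>auto simp: set_integrable_def\<close>)
      also have "\<dots> = (LINT x|\<sigma>. indicator ?S x *\<^sub>R (G x * (\<Sum>i\<in>I. \<theta> i x) * (\<nu> x \<bullet> e)))"
        by (simp add: sum_distrib_left sum_distrib_right)
      also have "\<dots> = (LINT x:?S|\<sigma>. G x * (\<nu> x \<bullet> e))"
        unfolding set_lebesgue_integral_def
        by (intro Bochner_Integration.integral_cong refl) (auto simp: indicator_def I(7) frontier_def)
      finally show ?thesis .
    qed
    ultimately show ?thesis by (simp add: sum_subtractf)
  qed
  ultimately show ?thesis by (rule that)
qed

lemma cutoff_integral_tendsto:
  fixes w :: "real^'n \<Rightarrow> real"
  assumes \<zeta>: "\<And>n. C1_with_grad UNIV (\<zeta> n) (Z n)" "\<And>n x. 0 \<le> \<zeta> n x" "\<And>n x. \<zeta> n x \<le> 1"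
      "\<And>x. x \<in> \<Omega> \<Longrightarrow> (\<lambda>n. \<zeta> n x) \<longlonglongrightarrow> 1"
    and w: "continuous_on (closure \<Omega>) w"
  shows "(\<lambda>n. LINT x:\<Omega>|lborel. \<zeta> n x * w x) \<longlonglongrightarrow> (LINT x:\<Omega>|lborel. w x)"
  unfolding set_lebesgue_integral_def
proof (rule integral_dominated_convergence[where w="\<lambda>x. norm (indicator \<Omega> x *\<^sub>R w x)"])
  have w_int: "integrable lborel (\<lambda>x. indicator \<Omega> x *\<^sub>R w x)"
    using set_integrable_continuous_closure[OF open_\<Omega> bounded_\<Omega> w] by (simp add: set_integrable_def)
  then show "(\<lambda>x. indicator \<Omega> x *\<^sub>R w x) \<in> borel_measurable lborel"
    "integrable lborel (\<lambda>x. norm (indicator \<Omega> x *\<^sub>R w x))" by (auto simp del: norm_scaleR)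
  show "(\<lambda>x. indicator \<Omega> x *\<^sub>R (\<zeta> n x * w x)) \<in> borel_measurable lborel" for n
    using set_integrable_continuous_closure[OF open_\<Omega> bounded_\<Omega>
        continuous_on_mult[OF C1_with_grad_UNIV_continuous(1)[OF \<zeta>(1)] w], of n]
    unfolding set_integrable_def by (rule borel_measurable_integrable)
  show "AE x in lborel. norm (indicator \<Omega> x *\<^sub>R (\<zeta> n x * w x)) \<le> norm (indicator \<Omega> x *\<^sub>R w x)" for n
    using \<zeta>(2,3)[of n] by (auto simp: indicator_def abs_mult mult_left_le_one_le)
  show "AE x in lborel. (\<lambda>n. indicator \<Omega> x *\<^sub>R (\<zeta> n x * w x)) \<longlonglongrightarrow> indicator \<Omega> x *\<^sub>R w x"
  proof (rule AE_I2)
    fix x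
    show "(\<lambda>n. indicator \<Omega> x *\<^sub>R (\<zeta> n x * w x)) \<longlonglongrightarrow> indicator \<Omega> x *\<^sub>R w x"
    proof (cases "x \<in> \<Omega>")
      case True
      from tendsto_mult[OF \<zeta>(4)[OF True] tendsto_const[of "w x"]] show ?thesis using True by simp
    qed simp
  qed
qed

lemma interior_integrable:
  fixes w :: "real^'n \<Rightarrow> real"
  shows "continuous_on (closure \<Omega>) w \<Longrightarrow> set_integrable lborel \<Omega> w"
  by (rule set_integrable_continuous_closure[OF open_\<Omega> bounded_\<Omega>])

text \<open>The product of \<open>g\<close> with the cutoff \<open>\<zeta> n\<close> has compact
  support, so its gradient integrates to zero. One summand tends to the volume integral, the other
  to minus the surface integral.\<close>

theorem divergence_theorem:
  assumes g: "C1_with_grad \<Omega> g G"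
  shows "(LINT x:\<Omega>|lborel. G x \<bullet> e) = (LINT x:frontier \<Omega>|\<sigma>. g x * (\<nu> x \<bullet> e))"
proof -
  obtain \<zeta> :: "nat \<Rightarrow> real^'n \<Rightarrow> real" and Z where \<zeta>:
    "\<And>n. C1_with_grad UNIV (\<zeta> n) (Z n)"
    "\<And>n. \<exists>L. compact L \<and> L \<subseteq> \<Omega> \<and> (\<forall>x. x \<notin> L \<longrightarrow> \<zeta> n x = 0)"
    "\<And>n x. 0 \<le> \<zeta> n x" "\<And>n x. \<zeta> n x \<le> 1"
    "\<And>x. x \<in> \<Omega> \<Longrightarrow> (\<lambda>n. \<zeta> n x) \<longlonglongrightarrow> 1"
    "\<And>G e. continuous_on (closure \<Omega>) G \<Longrightarrow>
      (\<lambda>n. LINT x:\<Omega>|lborel. G x * (Z n x \<bullet> e)) \<longlonglongrightarrow> - (LINT x:frontier \<Omega>|\<sigma>. G x * (\<nu> x \<bullet> e))"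
    by (rule surface_cutoff) (rule that)
  note gc = C1_with_gradD(1,2)[OF g] and \<zeta>c = C1_with_grad_UNIV_continuous[OF \<zeta>(1)]
  have e: "(LINT x:\<Omega>|lborel. \<zeta> n x * (G x \<bullet> e)) + (LINT x:\<Omega>|lborel. g x * (Z n x \<bullet> e)) = 0" for n
  proof -
    obtain L where L: "compact L" "L \<subseteq> \<Omega>" "\<And>x. x \<notin> L \<Longrightarrow> \<zeta> n x = 0" using \<zeta>(2)[of n] by blast
    have "(LINT x:\<Omega>|lborel. (\<zeta> n x *\<^sub>R G x + g x *\<^sub>R Z n x) \<bullet> e) = 0"
      by (rule set_integral_gradient_cutoff[OF open_\<Omega> \<zeta>(1) L g])
    moreover have "set_integrable lborel \<Omega> (\<lambda>x. \<zeta> n x * (G x \<bullet> e))" "set_integrable lborel \<Omega> (\<lambda>x. g x * (Z n x \<bullet> e))"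
      by (intro interior_integrable continuous_intros gc \<zeta>c)+
    ultimately show ?thesis by (simp add: inner_add_left set_integral_add)
  qed
  have "(\<lambda>n. (LINT x:\<Omega>|lborel. \<zeta> n x * (G x \<bullet> e)) + (LINT x:\<Omega>|lborel. g x * (Z n x \<bullet> e)))
      \<longlonglongrightarrow> (LINT x:\<Omega>|lborel. G x \<bullet> e) + - (LINT x:frontier \<Omega>|\<sigma>. g x * (\<nu> x \<bullet> e))"
    by (intro tendsto_add cutoff_integral_tendsto[OF \<zeta>(1,3,4,5)] \<zeta>(6) gc continuous_intros)
  then show ?thesis unfolding e by (simp add: LIMSEQ_const_iff)
qed

text \<open>For \<open>\<zeta> n\<close> times \<open>X\<close> the swap of directions is exact, and
  in the limit the gradient of the cutoff leaves the boundary term. There \<open>\<psi>\<close> is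
  differentiated along \<open>(\<nu> \<bullet> d) e - (\<nu> \<bullet> e) d\<close>, which is
  orthogonal to \<open>\<nu>\<close>, hence tangential.\<close>

theorem tangential_divergence_theorem:
  assumes X: "C1_with_grad \<Omega> X X'" and \<psi>: "C1_with_grad \<Omega> \<psi> \<psi>'"
  shows "(LINT x:\<Omega>|lborel. (X' x \<bullet> d) * (\<psi>' x \<bullet> e)) - (LINT x:\<Omega>|lborel. (X' x \<bullet> e) * (\<psi>' x \<bullet> d))
    = (LINT x:frontier \<Omega>|\<sigma>. X x * ((\<psi>' x \<bullet> e) * (\<nu> x \<bullet> d) - (\<psi>' x \<bullet> d) * (\<nu> x \<bullet> e)))"
proof -
  obtain \<zeta> :: "nat \<Rightarrow> real^'n \<Rightarrow> real" and Z where \<zeta>: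
    "\<And>n. C1_with_grad UNIV (\<zeta> n) (Z n)"
    "\<And>n. \<exists>L. compact L \<and> L \<subseteq> \<Omega> \<and> (\<forall>x. x \<notin> L \<longrightarrow> \<zeta> n x = 0)"
    "\<And>n x. 0 \<le> \<zeta> n x" "\<And>n x. \<zeta> n x \<le> 1"
    "\<And>x. x \<in> \<Omega> \<Longrightarrow> (\<lambda>n. \<zeta> n x) \<longlonglongrightarrow> 1"
    "\<And>G e. continuous_on (closure \<Omega>) G \<Longrightarrow>
      (\<lambda>n. LINT x:\<Omega>|lborel. G x * (Z n x \<bullet> e)) \<longlonglongrightarrow> - (LINT x:frontier \<Omega>|\<sigma>. G x * (\<nu> x \<bullet> e))"
    by (rule surface_cutoff) (rule that)
  note c = C1_with_gradD(1,2)[OF X] C1_with_gradD(1,2)[OF \<psi>] and \<zeta>c = C1_with_grad_UNIV_continuous[OF \<zeta>(1)]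
  let ?I = "\<lambda>n d e. (LINT x:\<Omega>|lborel. \<zeta> n x * ((X' x \<bullet> d) * (\<psi>' x \<bullet> e)))
      + (LINT x:\<Omega>|lborel. X x * (\<psi>' x \<bullet> e) * (Z n x \<bullet> d))"
  have split: "(LINT x:\<Omega>|lborel. ((\<zeta> n x *\<^sub>R X' x + X x *\<^sub>R Z n x) \<bullet> d) * (\<psi>' x \<bullet> e)) = ?I n d e" for n d e
  proof -
    have "set_integrable lborel \<Omega> (\<lambda>x. \<zeta> n x * ((X' x \<bullet> d) * (\<psi>' x \<bullet> e)))"
      "set_integrable lborel \<Omega> (\<lambda>x. X x * (\<psi>' x \<bullet> e) * (Z n x \<bullet> d))"
      by (intro interior_integrable continuous_intros c \<zeta>c)+
    from set_integral_add(2)[OF this, symmetric] show ?thesis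
      by (simp add: inner_add_left algebra_simps)
  qed
  have e: "?I n d e = ?I n e d" for n
  proof -
    obtain L where L: "compact L" "L \<subseteq> \<Omega>" "\<And>x. x \<notin> L \<Longrightarrow> \<zeta> n x = 0" using \<zeta>(2)[of n] by blast
    let ?Y = "\<lambda>x. if x \<in> \<Omega> then \<zeta> n x * X x else 0" and ?Y' = "\<lambda>x. if x \<in> \<Omega> then \<zeta> n x *\<^sub>R X' x + X x *\<^sub>R Z n x else 0"
    have Y: "C1_with_grad UNIV ?Y ?Y'"
      by (rule C1_with_grad_mult_cutoff[OF open_\<Omega> \<zeta>(1) L X])
    have "(LINT x:\<Omega>|lborel. (?Y' x \<bullet> d) * (\<psi>' x \<bullet> e)) = (LINT x:\<Omega>|lborel. (?Y' x \<bullet> e) * (\<psi>' x \<bullet> d))"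
      by (rule set_integral_gradients_swap[OF open_\<Omega> Y L(1,2) _ \<psi>]) (use L(3) in auto)
    moreover have "(LINT x:\<Omega>|lborel. (?Y' x \<bullet> d) * (\<psi>' x \<bullet> e)) = (LINT x:\<Omega>|lborel. ((\<zeta> n x *\<^sub>R X' x + X x *\<^sub>R Z n x) \<bullet> d) * (\<psi>' x \<bullet> e))" for d e
      unfolding set_lebesgue_integral_def
      by (intro Bochner_Integration.integral_cong refl) (auto simp: indicator_def)
    ultimately show ?thesis unfolding split[symmetric] by simp
  qed
  have lim: "(\<lambda>n. ?I n d e) \<longlonglongrightarrow> (LINT x:\<Omega>|lborel. (X' x \<bullet> d) * (\<psi>' x \<bullet> e))
      + - (LINT x:frontier \<Omega>|\<sigma>. X x * (\<psi>' x \<bullet> e) * (\<nu> x \<bullet> d))" for d e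
    by (intro tendsto_add cutoff_integral_tendsto[OF \<zeta>(1,3,4,5)] \<zeta>(6) c continuous_intros)
  have "(LINT x:\<Omega>|lborel. (X' x \<bullet> d) * (\<psi>' x \<bullet> e)) + - (LINT x:frontier \<Omega>|\<sigma>. X x * (\<psi>' x \<bullet> e) * (\<nu> x \<bullet> d))
      = (LINT x:\<Omega>|lborel. (X' x \<bullet> e) * (\<psi>' x \<bullet> d)) + - (LINT x:frontier \<Omega>|\<sigma>. X x * (\<psi>' x \<bullet> d) * (\<nu> x \<bullet> e))"
    using LIMSEQ_unique[OF lim[of d e] lim[of e d, folded e]] .
  moreover have "(LINT x:frontier \<Omega>|\<sigma>. X x * (\<psi>' x \<bullet> e) * (\<nu> x \<bullet> d)) - (LINT x:frontier \<Omega>|\<sigma>. X x * (\<psi>' x \<bullet> d) * (\<nu> x \<bullet> e))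
      = (LINT x:frontier \<Omega>|\<sigma>. X x * ((\<psi>' x \<bullet> e) * (\<nu> x \<bullet> d) - (\<psi>' x \<bullet> d) * (\<nu> x \<bullet> e)))"
  proof -
    have sub: "frontier \<Omega> \<subseteq> closure \<Omega>" by (auto simp: frontier_def)
    have "set_integrable \<sigma> (frontier \<Omega>) (\<lambda>x. X x * (\<psi>' x \<bullet> e) * (\<nu> x \<bullet> d))"
      "set_integrable \<sigma> (frontier \<Omega>) (\<lambda>x. X x * (\<psi>' x \<bullet> d) * (\<nu> x \<bullet> e))"
      by (intro \<sigma>_set_integrable continuous_intros continuous_on_outer_normal c[THEN continuous_on_subset[OF _ sub]])+
    from set_integral_diff(2)[OF this, symmetric] show ?thesis by (simp add: algebra_simps)
  qed
  ultimately show ?thesis by linarith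
qed

text \<open>Schwarz's theorem in weak form: the swap of directions shows that mixed derivatives
  agree when tested, continuity makes this pointwise in \<open>\<Omega>\<close> and carries it to
  the closure.\<close>

lemma second_derivatives_symmetric:
  assumes g: "C1_with_grad \<Omega> g G" and G: "\<And>i. C1_with_grad \<Omega> (\<lambda>x. G x $ i) (H i)" and x: "x \<in> closure \<Omega>"
  shows "H i x $ j = H j x $ i"
proof -
  have c: "continuous_on (closure \<Omega>) (\<lambda>x. H i x $ j - H j x $ i)" for i j
    using C1_with_gradD(2)[OF G] by (intro continuous_intros)
  have \<Omega>0: "H i x $ j - H j x $ i = 0" if "x \<in> \<Omega>" for x
  proof (rule continuous_eq_0_if_integral_test_0[OF open_\<Omega> _ _ that])
    show "continuous_on \<Omega> (\<lambda>x. H i x $ j - H j x $ i)"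
      by (rule continuous_on_subset[OF c closure_subset])
    fix \<theta> \<Theta> K
    assume \<theta>: "C1_with_grad UNIV \<theta> \<Theta>" "compact K" "K \<subseteq> \<Omega>" "\<And>x. x \<notin> K \<Longrightarrow> \<theta> x = 0"
    have "(LINT x:\<Omega>|lborel. \<theta> x * H i x $ j) = - (LINT x:\<Omega>|lborel. (\<Theta> x \<bullet> axis j 1) * (G x \<bullet> axis i 1))" for i j
    proof -
      have "(LINT x:\<Omega>|lborel. (\<theta> x *\<^sub>R H i x + (G x $ i) *\<^sub>R \<Theta> x) \<bullet> axis j 1) = 0"
        by (rule set_integral_gradient_cutoff[OF open_\<Omega> \<theta> G])
      moreover have "set_integrable lborel \<Omega> (\<lambda>x. \<theta> x * H i x $ j)" "set_integrable lborel \<Omega> (\<lambda>x. (\<Theta> x \<bullet> axis j 1) * (G x \<bullet> axis i 1))"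
        by (intro interior_integrable continuous_intros C1_with_grad_UNIV_continuous[OF \<theta>(1)]
            C1_with_gradD(2)[OF G] C1_with_gradD(2)[OF g])+
      ultimately show ?thesis
        by (simp add: inner_add_left inner_axis set_integral_add mult.commute)
    qed
    moreover have "(LINT x:\<Omega>|lborel. (\<Theta> x \<bullet> axis j 1) * (G x \<bullet> axis i 1)) = (LINT x:\<Omega>|lborel. (\<Theta> x \<bullet> axis i 1) * (G x \<bullet> axis j 1))"
      by (rule set_integral_gradients_swap[OF open_\<Omega> \<theta> g])
    ultimately have "(LINT x:\<Omega>|lborel. \<theta> x * H i x $ j) - (LINT x:\<Omega>|lborel. \<theta> x * H j x $ i) = 0" by simp
    moreover have "set_integrable lborel \<Omega> (\<lambda>x. \<theta> x * H i x $ j)" for i j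
      by (intro interior_integrable continuous_intros C1_with_grad_UNIV_continuous[OF \<theta>(1)] C1_with_gradD(2)[OF G])
    ultimately show "(LINT x:\<Omega>|lborel. (H i x $ j - H j x $ i) * \<theta> x) = 0"
      using set_integral_diff(2)[of lborel \<Omega> "\<lambda>x. \<theta> x * H i x $ j" "\<lambda>x. \<theta> x * H j x $ i"]
      by (simp add: algebra_simps)
  qed
  have "H i x $ j - H j x $ i = 0"
    by (rule continuous_constant_on_closure[OF c \<Omega>0 x])
  then show ?thesis by simp
qed

end

subsection \<open>The coefficient matrix\<close>

lemma C1_differentiable_on_deriv:
  fixes f :: "real \<Rightarrow> real"
  assumes "f C1_differentiable_on S"
  shows "\<And>x. x \<in> S \<Longrightarrow> (f has_real_derivative deriv f x) (at x)" "continuous_on S (deriv f)"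
    "continuous_on S f"
proof -
  obtain D where D: "\<And>x. x \<in> S \<Longrightarrow> (f has_vector_derivative D x) (at x)" "continuous_on S D"
    using assms by (auto simp: C1_differentiable_on_def)
  then have d: "deriv f x = D x" if "x \<in> S" for x
    using that by (simp add: DERIV_imp_deriv has_real_derivative_iff_has_vector_derivative)
  then show df: "(f has_real_derivative deriv f x) (at x)" if "x \<in> S" for x
    using D(1)[OF that] that by (simp add: has_real_derivative_iff_has_vector_derivative)
  show "continuous_on S (deriv f)"
    using D(2) d by (metis continuous_on_eq)
  show "continuous_on S f"
    by (rule continuous_at_imp_continuous_on) (use df DERIV_isCont in blast)
qed

lemma A_mat_mult:
  assumes "\<xi> \<noteq> 0"
  shows "A_mat a \<xi> *v v = a (norm \<xi>) *\<^sub>R v + (deriv a (norm \<xi>) / norm \<xi> * (\<xi> \<bullet> v)) *\<^sub>R \<xi>"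
proof -
  have "(A_mat a \<xi> *v v) $ h = a (norm \<xi>) * v $ h + deriv a (norm \<xi>) / norm \<xi> * (\<xi> \<bullet> v) * \<xi> $ h" for h
  proof -
    have "(A_mat a \<xi> *v v) $ h = (\<Sum>k\<in>UNIV. (deriv a (norm \<xi>) / norm \<xi> * \<xi> $ h * \<xi> $ k
        + a (norm \<xi>) * (if h = k then 1 else 0)) * v $ k)"
      using assms by (simp add: A_mat_def matrix_vector_mult_def)
    also have "\<dots> = (\<Sum>k\<in>UNIV. (deriv a (norm \<xi>) / norm \<xi> * \<xi> $ h) * (\<xi> $ k * v $ k)
        + (if h = k then a (norm \<xi>) * v $ k else 0))"
      by (intro sum.cong refl) (auto simp: algebra_simps)
    also have "\<dots> = (deriv a (norm \<xi>) / norm \<xi> * \<xi> $ h) * (\<xi> \<bullet> v) + a (norm \<xi>) * v $ h"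
      by (simp add: sum.distrib inner_vec_def sum_distrib_left)
    finally show ?thesis by (simp add: algebra_simps)
  qed
  then show ?thesis by (simp add: vec_eq_iff)
qed

lemma A_mat_0_mult: "A_mat a 0 *v v = a 0 *\<^sub>R v"
  by (simp add: A_mat_def flip: scaleR_matrix_vector_assoc)

lemma A_mat_sym: "A_mat a \<xi> $ i $ j = A_mat a \<xi> $ j $ i"
  by (simp add: A_mat_def mat_def mult.commute mult.left_commute)

text \<open>\<open>A_mat\<close> is the Jacobian of the flux. Away from zero this is the chain rule;
  at zero the remainder divided by \<open>norm y\<close> is the difference of
  \<open>a (norm y)\<close> and \<open>a 0\<close>, so continuity of \<open>a\<close>
  suffices.\<close>

lemma flux_has_derivative:
  fixes \<xi> :: "real^'n"
  assumes a: "C11_loc_pos a" and \<xi>: "\<xi> \<noteq> 0 \<or> cond_A2 a"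
  shows "((\<lambda>\<xi>. a (norm \<xi>) *\<^sub>R \<xi>) has_derivative (\<lambda>v. A_mat a \<xi> *v v)) (at \<xi>)"
proof (cases "\<xi> = 0")
  case False
  have "(a has_real_derivative deriv a (norm \<xi>)) (at (norm \<xi>))"
    using C1_differentiable_on_deriv(1)[of a "{0<..}"] a False by (simp add: C11_loc_pos_def)
  then have "(a has_derivative (\<lambda>t. deriv a (norm \<xi>) * t)) (at (norm \<xi>))"
    by (simp add: has_field_derivative_def)
  from has_derivative_compose[OF has_derivative_norm[OF False] this]
  have "((\<lambda>\<xi>. a (norm \<xi>)) has_derivative (\<lambda>v. deriv a (norm \<xi>) * (v \<bullet> sgn \<xi>))) (at \<xi>)"
    by (simp add: inner_commute)
  from has_derivative_scaleR[OF this has_derivative_ident]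
  have "((\<lambda>\<xi>. a (norm \<xi>) *\<^sub>R \<xi>) has_derivative
      (\<lambda>v. a (norm \<xi>) *\<^sub>R v + (deriv a (norm \<xi>) * (v \<bullet> sgn \<xi>)) *\<^sub>R \<xi>)) (at \<xi>)" .
  moreover have "A_mat a \<xi> *v v = a (norm \<xi>) *\<^sub>R v + (deriv a (norm \<xi>) * (v \<bullet> sgn \<xi>)) *\<^sub>R \<xi>" for v
    unfolding A_mat_mult[OF False] by (simp add: sgn_div_norm inner_commute field_simps)
  ultimately show ?thesis by simp
next
  case True
  then have "continuous_on {0..} a" using \<xi> by (simp add: cond_A2_def)
  then have "continuous_on UNIV (\<lambda>y :: real^'n. a (norm y))"
    by (intro continuous_on_compose2[of "{0..}" a UNIV norm] continuous_intros) auto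
  then have "((\<lambda>y :: real^'n. a (norm y)) \<longlongrightarrow> a (norm (0 :: real^'n))) (at 0)"
    unfolding continuous_on_def by blast
  then have l: "((\<lambda>y :: real^'n. norm (a (norm y) - a 0)) \<longlongrightarrow> 0) (at 0)"
    by (simp add: LIM_zero_iff tendsto_norm_zero_iff del: real_norm_def)
  have "((\<lambda>y :: real^'n. norm (a (norm y) *\<^sub>R y - a (norm (0 :: real^'n)) *\<^sub>R 0 - a 0 *\<^sub>R (y - 0)) / norm (y - 0)) \<longlongrightarrow> 0) (at 0)"
  proof (rule Lim_transform_eventually[OF l])
    show "\<forall>\<^sub>F y :: real^'n in at 0. norm (a (norm y) - a 0)
        = norm (a (norm y) *\<^sub>R y - a (norm (0 :: real^'n)) *\<^sub>R 0 - a 0 *\<^sub>R (y - 0)) / norm (y - 0)"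
      unfolding eventually_at_filter
      by (rule always_eventually) (auto simp flip: scaleR_diff_left)
  qed
  then have "((\<lambda>\<xi> :: real^'n. a (norm \<xi>) *\<^sub>R \<xi>) has_derivative (\<lambda>v. a 0 *\<^sub>R v)) (at 0)"
    unfolding has_derivative_iff_norm by (auto intro: bounded_linear_scaleR_right)
  then show ?thesis using True by (simp add: A_mat_0_mult)
qed

text \<open>\<open>E\<close> is the derivative of \<open>t * a t\<close> minus \<open>a t\<close>.
  Both terms equal \<open>a 0\<close> at zero, because the difference quotient of
  \<open>t * a t\<close> at zero is \<open>a t\<close> itself.\<close>

lemma tendsto_t_deriv:
  assumes a: "C11_loc_pos a" and A2: "cond_A2 a"
  obtains E where "continuous_on {0..} E" "E 0 = 0" "\<And>t. t > 0 \<Longrightarrow> t * deriv a t = E t"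
proof -
  obtain D where D: "continuous_on {0..} D"
    "\<And>t. t \<ge> 0 \<Longrightarrow> ((\<lambda>t. t * a t) has_real_derivative D t) (at t within {0..})"
    and ac: "continuous_on {0..} a"
    using A2 unfolding cond_A2_def by blast
  have "D t - a t = t * deriv a t" if t: "t > 0" for t
  proof -
    have at: "at t within {0..} = at t"
      by (rule at_within_interior) (use t in \<open>simp add: interior_real_atLeast\<close>)
    have "(a has_real_derivative deriv a t) (at t)"
      using C1_differentiable_on_deriv(1)[of a "{0<..}" t] a t by (simp add: C11_loc_pos_def)
    from DERIV_mult[OF DERIV_ident this]
    have "((\<lambda>t. t * a t) has_real_derivative a t + deriv a t * t) (at t)" by simp
    moreover have "((\<lambda>t. t * a t) has_real_derivative D t) (at t)"
      using D(2)[of t] t at by simp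
    ultimately have "D t = a t + deriv a t * t" by (rule DERIV_unique[rotated])
    then show ?thesis by simp
  qed
  moreover have "D 0 = a 0"
  proof -
    have "((\<lambda>t. (t * a t - 0 * a 0) / (t - 0)) \<longlongrightarrow> D 0) (at 0 within {0..})"
      using D(2)[of 0] by (simp add: has_field_derivative_iff)
    then have "(a \<longlongrightarrow> D 0) (at 0 within {0..})"
      by (rule Lim_transform_eventually) (auto simp: eventually_at_filter)
    then have "(a \<longlongrightarrow> D 0) (at_right 0)"
      by (rule tendsto_within_subset) auto
    moreover have "(a \<longlongrightarrow> a 0) (at 0 within {0..})"
      using ac by (simp add: continuous_on_def)
    then have "(a \<longlongrightarrow> a 0) (at_right 0)"
      by (rule tendsto_within_subset) auto
    ultimately show ?thesis using tendsto_unique[OF trivial_limit_at_right_real] by blast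
  qed
  ultimately show ?thesis
    using that[of "\<lambda>t. D t - a t"] D(1) ac by (auto intro: continuous_intros)
qed

lemma continuous_on_A_mat_nonzero:
  assumes a: "C11_loc_pos a"
  shows "continuous_on (- {0 :: real^'n}) (A_mat a)"
proof -
  have c: "continuous_on {0<..} a" "continuous_on {0<..} (deriv a)"
    using C1_differentiable_on_deriv[of a "{0<..}"] a by (auto simp: C11_loc_pos_def)
  have n: "continuous_on (- {0 :: real^'n}) (\<lambda>\<xi>. a (norm \<xi>))" "continuous_on (- {0 :: real^'n}) (\<lambda>\<xi>. deriv a (norm \<xi>))"
    by (rule continuous_on_compose2[OF c(1)] continuous_on_compose2[OF c(2)]; auto intro: continuous_intros)+
  have "continuous_on (- {0 :: real^'n}) (\<lambda>\<xi>. (\<chi> h k. deriv a (norm \<xi>) / norm \<xi> * \<xi> $ h * \<xi> $ k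
      + a (norm \<xi>) * (if h = k then 1 else 0)))"
    by (intro continuous_on_vec_lambda continuous_intros n) auto
  then show ?thesis
    by (rule continuous_on_eq) (simp add: A_mat_def)
qed

text \<open>Apart from the diagonal term, an entry is \<open>|\<xi>| a'(|\<xi>|)\<close> times two
  components of a unit vector, so it is bounded by a quantity that tends to zero.\<close>

lemma continuous_on_A_mat_A2:
  assumes a: "C11_loc_pos a" and A2: "cond_A2 a"
  shows "continuous_on (UNIV :: (real^'n) set) (A_mat a)"
proof -
  obtain E where E: "continuous_on {0..} E" "E 0 = 0" "\<And>t. t > 0 \<Longrightarrow> t * deriv a t = E t"
    using tendsto_t_deriv[OF a A2] by blast
  have ac: "continuous_on {0..} a" using A2 by (simp add: cond_A2_def)
  have norm_lim: "((\<lambda>\<xi> :: real^'n. g (norm \<xi>)) \<longlongrightarrow> g 0) (at 0)" if "continuous_on {0..} g" for g :: "real \<Rightarrow> real"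
  proof -
    have "continuous_on UNIV (\<lambda>\<xi> :: real^'n. g (norm \<xi>))"
      by (rule continuous_on_compose2[OF that]) (auto intro: continuous_intros)
    then show ?thesis unfolding continuous_on_def by (metis UNIV_I norm_zero)
  qed
  have entry: "((\<lambda>\<xi> :: real^'n. A_mat a \<xi> $ h $ k) \<longlongrightarrow> A_mat a 0 $ h $ k) (at 0)" for h k
  proof -
    let ?d = "if h = k then 1 else 0 :: real"
    have "((\<lambda>\<xi> :: real^'n. (A_mat a \<xi> $ h $ k - a (norm \<xi>) * ?d) + a (norm \<xi>) * ?d) \<longlongrightarrow> 0 + a 0 * ?d) (at 0)"
    proof (intro tendsto_add tendsto_mult tendsto_const norm_lim ac)
      have e0: "((\<lambda>\<xi> :: real^'n. \<bar>E (norm \<xi>)\<bar>) \<longlongrightarrow> 0) (at 0)"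
        using tendsto_rabs[OF norm_lim[OF E(1)]] E(2) by simp
      show "((\<lambda>\<xi> :: real^'n. A_mat a \<xi> $ h $ k - a (norm \<xi>) * ?d) \<longlongrightarrow> 0) (at 0)"
      proof (rule Lim_null_comparison[OF _ e0])
        have "norm (A_mat a \<xi> $ h $ k - a (norm \<xi>) * ?d) \<le> \<bar>E (norm \<xi>)\<bar>" if "\<xi> \<noteq> 0" for \<xi> :: "real^'n"
        proof -
          have n: "norm \<xi> > 0" using that by simp
          have "A_mat a \<xi> $ h $ k - a (norm \<xi>) * ?d = (norm \<xi> * deriv a (norm \<xi>)) * ((\<xi> $ h / norm \<xi>) * (\<xi> $ k / norm \<xi>))"
            using that by (simp add: A_mat_def field_simps)
          also have "\<bar>\<dots>\<bar> = \<bar>E (norm \<xi>)\<bar> * (\<bar>\<xi> $ h\<bar> / norm \<xi> * (\<bar>\<xi> $ k\<bar> / norm \<xi>))"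
            unfolding E(3)[OF n] by (simp add: abs_mult)
          also have "\<dots> \<le> \<bar>E (norm \<xi>)\<bar> * (1 * 1)"
            using n component_le_norm_cart[of \<xi>] by (intro mult_left_mono mult_mono) auto
          finally show ?thesis by simp
        qed
        then show "\<forall>\<^sub>F \<xi> :: real^'n in at 0. norm (A_mat a \<xi> $ h $ k - a (norm \<xi>) * ?d) \<le> \<bar>E (norm \<xi>)\<bar>"
          by (simp add: eventually_at_filter)
      qed
    qed
    moreover have "A_mat a (0 :: real^'n) $ h $ k = 0 + a 0 * ?d"
      by (simp add: A_mat_def mat_def)
    ultimately show ?thesis by simp
  qed
  have "isCont (A_mat a) (\<xi> :: real^'n)" for \<xi>
  proof (cases "\<xi> = 0")
    case True
    have "(A_mat a \<longlongrightarrow> A_mat a 0) (at (0 :: real^'n))"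
      by (intro vec_tendstoI entry)
    then show ?thesis using True by (simp add: isCont_def)
  next
    case False
    then show ?thesis
      using continuous_on_A_mat_nonzero[OF a] continuous_on_eq_continuous_at[of "- {0 :: real^'n}"] by auto
  qed
  then show ?thesis by (simp add: continuous_at_imp_continuous_on)
qed

text \<open>Makes the approximants of Stone-Weierstrass admissible as test functions.\<close>

lemma real_polynomial_function_C1:
  fixes g :: "real^'n \<Rightarrow> real"
  assumes "real_polynomial_function g"
  shows "\<exists>G. C1_with_grad U g G"
  using assms
proof induction
  case (linear g)
  then have lin: "linear g" by (rule bounded_linear.linear)
  have gv: "g v = (\<chi> i. g (axis i 1)) \<bullet> v" for v
  proof -
    have "g v = g (\<Sum>i\<in>UNIV. v $ i *\<^sub>R axis i 1)"
      by (simp add: basis_expansion flip: scalar_mult_eq_scaleR)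
    then show ?thesis
      by (simp add: linear_sum[OF lin] linear_cmul[OF lin] inner_vec_def mult.commute)
  qed
  have eq: "(\<lambda>v. (\<chi> i. g (axis i 1)) \<bullet> v) = g"
    by (intro ext) (rule gv[symmetric])
  have "C1_with_grad U g (\<lambda>x. \<chi> i. g (axis i 1))"
    unfolding C1_with_grad_def eq
    using bounded_linear_imp_has_derivative[OF linear] linear_continuous_on[OF linear] by auto
  then show ?case by (rule exI[where x="\<lambda>x. \<chi> i. g (axis i 1)"])
qed (auto intro: C1_with_grad_const C1_with_grad_add C1_with_grad_mult)

subsection \<open>The linearised equation\<close>

lemma set_integral_sum':
  fixes g :: "'i \<Rightarrow> 'a \<Rightarrow> real"
  assumes "\<And>i. i \<in> I \<Longrightarrow> set_integrable M S (g i)"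
  shows "(LINT x:S|M. (\<Sum>i\<in>I. g i x)) = (\<Sum>i\<in>I. LINT x:S|M. g i x)"
  using assms unfolding set_lebesgue_integral_def set_integrable_def
  by (simp only: scaleR_sum_right Bochner_Integration.integral_sum)

lemma continuous_on_matrix_vector_mult:
  fixes B :: "'a::topological_space \<Rightarrow> real^'n^'m"
  assumes "continuous_on S B" "continuous_on S w"
  shows "continuous_on S (\<lambda>x. B x *v w x)"
  unfolding matrix_vector_mult_def using assms
  by (intro continuous_on_vec_lambda continuous_intros)

locale robin_solution = smooth_domain \<Omega> for \<Omega> :: "(real^'n::finite) set" +
  fixes a f h :: "real \<Rightarrow> real" and u :: "real^'n \<Rightarrow> real"
  assumes f: "f C1_differentiable_on UNIV" and h: "h C1_differentiable_on UNIV"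
    and a: "C11_loc_pos a" and u: "Ck_closure 2 \<Omega> u" and weak: "weak_solution \<Omega> a f h u"
begin

abbreviation D where "D \<equiv> grad \<Omega> u"
abbreviation H where "H i \<equiv> grad \<Omega> (partial \<Omega> i u)"
abbreviation A where "A x \<equiv> A_mat a (D x)"

definition X where "X x = a (norm (D x)) *\<^sub>R D x"
definition X' where "X' j x = (\<Sum>l\<in>UNIV. A x $ j $ l *\<^sub>R H l x)"

lemma u_C1: "C1_with_grad \<Omega> u D"
  using u by (intro Ck_closure_1_C1_with_grad) (simp add: numeral_2_eq_2)

lemma D_C1: "C1_with_grad \<Omega> (\<lambda>x. D x $ i) (H i)"
  using u Ck_closure_1_C1_with_grad[of \<Omega> "partial \<Omega> i u"] by (simp add: numeral_2_eq_2 grad_def)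

lemma H_sym: "x \<in> closure \<Omega> \<Longrightarrow> H i x $ j = H j x $ i"
  by (rule second_derivatives_symmetric[OF u_C1 D_C1])

lemma nondegenerate:
  assumes "x \<in> closure \<Omega>"
  shows "D x \<noteq> 0 \<or> cond_A2 a"
  using weak assms by (auto simp: weak_solution_def cond_A1_def)

lemma frontier_closure: "frontier \<Omega> \<subseteq> closure \<Omega>"
  by (auto simp: frontier_def)

lemma flux_derivative:
  "x \<in> closure \<Omega> \<Longrightarrow> ((\<lambda>\<xi>. a (norm \<xi>) *\<^sub>R \<xi>) has_derivative (\<lambda>v. A x *v v)) (at (D x))"
  by (rule flux_has_derivative[OF a nondegenerate])

lemma continuous_facts:
  assumes S: "S \<subseteq> closure \<Omega>"
  shows "continuous_on S u" "continuous_on S D" "continuous_on S (H i)" "continuous_on S A" "continuous_on S X"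
    "continuous_on S (\<lambda>x. f (u x))" "continuous_on S (\<lambda>x. h (u x))"
    "continuous_on S (\<lambda>x. deriv f (u x))" "continuous_on S (\<lambda>x. deriv h (u x))"
    "continuous_on S (X' j)"
proof -
  show u: "continuous_on S u" and D: "continuous_on S D" and H: "continuous_on S (H i)" for i
    using C1_with_gradD(1,2)[OF u_C1] C1_with_gradD(2)[OF D_C1] S continuous_on_subset by blast+
  show A: "continuous_on S A"
  proof (cases "cond_A2 a")
    case True
    show ?thesis by (rule continuous_on_compose2[OF continuous_on_A_mat_A2[OF a True] D]) auto
  next
    case False
    have "D x \<noteq> 0" if "x \<in> S" for x
      using nondegenerate[OF subsetD[OF S that]] False by simp
    then have "D ` S \<subseteq> - {0}" by auto
    then show ?thesis by (rule continuous_on_compose2[OF continuous_on_A_mat_nonzero[OF a] D])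
  qed
  have "continuous_on (D ` S) (\<lambda>\<xi>. a (norm \<xi>) *\<^sub>R \<xi>)"
  proof (rule continuous_at_imp_continuous_on, rule ballI)
    fix \<xi> assume "\<xi> \<in> D ` S"
    then obtain x where x: "x \<in> S" "\<xi> = D x" by blast
    show "isCont (\<lambda>\<xi>. a (norm \<xi>) *\<^sub>R \<xi>) \<xi>"
      unfolding x(2) by (rule has_derivative_continuous[OF flux_derivative[OF subsetD[OF S x(1)]]])
  qed
  then show "continuous_on S X"
    unfolding X_def by (rule continuous_on_compose2[OF _ D]) auto
  note fc = C1_differentiable_on_deriv(2,3)[OF f] C1_differentiable_on_deriv(2,3)[OF h]
  show "continuous_on S (\<lambda>x. f (u x))" "continuous_on S (\<lambda>x. h (u x))"
    "continuous_on S (\<lambda>x. deriv f (u x))" "continuous_on S (\<lambda>x. deriv h (u x))"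
    by (rule continuous_on_compose2[OF fc(2) u] continuous_on_compose2[OF fc(4) u]
        continuous_on_compose2[OF fc(1) u] continuous_on_compose2[OF fc(3) u]; simp)+
  show "continuous_on S (X' j)"
    unfolding X'_def[abs_def] by (intro continuous_intros A H)
qed

lemma D_has_derivative:
  assumes x: "x \<in> \<Omega>"
  shows "(D has_derivative (\<lambda>v. \<chi> i. H i x \<bullet> v)) (at x)"
  unfolding has_derivative_componentwise_within[of D]
proof
  fix b :: "real^'n" assume "b \<in> Basis"
  then obtain i where b: "b = axis i 1" by (auto simp: Basis_vec_def)
  show "((\<lambda>x. D x \<bullet> b) has_derivative (\<lambda>v. (\<chi> i. H i x \<bullet> v) \<bullet> b)) (at x)"
    using C1_with_gradD(3)[OF D_C1 x, of i] by (simp add: b inner_axis)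
qed

lemma X_C1: "C1_with_grad \<Omega> (\<lambda>x. X x $ j) (X' j)"
  unfolding C1_with_grad_def
proof (intro conjI ballI)
  show "continuous_on (closure \<Omega>) (\<lambda>x. X x $ j)" "continuous_on (closure \<Omega>) (X' j)"
    by (intro continuous_intros continuous_facts subset_refl)+
  fix x assume x: "x \<in> \<Omega>"
  then have xc: "x \<in> closure \<Omega>" using closure_subset by blast
  from has_derivative_compose[OF D_has_derivative[OF x] flux_derivative[OF xc]]
  have "(X has_derivative (\<lambda>v. A x *v (\<chi> i. H i x \<bullet> v))) (at x)"
    by (simp add: X_def[abs_def])
  from bounded_linear.has_derivative[OF bounded_linear_vec_nth this, of j]
  have "((\<lambda>x. X x $ j) has_derivative (\<lambda>v. (A x *v (\<chi> i. H i x \<bullet> v)) $ j)) (at x)" .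
  moreover have "(A x *v (\<chi> i. H i x \<bullet> v)) $ j = X' j x \<bullet> v" for v
    by (simp add: matrix_vector_mult_def X'_def inner_sum_left)
  ultimately show "((\<lambda>x. X x $ j) has_derivative (\<lambda>v. X' j x \<bullet> v)) (at x)" by simp
qed

section \<open>The equation and the boundary condition recovered from the weak formulation\<close>

lemma weak_test:
  assumes \<psi>: "C1_with_grad \<Omega> \<psi> \<psi>'"
  shows "(LINT x:\<Omega>|lborel. X x \<bullet> \<psi>' x) + (LINT x:frontier \<Omega>|\<sigma>. h (u x) * \<psi> x)
    - (LINT x:\<Omega>|lborel. f (u x) * \<psi> x) = 0"
proof -
  have "grad \<Omega> \<psi> x = \<psi>' x" if "x \<in> \<Omega>" for x
    by (rule C1_with_grad_grad[OF open_\<Omega> \<psi> subsetD[OF closure_subset that]])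
  then have eq: "(LINT x:\<Omega>|lborel. a (norm (D x)) * (D x \<bullet> grad \<Omega> \<psi> x)) = (LINT x:\<Omega>|lborel. X x \<bullet> \<psi>' x)"
    using open_\<Omega> by (intro set_lebesgue_integral_cong) (auto simp: X_def)
  have ck: "Ck_closure 1 \<Omega> \<psi>"
    by (rule C1_with_grad_imp_Ck_closure_1[OF open_\<Omega> \<psi>])
  have "(LINT x:\<Omega>|lborel. a (norm (D x)) * (D x \<bullet> grad \<Omega> \<phi> x)) + (LINT x:frontier \<Omega>|\<sigma>. h (u x) * \<phi> x)
    - (LINT x:\<Omega>|lborel. f (u x) * \<phi> x) = 0" if "Ck_closure 1 \<Omega> \<phi>" for \<phi>
    using weak that unfolding weak_solution_def by blast
  from this[OF ck] show ?thesis unfolding eq .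
qed

definition div_X where "div_X x = (\<Sum>j\<in>UNIV. X' j x $ j)"

lemma div_X_continuous: "S \<subseteq> closure \<Omega> \<Longrightarrow> continuous_on S div_X"
  unfolding div_X_def[abs_def] by (intro continuous_intros continuous_facts)

text \<open>As \<open>X\<close> is \<open>C^1\<close>, the weak formulation can be integrated by
  parts, which separates it into an interior and a boundary residue.\<close>

lemma boundary_identity:
  assumes \<psi>: "C1_with_grad \<Omega> \<psi> \<psi>'"
  shows "(LINT x:frontier \<Omega>|\<sigma>. (X x \<bullet> \<nu> x + h (u x)) * \<psi> x) = (LINT x:\<Omega>|lborel. (div_X x + f (u x)) * \<psi> x)"
proof -
  note c = continuous_facts[OF subset_refl] C1_with_gradD(1,2)[OF \<psi>] div_X_continuous[OF subset_refl]
  note b = continuous_facts[OF frontier_closure] C1_with_gradD(1,2)[OF \<psi>, THEN continuous_on_subset[OF _ frontier_closure]]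
    continuous_on_outer_normal
  have j: "(LINT x:\<Omega>|lborel. X x $ j * \<psi>' x $ j + \<psi> x * X' j x $ j) = (LINT x:frontier \<Omega>|\<sigma>. X x $ j * \<psi> x * \<nu> x $ j)" for j
    using divergence_theorem[OF C1_with_grad_mult[OF X_C1 \<psi>], of j "axis j 1"] by (simp add: inner_add_left inner_axis)
  have "(LINT x:\<Omega>|lborel. X x \<bullet> \<psi>' x + div_X x * \<psi> x) = (LINT x:\<Omega>|lborel. (\<Sum>j\<in>UNIV. X x $ j * \<psi>' x $ j + \<psi> x * X' j x $ j))"
    by (simp add: sum.distrib inner_vec_def div_X_def sum_distrib_left mult.commute)
  also have "\<dots> = (\<Sum>j\<in>UNIV. LINT x:\<Omega>|lborel. X x $ j * \<psi>' x $ j + \<psi> x * X' j x $ j)"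
    by (intro set_integral_sum' interior_integrable continuous_intros c)
  also have "\<dots> = (LINT x:frontier \<Omega>|\<sigma>. (\<Sum>j\<in>UNIV. X x $ j * \<psi> x * \<nu> x $ j))"
    unfolding j by (intro set_integral_sum'[symmetric] \<sigma>_set_integrable continuous_intros b)
  also have "\<dots> = (LINT x:frontier \<Omega>|\<sigma>. (X x \<bullet> \<nu> x) * \<psi> x)"
    by (simp add: inner_vec_def sum_distrib_right sum_distrib_left algebra_simps)
  finally have "(LINT x:\<Omega>|lborel. X x \<bullet> \<psi>' x + div_X x * \<psi> x) = (LINT x:frontier \<Omega>|\<sigma>. (X x \<bullet> \<nu> x) * \<psi> x)" .
  moreover have "(LINT x:\<Omega>|lborel. X x \<bullet> \<psi>' x + div_X x * \<psi> x)
      = (LINT x:\<Omega>|lborel. X x \<bullet> \<psi>' x) + (LINT x:\<Omega>|lborel. div_X x * \<psi> x)"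
    by (intro set_integral_add interior_integrable continuous_intros c)
  moreover have "(LINT x:\<Omega>|lborel. (div_X x + f (u x)) * \<psi> x)
      = (LINT x:\<Omega>|lborel. div_X x * \<psi> x) + (LINT x:\<Omega>|lborel. f (u x) * \<psi> x)"
    unfolding distrib_right by (intro set_integral_add interior_integrable continuous_intros c)
  moreover have "(LINT x:frontier \<Omega>|\<sigma>. (X x \<bullet> \<nu> x + h (u x)) * \<psi> x)
      = (LINT x:frontier \<Omega>|\<sigma>. (X x \<bullet> \<nu> x) * \<psi> x) + (LINT x:frontier \<Omega>|\<sigma>. h (u x) * \<psi> x)"
    unfolding distrib_right by (intro set_integral_add \<sigma>_set_integrable continuous_intros b)
  ultimately show ?thesis using weak_test[OF \<psi>] by simp
qed

text \<open>Test functions with compact support in \<open>\<Omega>\<close> vanish on the frontier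
  and leave only the interior residue, which is continuous.\<close>

lemma equation:
  assumes "x \<in> \<Omega>"
  shows "div_X x = - f (u x)"
proof -
  have "div_X x + f (u x) = 0"
  proof (rule continuous_eq_0_if_integral_test_0[OF open_\<Omega> _ _ assms])
    show "continuous_on \<Omega> (\<lambda>x. div_X x + f (u x))"
      by (intro continuous_intros div_X_continuous continuous_facts closure_subset)
    fix \<theta> \<Theta> K
    assume \<theta>: "C1_with_grad UNIV \<theta> \<Theta>" "compact K" "K \<subseteq> \<Omega>" "\<And>x. x \<notin> K \<Longrightarrow> \<theta> x = 0"
    have z: "\<theta> x = 0" if "x \<in> frontier \<Omega>" for x
    proof (rule \<theta>(4))
      have "x \<notin> \<Omega>" using that open_\<Omega> by (simp add: frontier_def interior_open)
      then show "x \<notin> K" using \<theta>(3) by blast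
    qed
    have "(LINT x:frontier \<Omega>|\<sigma>. (X x \<bullet> \<nu> x + h (u x)) * \<theta> x) = (LINT x:frontier \<Omega>|\<sigma>. 0)"
      by (rule set_lebesgue_integral_cong) (auto simp: sets_surface_measure z)
    then show "(LINT x:\<Omega>|lborel. (div_X x + f (u x)) * \<theta> x) = 0"
      using boundary_identity[OF C1_with_grad_subset[OF \<theta>(1) subset_UNIV]] by simp
  qed
  then show ?thesis by simp
qed

text \<open>With the interior equation the boundary residue is orthogonal to all \<open>C^1\<close>
  functions, in particular to polynomials, which are uniformly dense on the compact frontier.
  Continuous weights matter because the later weight contains the Laplacian of the
  \<open>C^2\<close> function \<open>u\<close>.\<close>

lemma boundary_condition:
  fixes w :: "real^'n \<Rightarrow> real"
  assumes w: "continuous_on (frontier \<Omega>) w"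
  shows "(LINT x:frontier \<Omega>|\<sigma>. (X x \<bullet> \<nu> x + h (u x)) * w x) = 0"
proof -
  let ?q = "\<lambda>x. X x \<bullet> \<nu> x + h (u x)"
  note b = continuous_facts[OF frontier_closure] continuous_on_outer_normal w
  have poly: "(LINT x:frontier \<Omega>|\<sigma>. ?q x * g x) = 0" if "C1_with_grad \<Omega> g G" for g G
  proof -
    have "(LINT x:\<Omega>|lborel. (div_X x + f (u x)) * g x) = (LINT x:\<Omega>|lborel. 0)"
      using open_\<Omega> by (intro set_lebesgue_integral_cong) (auto simp: equation)
    then show ?thesis using boundary_identity[OF that] by simp
  qed
  let ?I = "LINT x:frontier \<Omega>|\<sigma>. ?q x * w x" and ?C = "LINT x:frontier \<Omega>|\<sigma>. \<bar>?q x\<bar>"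
  have le: "\<bar>?I\<bar> \<le> e * ?C" if "e > 0" for e
  proof -
    obtain g where g: "real_polynomial_function g" "\<And>x. x \<in> frontier \<Omega> \<Longrightarrow> \<bar>w x - g x\<bar> < e"
      using Stone_Weierstrass_real_polynomial_function[OF frontier_compact w \<open>e > 0\<close>] by blast
    obtain G where G: "C1_with_grad UNIV g G" using real_polynomial_function_C1[OF g(1)] by blast
    have gc: "continuous_on (frontier \<Omega>) g" by (rule C1_with_grad_UNIV_continuous(1)[OF G])
    have i: "set_integrable \<sigma> (frontier \<Omega>) (\<lambda>x. ?q x * (w x - g x))"
      by (intro \<sigma>_set_integrable continuous_intros b gc)
    have "?I = ?I - (LINT x:frontier \<Omega>|\<sigma>. ?q x * g x)"
      using poly[OF C1_with_grad_subset[OF G subset_UNIV]] by simp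
    also have "\<dots> = (LINT x:frontier \<Omega>|\<sigma>. ?q x * w x - ?q x * g x)"
      by (intro set_integral_diff(2)[symmetric] \<sigma>_set_integrable continuous_intros b gc)
    also have "\<dots> = (LINT x:frontier \<Omega>|\<sigma>. ?q x * (w x - g x))"
      by (simp add: right_diff_distrib)
    also have "\<bar>\<dots>\<bar> \<le> (LINT x:frontier \<Omega>|\<sigma>. e * \<bar>?q x\<bar>)"
    proof -
      have "\<bar>LINT x:frontier \<Omega>|\<sigma>. ?q x * (w x - g x)\<bar> \<le> (LINT x:frontier \<Omega>|\<sigma>. \<bar>?q x * (w x - g x)\<bar>)"
        using set_integral_norm_bound[OF i] by simp
      also have "\<dots> \<le> (LINT x:frontier \<Omega>|\<sigma>. e * \<bar>?q x\<bar>)"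
      proof (rule set_integral_mono)
        show "set_integrable \<sigma> (frontier \<Omega>) (\<lambda>x. \<bar>?q x * (w x - g x)\<bar>)"
          "set_integrable \<sigma> (frontier \<Omega>) (\<lambda>x. e * \<bar>?q x\<bar>)"
          by (intro \<sigma>_set_integrable continuous_intros b gc)+
        fix x assume "x \<in> frontier \<Omega>"
        then have "\<bar>w x - g x\<bar> \<le> e" using g(2) by force
        then show "\<bar>?q x * (w x - g x)\<bar> \<le> e * \<bar>?q x\<bar>"
          unfolding abs_mult by (simp add: mult.commute mult_right_mono)
      qed
      finally show ?thesis .
    qed
    finally show ?thesis by simp
  qed
  have "((\<lambda>e. e * ?C) \<longlongrightarrow> 0 * ?C) (at_right 0)" by (intro tendsto_intros)
  moreover have "\<forall>\<^sub>F e in at_right 0. \<bar>?I\<bar> \<le> e * ?C"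
    unfolding eventually_at_right_field using le by (intro exI[of _ 1]) auto
  ultimately have "\<bar>?I\<bar> \<le> 0"
    using tendsto_lowerbound[of "\<lambda>e. e * ?C" 0 "at_right 0" "\<bar>?I\<bar>"] trivial_limit_at_right_real by simp
  then show ?thesis by simp
qed

text \<open>Sum the tangential identity for the components of \<open>X\<close> over
  \<open>j\<close>. Symmetry of second derivatives identifies \<open>\<partial>_k X_j\<close> with a
  component of \<open>A\<close> applied to the gradient of \<open>u_k\<close>; the divergence of
  \<open>X\<close> is \<open>- f(u)\<close>, and the divergence theorem moves
  \<open>\<partial>_k\<close> from \<open>\<psi>\<close> to \<open>f(u)\<close>.\<close>

lemma linearized_equation:
  assumes \<psi>: "C1_with_grad \<Omega> \<psi> \<psi>'"
  shows "(LINT x:\<Omega>|lborel. (A x *v H k x) \<bullet> \<psi>' x) = (LINT x:\<Omega>|lborel. deriv f (u x) * D x $ k * \<psi> x)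
    + (LINT x:frontier \<Omega>|\<sigma>. (X x \<bullet> \<psi>' x) * \<nu> x $ k - (X x \<bullet> \<nu> x) * \<psi>' x $ k - f (u x) * \<psi> x * \<nu> x $ k)"
proof -
  note c = continuous_facts[OF subset_refl] C1_with_gradD(1,2)[OF \<psi>] div_X_continuous[OF subset_refl]
    continuous_on_matrix_vector_mult
  note b = continuous_facts[OF frontier_closure] C1_with_gradD(1,2)[OF \<psi>, THEN continuous_on_subset[OF _ frontier_closure]]
    continuous_on_outer_normal
  have ptw: "(A x *v H k x) \<bullet> \<psi>' x = (\<Sum>j\<in>UNIV. X' j x $ k * \<psi>' x $ j)" if "x \<in> \<Omega>" for x
  proof -
    have xc: "x \<in> closure \<Omega>" using that closure_subset by blast
    have "X' j x $ k = (A x *v H k x) $ j" for j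
      by (simp add: X'_def matrix_vector_mult_def H_sym[OF xc, of _ k])
    then show ?thesis by (simp add: inner_vec_def)
  qed
  have t: "(LINT x:\<Omega>|lborel. X' j x $ k * \<psi>' x $ j) - (LINT x:\<Omega>|lborel. X' j x $ j * \<psi>' x $ k)
      = (LINT x:frontier \<Omega>|\<sigma>. X x $ j * (\<psi>' x $ j * \<nu> x $ k - \<psi>' x $ k * \<nu> x $ j))" for j
    using tangential_divergence_theorem[OF X_C1 \<psi>, of j "axis k 1" "axis j 1"] by (simp add: inner_axis)
  have "(LINT x:\<Omega>|lborel. (A x *v H k x) \<bullet> \<psi>' x) = (LINT x:\<Omega>|lborel. (\<Sum>j\<in>UNIV. X' j x $ k * \<psi>' x $ j))"
    using open_\<Omega> by (intro set_lebesgue_integral_cong) (auto simp: ptw)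
  also have "\<dots> = (\<Sum>j\<in>UNIV. LINT x:\<Omega>|lborel. X' j x $ k * \<psi>' x $ j)"
    by (intro set_integral_sum' interior_integrable continuous_intros c)
  also have "\<dots> = (\<Sum>j\<in>UNIV. LINT x:\<Omega>|lborel. X' j x $ j * \<psi>' x $ k)
      + (\<Sum>j\<in>UNIV. LINT x:frontier \<Omega>|\<sigma>. X x $ j * (\<psi>' x $ j * \<nu> x $ k - \<psi>' x $ k * \<nu> x $ j))"
    unfolding sum.distrib[symmetric] by (intro sum.cong refl) (simp add: t[symmetric])
  also have "(\<Sum>j\<in>UNIV. LINT x:\<Omega>|lborel. X' j x $ j * \<psi>' x $ k) = (LINT x:\<Omega>|lborel. (\<Sum>j\<in>UNIV. X' j x $ j * \<psi>' x $ k))"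
    by (intro set_integral_sum'[symmetric] interior_integrable continuous_intros c)
  also have "\<dots> = (LINT x:\<Omega>|lborel. - (f (u x) * \<psi>' x $ k))"
    using open_\<Omega> equation
    by (intro set_lebesgue_integral_cong) (auto simp: div_X_def sum_distrib_right[symmetric])
  also have "(\<Sum>j\<in>UNIV. LINT x:frontier \<Omega>|\<sigma>. X x $ j * (\<psi>' x $ j * \<nu> x $ k - \<psi>' x $ k * \<nu> x $ j))
      = (LINT x:frontier \<Omega>|\<sigma>. (\<Sum>j\<in>UNIV. X x $ j * (\<psi>' x $ j * \<nu> x $ k - \<psi>' x $ k * \<nu> x $ j)))"
    by (intro set_integral_sum'[symmetric] \<sigma>_set_integrable continuous_intros b)
  also have "\<dots> = (LINT x:frontier \<Omega>|\<sigma>. (X x \<bullet> \<psi>' x) * \<nu> x $ k - (X x \<bullet> \<nu> x) * \<psi>' x $ k)"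
    by (simp add: inner_vec_def sum_distrib_right sum_distrib_left right_diff_distrib sum_subtractf mult_ac)
  finally have 1: "(LINT x:\<Omega>|lborel. (A x *v H k x) \<bullet> \<psi>' x) = - (LINT x:\<Omega>|lborel. f (u x) * \<psi>' x $ k)
      + (LINT x:frontier \<Omega>|\<sigma>. (X x \<bullet> \<psi>' x) * \<nu> x $ k - (X x \<bullet> \<nu> x) * \<psi>' x $ k)"
    by (simp add: set_lebesgue_integral_def)
  have fu: "C1_with_grad \<Omega> (\<lambda>x. f (u x)) (\<lambda>x. deriv f (u x) *\<^sub>R D x)"
    by (rule C1_with_grad_compose[OF u_C1])
      (use C1_differentiable_on_deriv[OF f] in \<open>auto intro: continuous_on_subset\<close>)
  have "(LINT x:\<Omega>|lborel. f (u x) * \<psi>' x $ k + deriv f (u x) * D x $ k * \<psi> x) = (LINT x:frontier \<Omega>|\<sigma>. f (u x) * \<psi> x * \<nu> x $ k)"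
    using divergence_theorem[OF C1_with_grad_mult[OF fu \<psi>], of "axis k 1"]
    by (simp add: inner_add_left inner_axis mult_ac)
  moreover have "(LINT x:\<Omega>|lborel. f (u x) * \<psi>' x $ k + deriv f (u x) * D x $ k * \<psi> x)
      = (LINT x:\<Omega>|lborel. f (u x) * \<psi>' x $ k) + (LINT x:\<Omega>|lborel. deriv f (u x) * D x $ k * \<psi> x)"
    by (intro set_integral_add interior_integrable continuous_intros c)
  moreover have "(LINT x:frontier \<Omega>|\<sigma>. ((X x \<bullet> \<psi>' x) * \<nu> x $ k - (X x \<bullet> \<nu> x) * \<psi>' x $ k) - f (u x) * \<psi> x * \<nu> x $ k)
      = (LINT x:frontier \<Omega>|\<sigma>. (X x \<bullet> \<psi>' x) * \<nu> x $ k - (X x \<bullet> \<nu> x) * \<psi>' x $ k)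
        - (LINT x:frontier \<Omega>|\<sigma>. f (u x) * \<psi> x * \<nu> x $ k)"
    by (intro set_integral_diff \<sigma>_set_integrable continuous_intros b)
  ultimately show ?thesis using 1 by simp
qed

section \<open>The linearised equation summed over the coordinate directions\<close>

definition lap where "lap x = (\<Sum>k\<in>UNIV. H k x $ k)"
definition normal_H where "normal_H x = (\<chi> i. H i x \<bullet> \<nu> x)"

lemma boundary_facts:
  "continuous_on (frontier \<Omega>) lap" "continuous_on (frontier \<Omega>) normal_H"
  "continuous_on (frontier \<Omega>) (\<lambda>x. a (norm (D x)) * (D x \<bullet> normal_H x))"
proof -
  note b = continuous_facts[OF frontier_closure] continuous_on_outer_normal
  show "continuous_on (frontier \<Omega>) lap"
    unfolding lap_def[abs_def] by (intro continuous_intros b)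
  show n: "continuous_on (frontier \<Omega>) normal_H"
    unfolding normal_H_def[abs_def] by (intro continuous_on_vec_lambda continuous_intros b)
  have "continuous_on (frontier \<Omega>) (\<lambda>x. X x \<bullet> normal_H x)"
    by (intro continuous_intros b n)
  then show "continuous_on (frontier \<Omega>) (\<lambda>x. a (norm (D x)) * (D x \<bullet> normal_H x))"
    by (simp add: X_def)
qed

text \<open>The boundary terms containing \<open>\<phi>'\<close> cancel because the flux \<open>X\<close> is parallel to \<open>D\<close>.\<close>

lemma linearized_energy:
  assumes \<phi>: "C1_with_grad \<Omega> \<phi> \<phi>'"
  shows "(LINT x:\<Omega>|lborel. (\<Sum>k\<in>UNIV. (A x *v H k x) \<bullet> ((\<phi> x)\<^sup>2 *\<^sub>R H k x + (2 * \<phi> x * D x $ k) *\<^sub>R \<phi>' x)))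
    = (LINT x:\<Omega>|lborel. deriv f (u x) * (norm (D x))\<^sup>2 * (\<phi> x)\<^sup>2)
      + (LINT x:frontier \<Omega>|\<sigma>. (a (norm (D x)) * (D x \<bullet> normal_H x) - f (u x) * (D x \<bullet> \<nu> x)
          + h (u x) * lap x) * (\<phi> x)\<^sup>2)"
proof -
  note c = continuous_facts[OF subset_refl] C1_with_gradD(1,2)[OF \<phi>] continuous_on_matrix_vector_mult
  note b = continuous_facts[OF frontier_closure] C1_with_gradD(1,2)[OF \<phi>, THEN continuous_on_subset[OF _ frontier_closure]]
    continuous_on_outer_normal boundary_facts
  define \<psi> where "\<psi> k x = \<phi> x * \<phi> x * D x $ k" for k x
  define \<psi>' where "\<psi>' k x = (\<phi> x)\<^sup>2 *\<^sub>R H k x + (2 * \<phi> x * D x $ k) *\<^sub>R \<phi>' x" for k x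
  have \<psi>: "C1_with_grad \<Omega> (\<psi> k) (\<psi>' k)" for k
  proof -
    have "C1_with_grad \<Omega> (\<psi> k) (\<lambda>x. (\<phi> x * \<phi> x) *\<^sub>R H k x + D x $ k *\<^sub>R (\<phi> x *\<^sub>R \<phi>' x + \<phi> x *\<^sub>R \<phi>' x))"
      unfolding \<psi>_def[abs_def] by (rule C1_with_grad_mult[OF C1_with_grad_mult[OF \<phi> \<phi>] D_C1])
    moreover have "(\<phi> x * \<phi> x) *\<^sub>R H k x + D x $ k *\<^sub>R (\<phi> x *\<^sub>R \<phi>' x + \<phi> x *\<^sub>R \<phi>' x) = \<psi>' k x" for x
      by (simp add: \<psi>'_def power2_eq_square algebra_simps flip: scaleR_add_left)
    ultimately show ?thesis by simp
  qed
  have cl\<psi>: "continuous_on (closure \<Omega>) (\<psi> k)" "continuous_on (closure \<Omega>) (\<psi>' k)" for k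
    using C1_with_gradD[OF \<psi>] by auto
  have b\<psi>: "continuous_on (frontier \<Omega>) (\<psi> k)" "continuous_on (frontier \<Omega>) (\<psi>' k)" for k
    using cl\<psi> frontier_closure continuous_on_subset by blast+
  let ?B = "\<lambda>k x. (X x \<bullet> \<psi>' k x) * \<nu> x $ k - (X x \<bullet> \<nu> x) * \<psi>' k x $ k - f (u x) * \<psi> k x * \<nu> x $ k"
  have "(LINT x:\<Omega>|lborel. (\<Sum>k\<in>UNIV. (A x *v H k x) \<bullet> \<psi>' k x)) = (\<Sum>k\<in>UNIV. LINT x:\<Omega>|lborel. (A x *v H k x) \<bullet> \<psi>' k x)"
    by (intro set_integral_sum' interior_integrable continuous_intros c cl\<psi>)
  also have "\<dots> = (\<Sum>k\<in>UNIV. LINT x:\<Omega>|lborel. deriv f (u x) * D x $ k * \<psi> k x) + (\<Sum>k\<in>UNIV. LINT x:frontier \<Omega>|\<sigma>. ?B k x)"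
    unfolding linearized_equation[OF \<psi>] sum.distrib ..
  also have "(\<Sum>k\<in>UNIV. LINT x:\<Omega>|lborel. deriv f (u x) * D x $ k * \<psi> k x)
      = (LINT x:\<Omega>|lborel. (\<Sum>k\<in>UNIV. deriv f (u x) * D x $ k * \<psi> k x))"
    by (intro set_integral_sum'[symmetric] interior_integrable continuous_intros c cl\<psi>)
  also have "\<dots> = (LINT x:\<Omega>|lborel. deriv f (u x) * (norm (D x))\<^sup>2 * (\<phi> x)\<^sup>2)"
    unfolding power2_norm_eq_inner
    by (simp add: \<psi>_def inner_vec_def sum_distrib_left sum_distrib_right power2_eq_square mult_ac)
  also have "(\<Sum>k\<in>UNIV. LINT x:frontier \<Omega>|\<sigma>. ?B k x) = (LINT x:frontier \<Omega>|\<sigma>. (\<Sum>k\<in>UNIV. ?B k x))"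
    by (intro set_integral_sum'[symmetric] \<sigma>_set_integrable continuous_intros b b\<psi>)
  \<comment> \<open>The normal flux is written as \<open>- h\<close> plus a residue; the residue
    appears with the continuous weight \<open>lap x * (\<phi> x)^2\<close>, so its integral vanishes
    by \<open>boundary_condition\<close>.\<close>
  also have "\<dots> = (LINT x:frontier \<Omega>|\<sigma>. (a (norm (D x)) * (D x \<bullet> normal_H x) - f (u x) * (D x \<bullet> \<nu> x)
      + h (u x) * lap x) * (\<phi> x)\<^sup>2 - (X x \<bullet> \<nu> x + h (u x)) * (lap x * (\<phi> x)\<^sup>2))"
  proof (rule set_lebesgue_integral_cong, simp add: sets_surface_measure, intro allI impI)
    fix x assume "x \<in> frontier \<Omega>"
    then have xc: "x \<in> closure \<Omega>" using frontier_closure by blast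
    let ?c = "a (norm (D x))" and ?p = "\<phi> x"
    have s1: "(\<Sum>k\<in>UNIV. (X x \<bullet> \<psi>' k x) * \<nu> x $ k) = ?p\<^sup>2 * (\<Sum>k\<in>UNIV. (X x \<bullet> H k x) * \<nu> x $ k) + 2 * ?p * (X x \<bullet> \<phi>' x) * (D x \<bullet> \<nu> x)"
      by (simp add: \<psi>'_def inner_add_right distrib_right distrib_left sum.distrib sum_distrib_left
          inner_vec_def[of "D x" "\<nu> x"] mult_ac)
    have s2: "(\<Sum>k\<in>UNIV. (X x \<bullet> \<nu> x) * \<psi>' k x $ k) = (X x \<bullet> \<nu> x) * (?p\<^sup>2 * lap x + 2 * ?p * (D x \<bullet> \<phi>' x))"
      by (simp add: \<psi>'_def lap_def sum.distrib sum_distrib_left inner_vec_def[of "D x" "\<phi>' x"] algebra_simps)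
    have s3: "(\<Sum>k\<in>UNIV. f (u x) * \<psi> k x * \<nu> x $ k) = f (u x) * ?p\<^sup>2 * (D x \<bullet> \<nu> x)"
      by (simp add: \<psi>_def sum_distrib_left inner_vec_def power2_eq_square mult_ac)
    \<comment> \<open>Symmetry of the Hessian turns the contraction of \<open>\<nu>\<close> with the
      index of \<open>u_k\<close> into a normal derivative of the gradient.\<close>
    have s4: "(\<Sum>k\<in>UNIV. (X x \<bullet> H k x) * \<nu> x $ k) = ?c * (D x \<bullet> normal_H x)"
    proof -
      have "(\<Sum>k\<in>UNIV. (D x \<bullet> H k x) * \<nu> x $ k) = (\<Sum>k\<in>UNIV. \<Sum>j\<in>UNIV. D x $ j * H j x $ k * \<nu> x $ k)"
        by (simp add: inner_vec_def sum_distrib_right H_sym[OF xc])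
      also have "\<dots> = (\<Sum>j\<in>UNIV. \<Sum>k\<in>UNIV. D x $ j * H j x $ k * \<nu> x $ k)"
        by (rule sum.swap)
      also have "\<dots> = D x \<bullet> normal_H x"
        by (simp add: inner_vec_def[of "D x"] normal_H_def inner_vec_def[of _ "\<nu> x"] sum_distrib_left mult.assoc)
      finally show ?thesis by (simp add: X_def sum_distrib_left[symmetric] mult.assoc)
    qed
    have s5: "(X x \<bullet> \<phi>' x) * (D x \<bullet> \<nu> x) = (X x \<bullet> \<nu> x) * (D x \<bullet> \<phi>' x)"
      by (simp add: X_def)
    have "(\<Sum>k\<in>UNIV. ?B k x) = (\<Sum>k\<in>UNIV. (X x \<bullet> \<psi>' k x) * \<nu> x $ k) - (\<Sum>k\<in>UNIV. (X x \<bullet> \<nu> x) * \<psi>' k x $ k)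
        - (\<Sum>k\<in>UNIV. f (u x) * \<psi> k x * \<nu> x $ k)"
      by (simp only: sum_subtractf)
    also have "\<dots> = ?p\<^sup>2 * (?c * (D x \<bullet> normal_H x)) - (X x \<bullet> \<nu> x) * (?p\<^sup>2 * lap x) - f (u x) * ?p\<^sup>2 * (D x \<bullet> \<nu> x)
        + 2 * ?p * ((X x \<bullet> \<phi>' x) * (D x \<bullet> \<nu> x) - (X x \<bullet> \<nu> x) * (D x \<bullet> \<phi>' x))"
      unfolding s1 s2 s3 s4 by (simp add: algebra_simps)
    also have "\<dots> = (?c * (D x \<bullet> normal_H x) - f (u x) * (D x \<bullet> \<nu> x) + h (u x) * lap x) * ?p\<^sup>2
        - (X x \<bullet> \<nu> x + h (u x)) * (lap x * ?p\<^sup>2)"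
      unfolding s5 by (simp add: algebra_simps)
    finally show "(\<Sum>k\<in>UNIV. ?B k x) = (?c * (D x \<bullet> normal_H x) - f (u x) * (D x \<bullet> \<nu> x) + h (u x) * lap x) * ?p\<^sup>2
        - (X x \<bullet> \<nu> x + h (u x)) * (lap x * ?p\<^sup>2)" .
  qed
  also have "\<dots> = (LINT x:frontier \<Omega>|\<sigma>. (a (norm (D x)) * (D x \<bullet> normal_H x) - f (u x) * (D x \<bullet> \<nu> x)
      + h (u x) * lap x) * (\<phi> x)\<^sup>2) - (LINT x:frontier \<Omega>|\<sigma>. (X x \<bullet> \<nu> x + h (u x)) * (lap x * (\<phi> x)\<^sup>2))"
    by (intro set_integral_diff \<sigma>_set_integrable continuous_on_mult continuous_on_add continuous_on_diff b
        continuous_on_inner continuous_on_power)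
  also have "(LINT x:frontier \<Omega>|\<sigma>. (X x \<bullet> \<nu> x + h (u x)) * (lap x * (\<phi> x)\<^sup>2)) = 0"
    by (intro boundary_condition continuous_intros b)
  finally show ?thesis by (simp add: \<psi>'_def)
qed

end

subsection \<open>The stability inequality\<close>

lemma cond_A2_nonneg:
  assumes "cond_A2 a" "\<And>t. t > 0 \<Longrightarrow> a t > 0"
  shows "a 0 \<ge> 0"
proof -
  have "(a \<longlongrightarrow> a 0) (at 0 within {0..})"
    using assms(1) by (simp add: cond_A2_def continuous_on_def)
  then have "(a \<longlongrightarrow> a 0) (at_right 0)"
    by (rule tendsto_within_subset) auto
  moreover have "\<forall>\<^sub>F t in at_right 0. 0 \<le> a t"
    unfolding eventually_at_right_field using assms(2) by (intro exI[of _ 1]) (auto intro: less_imp_le)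
  ultimately show ?thesis
    by (rule tendsto_lowerbound) (rule trivial_limit_at_right_real)
qed

lemma A_mat_inner_commute: "(A_mat a \<xi> *v v) \<bullet> w = (A_mat a \<xi> *v w) \<bullet> v"
proof -
  have "(A_mat a \<xi> *v v) \<bullet> w = (\<Sum>i\<in>UNIV. \<Sum>j\<in>UNIV. A_mat a \<xi> $ i $ j * v $ j * w $ i)"
    by (simp add: matrix_vector_mult_def inner_vec_def sum_distrib_right)
  also have "\<dots> = (\<Sum>j\<in>UNIV. \<Sum>i\<in>UNIV. A_mat a \<xi> $ j $ i * w $ i * v $ j)"
    by (subst sum.swap) (intro sum.cong refl, simp add: A_mat_sym[of _ _ _ "i" for i] mult.commute mult.left_commute A_mat_sym)
  also have "\<dots> = (A_mat a \<xi> *v w) \<bullet> v"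
    by (simp add: matrix_vector_mult_def inner_vec_def sum_distrib_right)
  finally show ?thesis .
qed

context robin_solution
begin

text \<open>Half the gradient of \<open>|\<nabla>u|^2\<close>, equal to
  \<open>|\<nabla>u| \<nabla>|\<nabla>u|\<close> where \<open>\<nabla>u\<close> is nonzero. It is
  continuous also at critical points.\<close>

definition P where "P x = (\<Sum>k\<in>UNIV. D x $ k *\<^sub>R H k x)"

lemma P_continuous: "S \<subseteq> closure \<Omega> \<Longrightarrow> continuous_on S P"
  unfolding P_def[abs_def] by (intro continuous_intros continuous_facts)

lemma A_mult_P: "A x *v P x = (\<Sum>k\<in>UNIV. D x $ k *\<^sub>R (A x *v H k x))"
  by (simp add: P_def linear_sum[OF matrix_vector_mul_linear] matrix_vector_mult_scaleR)

lemma P_eq_0: "D x = 0 \<Longrightarrow> P x = 0"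
  by (simp add: P_def)

lemma grad_norm_D:
  assumes x: "x \<in> \<Omega>" and D: "D x \<noteq> 0"
  shows "grad \<Omega> (\<lambda>y. norm (D y)) x = (1 / norm (D x)) *\<^sub>R P x"
proof -
  have "((\<lambda>y. norm (D y)) has_derivative (\<lambda>v. sgn (D x) \<bullet> (\<chi> i. H i x \<bullet> v))) (at x)"
    using has_derivative_compose[OF D_has_derivative[OF x] has_derivative_norm[OF D]] by (simp add: inner_commute)
  then have "frechet_derivative (\<lambda>y. norm (D y)) (at x) = (\<lambda>v. sgn (D x) \<bullet> (\<chi> i. H i x \<bullet> v))"
    by (rule frechet_derivative_at[symmetric])
  then show ?thesis
    using x by (simp add: vec_eq_iff grad_def[of _ "\<lambda>y. norm (D y)"] partial_def[of _ _ "\<lambda>y. norm (D y)"]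
        ext_closure_def inner_axis P_def sgn_div_norm inner_vec_def[of "D x"] divide_inverse mult.commute)
qed

lemma C1_regularized_norm:
  assumes "\<epsilon> > 0"
  shows "C1_with_grad \<Omega> (\<lambda>x. sqrt ((norm (D x))\<^sup>2 + \<epsilon>)) (\<lambda>x. (1 / sqrt ((norm (D x))\<^sup>2 + \<epsilon>)) *\<^sub>R P x)"
proof -
  have n: "(norm (D x))\<^sup>2 = (\<Sum>i\<in>UNIV. D x $ i * D x $ i)" for x
    unfolding power2_norm_eq_inner by (simp add: inner_vec_def)
  have "C1_with_grad \<Omega> (\<lambda>x. (\<Sum>i\<in>UNIV. D x $ i * D x $ i) + \<epsilon>) (\<lambda>x. (\<Sum>i\<in>UNIV. D x $ i *\<^sub>R H i x + D x $ i *\<^sub>R H i x) + 0)"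
    by (intro C1_with_grad_add C1_with_grad_const C1_with_grad_sum C1_with_grad_mult D_C1)
  moreover have "(\<Sum>i\<in>UNIV. D x $ i *\<^sub>R H i x + D x $ i *\<^sub>R H i x) + 0 = 2 *\<^sub>R P x" for x
    by (simp only: P_def sum.distrib scaleR_2 add_0_right)
  ultimately have S: "C1_with_grad \<Omega> (\<lambda>x. (norm (D x))\<^sup>2 + \<epsilon>) (\<lambda>x. 2 *\<^sub>R P x)"
    by (simp only: n)
  have pos: "(norm (D x))\<^sup>2 + \<epsilon> > 0" for x using assms by (simp add: add_nonneg_pos)
  have "C1_with_grad \<Omega> (\<lambda>x. sqrt ((norm (D x))\<^sup>2 + \<epsilon>)) (\<lambda>x. (inverse (sqrt ((norm (D x))\<^sup>2 + \<epsilon>)) / 2) *\<^sub>R (2 *\<^sub>R P x))"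
  proof (rule C1_with_grad_compose[OF S, of sqrt "\<lambda>t. inverse (sqrt t) / 2"])
    show "(sqrt has_real_derivative inverse (sqrt ((norm (D x))\<^sup>2 + \<epsilon>)) / 2) (at ((norm (D x))\<^sup>2 + \<epsilon>))" for x
      using pos by (rule DERIV_real_sqrt)
    show "continuous_on ((\<lambda>x. (norm (D x))\<^sup>2 + \<epsilon>) ` closure \<Omega>) sqrt" by (intro continuous_intros)
    have "\<forall>t\<in>(\<lambda>x. (norm (D x))\<^sup>2 + \<epsilon>) ` closure \<Omega>. sqrt t \<noteq> 0" using pos by (force simp: less_le)
    then show "continuous_on ((\<lambda>x. (norm (D x))\<^sup>2 + \<epsilon>) ` closure \<Omega>) (\<lambda>t. inverse (sqrt t) / 2)"
      by (auto intro!: continuous_intros)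
  qed
  then show ?thesis by (simp add: inverse_eq_divide)
qed

text \<open>With \<open>w^2 = |\<nabla>u|^2 + \<epsilon>\<close> the stability inequality for
  \<open>w \<phi>\<close> contains the same mixed term in \<open>\<phi>\<close> and
  \<open>\<phi>'\<close> as the linearised energy. Elimination removes it together with the main
  \<open>f'\<close> term; what the summand \<open>\<epsilon>\<close> adds to \<open>w^2\<close> is
  collected on the right.\<close>

lemma regularized_inequality:
  assumes stable: "stable_solution \<Omega> a f h u" and \<phi>: "C1_with_grad \<Omega> \<phi> \<phi>'" and \<epsilon>: "\<epsilon> > 0"
  shows "(LINT x:\<Omega>|lborel. ((\<Sum>k\<in>UNIV. (A x *v H k x) \<bullet> H k x) - ((A x *v P x) \<bullet> P x) / ((norm (D x))\<^sup>2 + \<epsilon>)) * (\<phi> x)\<^sup>2)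
    + (LINT x:frontier \<Omega>|\<sigma>. (f (u x) * (D x \<bullet> \<nu> x) - a (norm (D x)) * (D x \<bullet> normal_H x) - h (u x) * lap x
        - deriv h (u x) * (norm (D x))\<^sup>2) * (\<phi> x)\<^sup>2)
    \<le> (LINT x:\<Omega>|lborel. (norm (D x))\<^sup>2 * ((A x *v \<phi>' x) \<bullet> \<phi>' x))
      + \<epsilon> * ((LINT x:\<Omega>|lborel. (A x *v \<phi>' x) \<bullet> \<phi>' x) + (LINT x:frontier \<Omega>|\<sigma>. deriv h (u x) * (\<phi> x)\<^sup>2)
        - (LINT x:\<Omega>|lborel. deriv f (u x) * (\<phi> x)\<^sup>2))"
proof -
  note c = continuous_facts[OF subset_refl] C1_with_gradD(1,2)[OF \<phi>] continuous_on_matrix_vector_mult P_continuous[OF subset_refl]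
  note b = continuous_facts[OF frontier_closure] C1_with_gradD(1,2)[OF \<phi>, THEN continuous_on_subset[OF _ frontier_closure]]
    continuous_on_outer_normal boundary_facts
  let ?r = "\<lambda>x. (norm (D x))\<^sup>2 + \<epsilon>"
  have r: "?r x > 0" for x using \<epsilon> by (simp add: add_nonneg_pos)
  then have r0: "?r x \<noteq> 0" for x by (simp add: less_le)
  define w where "w x = sqrt (?r x)" for x
  have w: "w x > 0" "w x * w x = ?r x" for x using r[of x] by (auto simp: w_def)
  define \<psi>' where "\<psi>' x = w x *\<^sub>R \<phi>' x + \<phi> x *\<^sub>R ((1 / w x) *\<^sub>R P x)" for x
  have \<psi>: "C1_with_grad \<Omega> (\<lambda>x. w x * \<phi> x) \<psi>'"
    unfolding \<psi>'_def[abs_def] w_def by (rule C1_with_grad_mult[OF C1_regularized_norm[OF \<epsilon>] \<phi>])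
  \<comment> \<open>Symmetry of \<open>A\<close> merges the two mixed products, in which
    \<open>w\<close> cancels against \<open>1 / w\<close>; the mixed term is therefore free of
    \<open>\<epsilon>\<close>.\<close>
  have ptw: "(A x *v \<psi>' x) \<bullet> \<psi>' x = ((norm (D x))\<^sup>2 * ((A x *v \<phi>' x) \<bullet> \<phi>' x) + \<epsilon> * ((A x *v \<phi>' x) \<bullet> \<phi>' x))
      + (2 * \<phi> x * ((A x *v P x) \<bullet> \<phi>' x) + ((A x *v P x) \<bullet> P x) / ?r x * (\<phi> x)\<^sup>2)" for x
  proof -
    have "(A x *v \<psi>' x) \<bullet> \<psi>' x = (w x * w x) * ((A x *v \<phi>' x) \<bullet> \<phi>' x) + \<phi> x * ((A x *v \<phi>' x) \<bullet> P x) + \<phi> x * ((A x *v P x) \<bullet> \<phi>' x)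
        + (\<phi> x)\<^sup>2 / (w x * w x) * ((A x *v P x) \<bullet> P x)"
      using w(1)[of x]
      by (simp add: \<psi>'_def matrix_vector_right_distrib matrix_vector_mult_scaleR inner_add_left inner_add_right
          power2_eq_square field_simps)
    then show ?thesis
      unfolding w(2) A_mat_inner_commute[of a "D x" "\<phi>' x" "P x"] by (simp add: algebra_simps)
  qed
  let ?Q = "LINT x:\<Omega>|lborel. (A x *v \<phi>' x) \<bullet> \<phi>' x"
  let ?I5 = "LINT x:\<Omega>|lborel. (norm (D x))\<^sup>2 * ((A x *v \<phi>' x) \<bullet> \<phi>' x)"
  let ?I2 = "LINT x:\<Omega>|lborel. 2 * \<phi> x * ((A x *v P x) \<bullet> \<phi>' x)"
  let ?I4 = "LINT x:\<Omega>|lborel. ((A x *v P x) \<bullet> P x) / ?r x * (\<phi> x)\<^sup>2"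
  let ?I1 = "LINT x:\<Omega>|lborel. (\<Sum>k\<in>UNIV. (A x *v H k x) \<bullet> H k x) * (\<phi> x)\<^sup>2"
  let ?I3 = "LINT x:\<Omega>|lborel. deriv f (u x) * (norm (D x))\<^sup>2 * (\<phi> x)\<^sup>2"
  let ?K = "LINT x:frontier \<Omega>|\<sigma>. deriv h (u x) * (norm (D x))\<^sup>2 * (\<phi> x)\<^sup>2"
  let ?k = "LINT x:frontier \<Omega>|\<sigma>. deriv h (u x) * (\<phi> x)\<^sup>2"
  let ?m = "LINT x:\<Omega>|lborel. deriv f (u x) * (\<phi> x)\<^sup>2"
  let ?J = "LINT x:frontier \<Omega>|\<sigma>. (a (norm (D x)) * (D x \<bullet> normal_H x) - f (u x) * (D x \<bullet> \<nu> x) + h (u x) * lap x) * (\<phi> x)\<^sup>2"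
  note ints = interior_integrable continuous_intros c r0
  have e1: "(LINT x:\<Omega>|lborel. (A x *v \<psi>' x) \<bullet> \<psi>' x) = (?I5 + \<epsilon> * ?Q) + (?I2 + ?I4)"
  proof -
    have "(LINT x:\<Omega>|lborel. (A x *v \<psi>' x) \<bullet> \<psi>' x)
        = (LINT x:\<Omega>|lborel. (norm (D x))\<^sup>2 * ((A x *v \<phi>' x) \<bullet> \<phi>' x) + \<epsilon> * ((A x *v \<phi>' x) \<bullet> \<phi>' x))
        + (LINT x:\<Omega>|lborel. 2 * \<phi> x * ((A x *v P x) \<bullet> \<phi>' x) + ((A x *v P x) \<bullet> P x) / ?r x * (\<phi> x)\<^sup>2)"
      unfolding ptw by (intro set_integral_add ints) (simp add: r0)
    also have "(LINT x:\<Omega>|lborel. (norm (D x))\<^sup>2 * ((A x *v \<phi>' x) \<bullet> \<phi>' x) + \<epsilon> * ((A x *v \<phi>' x) \<bullet> \<phi>' x))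
        = ?I5 + (LINT x:\<Omega>|lborel. \<epsilon> * ((A x *v \<phi>' x) \<bullet> \<phi>' x))"
      by (intro set_integral_add ints)
    also have "(LINT x:\<Omega>|lborel. 2 * \<phi> x * ((A x *v P x) \<bullet> \<phi>' x) + ((A x *v P x) \<bullet> P x) / ?r x * (\<phi> x)\<^sup>2) = ?I2 + ?I4"
      by (intro set_integral_add ints) (simp add: r0)
    finally show ?thesis by simp
  qed
  have e2: "(LINT x:frontier \<Omega>|\<sigma>. deriv h (u x) * (w x * \<phi> x)\<^sup>2) = ?K + \<epsilon> * ?k"
  proof -
    have "deriv h (u x) * (w x * \<phi> x)\<^sup>2 = deriv h (u x) * (norm (D x))\<^sup>2 * (\<phi> x)\<^sup>2 + \<epsilon> * (deriv h (u x) * (\<phi> x)\<^sup>2)" for x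
      using w(2)[of x] by (simp add: power_mult_distrib power2_eq_square[of "w x"] algebra_simps)
    then have "(LINT x:frontier \<Omega>|\<sigma>. deriv h (u x) * (w x * \<phi> x)\<^sup>2)
        = (LINT x:frontier \<Omega>|\<sigma>. deriv h (u x) * (norm (D x))\<^sup>2 * (\<phi> x)\<^sup>2 + \<epsilon> * (deriv h (u x) * (\<phi> x)\<^sup>2))" by simp
    also have "\<dots> = ?K + (LINT x:frontier \<Omega>|\<sigma>. \<epsilon> * (deriv h (u x) * (\<phi> x)\<^sup>2))"
      by (intro set_integral_add \<sigma>_set_integrable continuous_intros b)
    finally show ?thesis by simp
  qed
  have e3: "(LINT x:\<Omega>|lborel. deriv f (u x) * (w x * \<phi> x)\<^sup>2) = ?I3 + \<epsilon> * ?m"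
  proof -
    have "deriv f (u x) * (w x * \<phi> x)\<^sup>2 = deriv f (u x) * (norm (D x))\<^sup>2 * (\<phi> x)\<^sup>2 + \<epsilon> * (deriv f (u x) * (\<phi> x)\<^sup>2)" for x
      using w(2)[of x] by (simp add: power_mult_distrib power2_eq_square[of "w x"] algebra_simps)
    then have "(LINT x:\<Omega>|lborel. deriv f (u x) * (w x * \<phi> x)\<^sup>2)
        = (LINT x:\<Omega>|lborel. deriv f (u x) * (norm (D x))\<^sup>2 * (\<phi> x)\<^sup>2 + \<epsilon> * (deriv f (u x) * (\<phi> x)\<^sup>2))" by simp
    also have "\<dots> = ?I3 + (LINT x:\<Omega>|lborel. \<epsilon> * (deriv f (u x) * (\<phi> x)\<^sup>2))"
      by (intro set_integral_add ints)
    finally show ?thesis by simp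
  qed
  have st: "(LINT x:\<Omega>|lborel. (A x *v \<psi>' x) \<bullet> \<psi>' x) + (LINT x:frontier \<Omega>|\<sigma>. deriv h (u x) * (w x * \<phi> x)\<^sup>2)
      - (LINT x:\<Omega>|lborel. deriv f (u x) * (w x * \<phi> x)\<^sup>2) \<ge> 0"
  proof -
    have "grad \<Omega> (\<lambda>x. w x * \<phi> x) x = \<psi>' x" if "x \<in> \<Omega>" for x
      by (rule C1_with_grad_grad[OF open_\<Omega> \<psi> subsetD[OF closure_subset that]])
    then have eq: "(LINT x:\<Omega>|lborel. (A x *v grad \<Omega> (\<lambda>x. w x * \<phi> x) x) \<bullet> grad \<Omega> (\<lambda>x. w x * \<phi> x) x)
        = (LINT x:\<Omega>|lborel. (A x *v \<psi>' x) \<bullet> \<psi>' x)"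
      using open_\<Omega> by (intro set_lebesgue_integral_cong) auto
    have "(LINT x:\<Omega>|lborel. (A x *v grad \<Omega> \<psi> x) \<bullet> grad \<Omega> \<psi> x) + (LINT x:frontier \<Omega>|\<sigma>. deriv h (u x) * (\<psi> x)\<^sup>2)
      - (LINT x:\<Omega>|lborel. deriv f (u x) * (\<psi> x)\<^sup>2) \<ge> 0" if "Ck_closure 1 \<Omega> \<psi>" for \<psi>
      using stable that unfolding stable_solution_def by blast
    from this[OF C1_with_grad_imp_Ck_closure_1[OF open_\<Omega> \<psi>]] show ?thesis unfolding eq .
  qed
  \<comment> \<open>The linearised energy, with the products
    \<open>D x $ k *\<^sub>R (A x *v H k x)\<close> collected into
    \<open>A x *v P x\<close>.\<close>
  have e4: "?I1 + ?I2 = ?I3 + ?J"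
  proof -
    have "(\<Sum>k\<in>UNIV. (A x *v H k x) \<bullet> ((\<phi> x)\<^sup>2 *\<^sub>R H k x + (2 * \<phi> x * D x $ k) *\<^sub>R \<phi>' x))
        = (\<Sum>k\<in>UNIV. (A x *v H k x) \<bullet> H k x) * (\<phi> x)\<^sup>2 + 2 * \<phi> x * ((A x *v P x) \<bullet> \<phi>' x)" for x
      by (simp add: A_mult_P inner_add_right sum.distrib inner_sum_left sum_distrib_left sum_distrib_right mult_ac)
    then have "?I3 + ?J = (LINT x:\<Omega>|lborel. (\<Sum>k\<in>UNIV. (A x *v H k x) \<bullet> H k x) * (\<phi> x)\<^sup>2 + 2 * \<phi> x * ((A x *v P x) \<bullet> \<phi>' x))"
      using linearized_energy[OF \<phi>] by simp
    also have "\<dots> = ?I1 + ?I2"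
      by (intro set_integral_add ints)
    finally show ?thesis by simp
  qed
  have e5: "(LINT x:\<Omega>|lborel. ((\<Sum>k\<in>UNIV. (A x *v H k x) \<bullet> H k x) - ((A x *v P x) \<bullet> P x) / ?r x) * (\<phi> x)\<^sup>2) = ?I1 - ?I4"
    unfolding left_diff_distrib by (intro set_integral_diff ints) (simp add: r0)
  have e6: "(LINT x:frontier \<Omega>|\<sigma>. (f (u x) * (D x \<bullet> \<nu> x) - a (norm (D x)) * (D x \<bullet> normal_H x) - h (u x) * lap x
        - deriv h (u x) * (norm (D x))\<^sup>2) * (\<phi> x)\<^sup>2) = - ?J - ?K"
  proof -
    have "(LINT x:frontier \<Omega>|\<sigma>. (f (u x) * (D x \<bullet> \<nu> x) - a (norm (D x)) * (D x \<bullet> normal_H x) - h (u x) * lap x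
        - deriv h (u x) * (norm (D x))\<^sup>2) * (\<phi> x)\<^sup>2)
        = (LINT x:frontier \<Omega>|\<sigma>. - 1 * ((a (norm (D x)) * (D x \<bullet> normal_H x) - f (u x) * (D x \<bullet> \<nu> x) + h (u x) * lap x) * (\<phi> x)\<^sup>2)
          - deriv h (u x) * (norm (D x))\<^sup>2 * (\<phi> x)\<^sup>2)"
      by (simp add: algebra_simps)
    also have "\<dots> = (LINT x:frontier \<Omega>|\<sigma>. - 1 * ((a (norm (D x)) * (D x \<bullet> normal_H x) - f (u x) * (D x \<bullet> \<nu> x) + h (u x) * lap x) * (\<phi> x)\<^sup>2)) - ?K"
      by (intro set_integral_diff \<sigma>_set_integrable continuous_on_mult continuous_on_add continuous_on_diff b
          continuous_on_inner continuous_on_power continuous_on_norm continuous_on_const)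
    finally show ?thesis by (simp only: set_integral_mult_right)
  qed
  show ?thesis
    unfolding e5 e6 using st[unfolded e1 e2 e3] e4 by (simp add: algebra_simps)
qed

text \<open>Expand the quotient as a double sum over second derivatives: its coefficients
  \<open>D_k D_j / (|D|^2 + \<epsilon>)\<close> are at most \<open>1\<close> in absolute value, so
  the continuous function \<open>B\<close> dominates uniformly in \<open>\<epsilon>\<close>.\<close>

lemma limit_inequality:
  assumes stable: "stable_solution \<Omega> a f h u" and \<phi>: "C1_with_grad \<Omega> \<phi> \<phi>'"
  defines "L \<equiv> \<lambda>x. ((\<Sum>k\<in>UNIV. (A x *v H k x) \<bullet> H k x) - ((A x *v P x) \<bullet> P x) / (norm (D x))\<^sup>2) * (\<phi> x)\<^sup>2"
  shows "set_integrable lborel \<Omega> L"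
    and "(LINT x:\<Omega>|lborel. L x)
    + (LINT x:frontier \<Omega>|\<sigma>. (f (u x) * (D x \<bullet> \<nu> x) - a (norm (D x)) * (D x \<bullet> normal_H x) - h (u x) * lap x
        - deriv h (u x) * (norm (D x))\<^sup>2) * (\<phi> x)\<^sup>2)
    \<le> (LINT x:\<Omega>|lborel. (norm (D x))\<^sup>2 * ((A x *v \<phi>' x) \<bullet> \<phi>' x))"
proof -
  note c = continuous_facts[OF subset_refl] C1_with_gradD(1,2)[OF \<phi>] continuous_on_matrix_vector_mult P_continuous[OF subset_refl]
  define \<epsilon> where "\<epsilon> n = 1 / real (Suc n)" for n
  have \<epsilon>: "\<epsilon> n > 0" for n by (simp add: \<epsilon>_def)
  have \<epsilon>_lim: "\<epsilon> \<longlonglongrightarrow> 0"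
    unfolding \<epsilon>_def using LIMSEQ_inverse_real_of_nat by (simp add: inverse_eq_divide)
  define l where "l n x = ((\<Sum>k\<in>UNIV. (A x *v H k x) \<bullet> H k x) - ((A x *v P x) \<bullet> P x) / ((norm (D x))\<^sup>2 + \<epsilon> n)) * (\<phi> x)\<^sup>2" for n x
  define B where "B x = ((\<Sum>k\<in>UNIV. \<bar>(A x *v H k x) \<bullet> H k x\<bar>) + (\<Sum>k\<in>UNIV. \<Sum>j\<in>UNIV. \<bar>(A x *v H k x) \<bullet> H j x\<bar>)) * (\<phi> x)\<^sup>2" for x
  have r0: "(norm (D x))\<^sup>2 + \<epsilon> n \<noteq> 0" for n x
    using \<epsilon>[of n] zero_le_power2[of "norm (D x)"] by linarith
  have l_int: "set_integrable lborel \<Omega> (l n)" for n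
    unfolding l_def[abs_def] by (intro interior_integrable continuous_intros c) (simp add: r0)
  have B_int: "set_integrable lborel \<Omega> B"
    unfolding B_def[abs_def] by (intro interior_integrable continuous_intros c)
  have l_le: "\<bar>l n x\<bar> \<le> B x" for n x
  proof -
    let ?r = "(norm (D x))\<^sup>2 + \<epsilon> n"
    have rp: "?r > 0" using \<epsilon>[of n] zero_le_power2[of "norm (D x)"] by linarith
    have "(A x *v P x) \<bullet> P x = (\<Sum>k\<in>UNIV. \<Sum>j\<in>UNIV. D x $ k * D x $ j * ((A x *v H k x) \<bullet> H j x))"
      by (simp add: A_mult_P)
        (simp add: P_def inner_sum_left inner_sum_right sum_distrib_left mult_ac,
          subst sum.swap, simp add: mult_ac)
    then have "\<bar>(A x *v P x) \<bullet> P x / ?r\<bar> = \<bar>\<Sum>k\<in>UNIV. \<Sum>j\<in>UNIV. (D x $ k * D x $ j / ?r) * ((A x *v H k x) \<bullet> H j x)\<bar>"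
      by (simp add: sum_divide_distrib)
    also have "\<dots> \<le> (\<Sum>k\<in>UNIV. \<Sum>j\<in>UNIV. \<bar>(D x $ k * D x $ j / ?r) * ((A x *v H k x) \<bullet> H j x)\<bar>)"
      by (rule order_trans[OF sum_abs]) (intro sum_mono sum_abs)
    also have "\<dots> \<le> (\<Sum>k\<in>UNIV. \<Sum>j\<in>UNIV. \<bar>(A x *v H k x) \<bullet> H j x\<bar>)"
    proof (intro sum_mono)
      fix k j
      have "\<bar>D x $ k\<bar> * \<bar>D x $ j\<bar> \<le> norm (D x) * norm (D x)"
        by (intro mult_mono component_le_norm_cart) auto
      then have "\<bar>D x $ k * D x $ j\<bar> \<le> ?r" using \<epsilon>[of n] by (simp add: abs_mult power2_eq_square)
      then have "\<bar>D x $ k * D x $ j / ?r\<bar> \<le> 1" using rp by (simp add: abs_divide)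
      from mult_right_mono[OF this abs_ge_zero[of "(A x *v H k x) \<bullet> H j x"]]
      show "\<bar>(D x $ k * D x $ j / ?r) * ((A x *v H k x) \<bullet> H j x)\<bar> \<le> \<bar>(A x *v H k x) \<bullet> H j x\<bar>"
        unfolding abs_mult[of "D x $ k * D x $ j / ?r"] by simp
    qed
    finally have "\<bar>(\<Sum>k\<in>UNIV. (A x *v H k x) \<bullet> H k x) - ((A x *v P x) \<bullet> P x) / ?r\<bar>
        \<le> (\<Sum>k\<in>UNIV. \<bar>(A x *v H k x) \<bullet> H k x\<bar>) + (\<Sum>k\<in>UNIV. \<Sum>j\<in>UNIV. \<bar>(A x *v H k x) \<bullet> H j x\<bar>)"
      using sum_abs[of "\<lambda>k. (A x *v H k x) \<bullet> H k x" UNIV] by linarith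
    from mult_right_mono[OF this zero_le_power2[of "\<phi> x"]] show ?thesis
      by (simp add: l_def B_def abs_mult)
  qed
  \<comment> \<open>Where the gradient vanishes, \<open>P x = 0\<close> makes the quotient in
    \<open>l n x\<close> zero for every \<open>n\<close>, and the one in \<open>L x\<close> is zero
    as a division by zero.\<close>
  have l_lim: "(\<lambda>n. l n x) \<longlonglongrightarrow> L x" for x
  proof (cases "D x = 0")
    case True
    then show ?thesis by (simp add: l_def L_def P_eq_0)
  next
    case False
    then have "(norm (D x))\<^sup>2 + 0 \<noteq> 0" by simp
    then have "(\<lambda>n. l n x) \<longlonglongrightarrow> ((\<Sum>k\<in>UNIV. (A x *v H k x) \<bullet> H k x) - ((A x *v P x) \<bullet> P x) / ((norm (D x))\<^sup>2 + 0)) * (\<phi> x)\<^sup>2"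
      unfolding l_def by (intro tendsto_intros \<epsilon>_lim)
    then show ?thesis by (simp add: L_def)
  qed
  note dc = integrable_dominated_convergence[where M=lborel and f="\<lambda>x. indicator \<Omega> x *\<^sub>R L x" and s="\<lambda>n x. indicator \<Omega> x *\<^sub>R l n x"
      and w="\<lambda>x. indicator \<Omega> x *\<^sub>R B x"]
    integral_dominated_convergence[where M=lborel and f="\<lambda>x. indicator \<Omega> x *\<^sub>R L x" and s="\<lambda>n x. indicator \<Omega> x *\<^sub>R l n x"
      and w="\<lambda>x. indicator \<Omega> x *\<^sub>R B x"]
  have lm: "(\<lambda>x. indicator \<Omega> x *\<^sub>R l n x) \<in> borel_measurable lborel" for n
    using l_int[of n] unfolding set_integrable_def by (rule borel_measurable_integrable)
  have lim1: "(\<lambda>n. indicator \<Omega> x *\<^sub>R l n x) \<longlonglongrightarrow> indicator \<Omega> x *\<^sub>R L x" for x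
    by (intro tendsto_intros l_lim)
  have Lm: "(\<lambda>x. indicator \<Omega> x *\<^sub>R L x) \<in> borel_measurable lborel"
    by (rule borel_measurable_LIMSEQ_real[OF lim1 lm])
  have dom: "norm (indicator \<Omega> x *\<^sub>R l n x) \<le> indicator \<Omega> x *\<^sub>R B x" for n x
    using l_le by (simp add: indicator_def)
  show "set_integrable lborel \<Omega> L"
    unfolding set_integrable_def
    by (rule dc(1)) (use Lm lm lim1 dom B_int in \<open>simp_all add: set_integrable_def\<close>)
  have lim: "(\<lambda>n. LINT x:\<Omega>|lborel. l n x) \<longlonglongrightarrow> (LINT x:\<Omega>|lborel. L x)"
    unfolding set_lebesgue_integral_def
    by (rule dc(2)) (use Lm lm lim1 dom B_int in \<open>simp_all add: set_integrable_def\<close>)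
  let ?b = "LINT x:frontier \<Omega>|\<sigma>. (f (u x) * (D x \<bullet> \<nu> x) - a (norm (D x)) * (D x \<bullet> normal_H x) - h (u x) * lap x
        - deriv h (u x) * (norm (D x))\<^sup>2) * (\<phi> x)\<^sup>2"
  let ?R = "LINT x:\<Omega>|lborel. (norm (D x))\<^sup>2 * ((A x *v \<phi>' x) \<bullet> \<phi>' x)"
  let ?C = "(LINT x:\<Omega>|lborel. (A x *v \<phi>' x) \<bullet> \<phi>' x) + (LINT x:frontier \<Omega>|\<sigma>. deriv h (u x) * (\<phi> x)\<^sup>2)
        - (LINT x:\<Omega>|lborel. deriv f (u x) * (\<phi> x)\<^sup>2)"
  have "(LINT x:\<Omega>|lborel. l n x) + ?b \<le> ?R + \<epsilon> n * ?C" for n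
    using regularized_inequality[OF stable \<phi> \<epsilon>[of n]] unfolding l_def .
  moreover have "(\<lambda>n. (LINT x:\<Omega>|lborel. l n x) + ?b) \<longlonglongrightarrow> (LINT x:\<Omega>|lborel. L x) + ?b"
    by (intro tendsto_add tendsto_const lim)
  moreover have "(\<lambda>n. ?R + \<epsilon> n * ?C) \<longlonglongrightarrow> ?R + 0 * ?C"
    by (intro tendsto_add tendsto_const tendsto_mult \<epsilon>_lim)
  ultimately have "(LINT x:\<Omega>|lborel. L x) + ?b \<le> ?R + 0 * ?C"
    by (intro LIMSEQ_le) auto
  then show "(LINT x:\<Omega>|lborel. L x) + ?b \<le> ?R" by simp
qed

lemma geometric_inequality:
  assumes stable: "stable_solution \<Omega> a f h u" and pos: "\<And>t. t > 0 \<Longrightarrow> a t > 0" and \<phi>: "C1_with_grad \<Omega> \<phi> \<phi>'"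
  shows "(LINT x:{x \<in> \<Omega>. D x \<noteq> 0}|lborel. ((\<Sum>k\<in>UNIV. (A x *v H k x) \<bullet> H k x)
        - (A x *v grad \<Omega> (\<lambda>y. norm (D y)) x) \<bullet> grad \<Omega> (\<lambda>y. norm (D y)) x) * (\<phi> x)\<^sup>2)
    + (LINT x:frontier \<Omega>|\<sigma>. (f (u x) * (D x \<bullet> \<nu> x) - a (norm (D x)) * (D x \<bullet> normal_H x) - h (u x) * lap x
        - deriv h (u x) * (norm (D x))\<^sup>2) * (\<phi> x)\<^sup>2)
    \<le> (LINT x:\<Omega>|lborel. (norm (D x))\<^sup>2 * ((A x *v \<phi>' x) \<bullet> \<phi>' x))"
proof -
  let ?S = "{x \<in> \<Omega>. D x \<noteq> 0}"
  let ?L = "\<lambda>x. ((\<Sum>k\<in>UNIV. (A x *v H k x) \<bullet> H k x) - ((A x *v P x) \<bullet> P x) / (norm (D x))\<^sup>2) * (\<phi> x)\<^sup>2"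
  have L: "set_integrable lborel \<Omega> ?L" by (rule limit_inequality(1)[OF stable \<phi>])
  have "open ?S"
  proof -
    have "?S = \<Omega> \<inter> D -` (- {0})" by auto
    then show ?thesis
      using continuous_open_preimage[OF continuous_facts(2)[OF closure_subset] open_\<Omega>, of "- {0}"] by auto
  qed
  then have S: "?S \<in> sets lborel" by simp
  then have LS: "set_integrable lborel ?S ?L"
    by (intro set_integrable_subset[OF L]) auto
  have "(LINT x:?S|lborel. ((\<Sum>k\<in>UNIV. (A x *v H k x) \<bullet> H k x)
        - (A x *v grad \<Omega> (\<lambda>y. norm (D y)) x) \<bullet> grad \<Omega> (\<lambda>y. norm (D y)) x) * (\<phi> x)\<^sup>2) = (LINT x:?S|lborel. ?L x)"
  proof (rule set_lebesgue_integral_cong[OF S], intro allI impI)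
    fix x assume "x \<in> ?S"
    then have "grad \<Omega> (\<lambda>y. norm (D y)) x = (1 / norm (D x)) *\<^sub>R P x" by (intro grad_norm_D) auto
    then show "((\<Sum>k\<in>UNIV. (A x *v H k x) \<bullet> H k x)
        - (A x *v grad \<Omega> (\<lambda>y. norm (D y)) x) \<bullet> grad \<Omega> (\<lambda>y. norm (D y)) x) * (\<phi> x)\<^sup>2 = ?L x"
      by (simp add: matrix_vector_mult_scaleR power2_eq_square)
  qed
  also have "\<dots> \<le> (LINT x:\<Omega>|lborel. ?L x)"
    unfolding set_lebesgue_integral_def
  proof (rule integral_mono)
    show "integrable lborel (\<lambda>x. indicator ?S x *\<^sub>R ?L x)" "integrable lborel (\<lambda>x. indicator \<Omega> x *\<^sub>R ?L x)"
      using L LS by (simp_all add: set_integrable_def)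
    fix x
    show "indicator ?S x *\<^sub>R ?L x \<le> indicator \<Omega> x *\<^sub>R ?L x"
    proof (cases "x \<in> \<Omega> \<and> D x = 0")
      case True
      \<comment> \<open>A critical point excludes \<open>cond_A1\<close>. Under
        \<open>cond_A2\<close> the value \<open>a 0\<close> is a limit of positive ones, and there
        \<open>A\<close> acts as multiplication by it.\<close>
      then have "cond_A2 a" using nondegenerate[OF subsetD[OF closure_subset, of x]] by simp
      then have "a 0 \<ge> 0" using pos by (rule cond_A2_nonneg)
      then have "?L x \<ge> 0"
        using True by (simp add: A_mat_0_mult P_eq_0 sum_nonneg)
      then show ?thesis using True by simp
    qed (auto simp: indicator_def)
  qed
  finally show ?thesis using limit_inequality(2)[OF stable \<phi>] by linarith
qed

end

theorem theorem1p3: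
  fixes \<Omega> :: "(real^'n) set"
    and a f h :: "real \<Rightarrow> real"
    and u \<phi> :: "real^'n \<Rightarrow> real"
  assumes "bounded_smooth_domain \<Omega>"
    and "f C1_differentiable_on UNIV"
    and "h C1_differentiable_on UNIV"
    and "C11_loc_pos a"
    and "\<And>t. t > 0 \<Longrightarrow> a t > 0"
    and "\<And>t. t > 0 \<Longrightarrow> a t + deriv a t * t > 0"
    and "Ck_closure 2 \<Omega> u"
    and "weak_solution \<Omega> a f h u"
    and "stable_solution \<Omega> a f h u"
    and "Ck_closure 1 \<Omega> \<phi>"
  shows
    "(LINT x:{x \<in> \<Omega>. grad \<Omega> u x \<noteq> 0}|lborel.
        ((\<Sum>i\<in>UNIV. (A_mat a (grad \<Omega> u x) *v grad \<Omega> (partial \<Omega> i u) x)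
                      \<bullet> grad \<Omega> (partial \<Omega> i u) x)
         - (A_mat a (grad \<Omega> u x) *v grad \<Omega> (\<lambda>y. norm (grad \<Omega> u y)) x)
             \<bullet> grad \<Omega> (\<lambda>y. norm (grad \<Omega> u y)) x) * (\<phi> x)\<^sup>2)
     + (LINT x:frontier \<Omega>|surface_measure \<Omega>.
         (f (u x) * normal_deriv \<Omega> u x
          - a (norm (grad \<Omega> u x)) * (grad \<Omega> u x \<bullet> normal_deriv_grad \<Omega> u x)
          - h (u x) * laplacian \<Omega> u x
          - deriv h (u x) * (norm (grad \<Omega> u x))\<^sup>2) * (\<phi> x)\<^sup>2)
     \<le> (LINT x:\<Omega>|lborel. (norm (grad \<Omega> u x))\<^sup>2
          * ((A_mat a (grad \<Omega> u x) *v grad \<Omega> \<phi> x) \<bullet> grad \<Omega> \<phi> x))"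
proof -
  interpret robin_solution \<Omega> a f h u
    by unfold_locales (use assms in auto)
  have "normal_deriv \<Omega> u x = D x \<bullet> \<nu> x" "normal_deriv_grad \<Omega> u x = normal_H x" "laplacian \<Omega> u x = lap x" for x
    by (simp_all add: normal_deriv_def normal_deriv_grad_def normal_H_def laplacian_def lap_def grad_def)
  then show ?thesis
    using geometric_inequality[OF assms(9) assms(5) Ck_closure_1_C1_with_grad[OF assms(10)]] by simp
qed

end
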